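(* Let $\mathfrak g=\mathfrak{gl}(m,n)$, let $1\le r\le m$, $1\le s\le n$, $\gamma=\epsilon_r-\delta_s$, and let $\lambda\in\mathfrak h^*$ satisfy $(\lambda+\rho,\gamma)=0$. Then the evaluation at $\lambda$ of the Šapovalov element $\theta_\gamma$ is given by $$\theta_\gamma(\lambda)=(-1)^{m+r}\sum_{j=1}^{m-r+1}\sum_{i=1}^{s}(-1)^{i+j}\ \overrightarrow{\det}\big({}_jA^+(\lambda,r)\big)\ \overleftarrow{\det}\big({}_iA^-(\lambda,s)\big)\,e_{m+i,\,j+r-1}$$ and also by $$\theta_\gamma(\lambda)=\sum_{j=1}^{m-r+1}\sum_{i=1}^{s}e_{m+i,\,j+r-1}\,(-1)^{i+j+r+m}\ \overleftarrow{\det}\big({}_jB^+(\lambda,r)\big)\ \overrightarrow{\det}\big({}_iB^-(\lambda,s)\big).$$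
   Context: The ground field $\mathtt k$ is algebraically closed of characteristic $0$. $\mathfrak{gl}(m,n)$ has matrix units $e_{i,j}$, $1\le i,j\le m+n$, diagonal Cartan subalgebra $\mathfrak h$, $\epsilon_i$ ($1\le i\le m$) and $\delta_j$ ($1\le j\le n$) being the coordinate functions dual to $e_{i,i}$ and $e_{m+j,m+j}$, with form $(\epsilon_i,\epsilon_j)=\delta_{ij}$, $(\delta_i,\delta_j)=-\delta_{ij}$, $(\epsilon_i,\delta_j)=0$. The Borel subalgebra is the distinguished one (upper triangular matrices), with positive even roots $\epsilon_i-\epsilon_j$, $\delta_i-\delta_j$ ($i<j$) and positive odd roots $\epsilon_i-\delta_j$; $\mathfrak n^\pm$ are the strictly upper/lower triangular matrices; $\rho=\frac12\sum_{\rm even}\alpha-\frac12\sum_{\rm odd}\alpha$ over positive roots. The negative root vectors are the matrix units $e_{j,i}$ ($i<j$). For non-isotropic $\alpha$, $\alpha^\vee=2\alpha/(\alpha,\alpha)$. For $\gamma$ a positive odd root, let $h_\gamma\in\mathfrak h$ correspond to $\gamma$ under the form. A Šapovalov element $\theta_\gamma$ for $\gamma$ is an element $\sum_\pi e_{-\pi}H_\pi\in U(\mathfrak n^-\oplus\mathfrak h)$ of weight $-\gamma$, where $H_\pi\in U(\mathfrak h)$, $\pi$ runs over partitions of $\gamma$ into positive roots, and $e_{-\pi}$ is the corresponding ordered product of negative root vectors, such that the coefficient $H_{\pi^0}$ of the partition $\pi^0$ of $\gamma$ into simple roots is $1$, and $e_\alpha\theta_\gamma\in U(\mathfrak g)(h_\gamma+\rho(h_\gamma))+U(\mathfrak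 g)\mathfrak n^+$ for all positive roots $\alpha$. Its evaluation at $\lambda$ is $\theta_\gamma(\lambda)=\sum_\pi H_\pi(\lambda)e_{-\pi}\in U(\mathfrak n^-)$; it is uniquely determined when $(\lambda+\rho,\gamma)=0$. Put $\sigma_{i,j}=\epsilon_i-\epsilon_j$, $\tau_{k,\ell}=\delta_k-\delta_\ell$, $a_j=(\lambda+\rho,\sigma_{r,r+j}^\vee)$ for $1\le j\le m-r$, $b_i=(\lambda+\rho,\tau_{i,s}^\vee)$ for $1\le i\le s-1$. $A^+(\lambda,r)$ is the $(m-r+1)\times(m-r)$ matrix with $(k,l)$ entry $e_{r+l,\,r+k-1}$ if $k\le l$, $-a_l$ if $k=l+1$, and $0$ if $k>l+1$. $A^-(\lambda,s)$ is the $s\times(s-1)$ matrix with $(k,l)$ entry $e_{m+k,\,m+l}$ if $k>l$, $b_l$ if $k=l$, and $0$ if $k<l$. $B^+(\lambda,r)$ (resp. $B^-(\lambda,s)$) is obtained from $A^+(\lambda,r)$ (resp. $A^-(\lambda,s)$) by replacing each $a_l$ by $a_l-1$ (resp. each $b_l$ by $b_l-1$). ${}_jB$ denotes the matrix $B$ with its $j$th row deleted. For a $k\times k$ matrix $B=(b_{i,j})$ with entries in $U(\mathfrak n^-)$, $$\overrightarrow{\det}(B)=\sum_{w\in\mathcal S_k}\mathrm{sign}(w)\,b_{w(1),1}\cdots b_{w(k),k},\qquad \overleftarrow{\det}(B)=\sum_{w\in\mathcal S_k}\mathrm{sign}(w)\,b_{w(k),k}\cdots b_{w(1),1},$$ and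 both equal $1$ when $k=0$ (this applies to ${}_1A^+,{}_1B^+$ if $r=m$ and to ${}_1A^-,{}_1B^-$ if $s=1$). *)

theory Defs
  imports
    "HOL-Library.Poly_Mapping"
    "HOL-Library.Multiset"
    "HOL-Library.Cardinality"
    "HOL-Combinatorics.Permutations"
    "HOL-Computational_Algebra.Polynomial"
begin

section \<open>Free associative algebras\<close>

text \<open>
  The free monoid on \<open>'a\<close>, written additively so that \<open>'a fword \<Rightarrow>\<^sub>0 'k\<close> (with the
  convolution product) is the free associative \<open>'k\<close>-algebra on \<open>'a\<close>.
\<close>

datatype 'a fword = FWord (letters: "'a list")

instantiation fword :: (type) monoid_add
begin

definition zero_fword :: "'a fword" where "0 = FWord []"

definition plus_fword :: "'a fword \<Rightarrow> 'a fword \<Rightarrow> 'a fword"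
  where "v + w = FWord (letters v @ letters w)"

instance
  by standard (auto simp: zero_fword_def plus_fword_def)

end

lemma fword_add_eq_0_iff [simp]: "v + w = 0 \<longleftrightarrow> v = 0 \<and> w = (0 :: 'a fword)"
  by (cases v; cases w) (auto simp: zero_fword_def plus_fword_def)

type_synonym ('a, 'k) free_algebra = "'a fword \<Rightarrow>\<^sub>0 'k"

definition fgen :: "'a \<Rightarrow> ('a, 'k::comm_ring_1) free_algebra"
  where "fgen a = Poly_Mapping.single (FWord [a]) 1"

definition fconst :: "'k \<Rightarrow> ('a, 'k::comm_ring_1) free_algebra"
  where "fconst c = Poly_Mapping.single 0 c"

lemma lookup_mult_0:
  fixes x y :: "('a, 'k::comm_ring_1) free_algebra"
  shows "Poly_Mapping.lookup (x * y) 0 = Poly_Mapping.lookup x 0 * Poly_Mapping.lookup y 0"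
proof -
  have "(\<Sum>q. Poly_Mapping.lookup y q when (0::'a fword) = l + q) =
      (Poly_Mapping.lookup y 0 when l = 0)" for l
  proof (cases "l = 0")
    case False
    then have "(0::'a fword) \<noteq> l + q" for q
      by (metis fword_add_eq_0_iff)
    with False show ?thesis by simp
  qed simp
  then show ?thesis
    by (simp add: lookup_mult mult_when)
qed

section \<open>The enveloping algebra of gl(m,n)\<close>

definition parity :: "nat \<Rightarrow> nat \<times> nat \<Rightarrow> nat"
  where "parity m = (\<lambda>(i, j). if (i \<le> m) = (j \<le> m) then 0 else 1)"

text \<open>
  \<open>T(gl(m,n))\<close> is free on the matrix units, so \<open>U(gl(m,n))\<close> is the free algebra on letters
  \<open>(i,j)\<close>, \<open>1 \<le> i, j \<le> m + n\<close>, modulo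
  \<open>x y - (-1)^(|x| |y|) y x = [x, y]\<close>, where \<open>|x|\<close> is the parity of \<open>x\<close>.
  Letters with an index out of range are set to 0.
\<close>

inductive_set ugl_ideal :: "nat \<Rightarrow> nat \<Rightarrow> (nat \<times> nat, 'k::comm_ring_1) free_algebra set"
  for m n :: nat
where
  super_comm:
    "\<lbrakk>i \<in> {1..m+n}; j \<in> {1..m+n}; k \<in> {1..m+n}; l \<in> {1..m+n}\<rbrakk> \<Longrightarrow>
      fgen (i, j) * fgen (k, l)
        - (-1) ^ (parity m (i, j) * parity m (k, l)) * (fgen (k, l) * fgen (i, j))
        - ((if j = k then fgen (i, l) else 0)
           - (-1) ^ (parity m (i, j) * parity m (k, l)) * (if l = i then fgen (k, j) else 0))
      \<in> ugl_ideal m n"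
| out_of_range: "\<not> (i \<in> {1..m+n} \<and> j \<in> {1..m+n}) \<Longrightarrow> fgen (i, j) \<in> ugl_ideal m n"
| zero: "0 \<in> ugl_ideal m n"
| add: "x \<in> ugl_ideal m n \<Longrightarrow> y \<in> ugl_ideal m n \<Longrightarrow> x + y \<in> ugl_ideal m n"
| mult: "x \<in> ugl_ideal m n \<Longrightarrow> a * x * b \<in> ugl_ideal m n"

lemma ugl_ideal_left: "x \<in> ugl_ideal m n \<Longrightarrow> a * x \<in> ugl_ideal m n"
  using ugl_ideal.mult[of x m n a 1] by simp

lemma ugl_ideal_right: "x \<in> ugl_ideal m n \<Longrightarrow> x * a \<in> ugl_ideal m n"
  using ugl_ideal.mult[of x m n 1 a] by simp

lemma ugl_ideal_uminus: "x \<in> ugl_ideal m n \<Longrightarrow> - x \<in> ugl_ideal m n"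
  using ugl_ideal_left[of x m n "- 1"] by simp

lemma ugl_ideal_augmentation:
  "x \<in> ugl_ideal m n \<Longrightarrow> Poly_Mapping.lookup x 0 = (0 :: 'k::comm_ring_1)"
proof (induction rule: ugl_ideal.induct)
  have gen: "Poly_Mapping.lookup (fgen a) 0 = (0 :: 'k)" for a :: "nat \<times> nat"
    by (simp add: fgen_def lookup_single zero_fword_def)
  {
    case super_comm
    then show ?case by (simp add: lookup_minus lookup_mult_0 gen)
  next
    case out_of_range
    then show ?case by (simp add: gen)
  next
    case zero
    then show ?case by simp
  next
    case add
    then show ?case by (simp add: lookup_add)
  next
    case mult
    then show ?case by (simp add: lookup_mult_0)
  }
qed

lemma one_notin_ugl_ideal: "(1 :: (nat \<times> nat, 'k::comm_ring_1) free_algebra) \<notin> ugl_ideal m n"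
proof
  assume "(1 :: (nat \<times> nat, 'k) free_algebra) \<in> ugl_ideal m n"
  from ugl_ideal_augmentation[OF this] show False
    by (simp add: lookup_one)
qed

text \<open>
  The integers \<open>m\<close> and \<open>n\<close> enter the type of \<open>U(gl(m,n))\<close> as the cardinalities of two
  finite index types.
\<close>

definition ugl_rel ::
  "'m::finite itself \<Rightarrow> 'n::finite itself \<Rightarrow>
   (nat \<times> nat, 'k::comm_ring_1) free_algebra \<Rightarrow> (nat \<times> nat, 'k) free_algebra \<Rightarrow> bool"
  where "ugl_rel _ _ x y \<longleftrightarrow> x - y \<in> ugl_ideal (CARD('m)) (CARD('n))"

lemma equivp_ugl_rel: "equivp (ugl_rel TYPE('m::finite) TYPE('n::finite)
    :: (nat \<times> nat, 'k::comm_ring_1) free_algebra \<Rightarrow> _)"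
proof (rule equivpI)
  show "reflp (ugl_rel TYPE('m) TYPE('n) :: (nat \<times> nat, 'k) free_algebra \<Rightarrow> _)"
    by (rule reflpI) (simp add: ugl_rel_def ugl_ideal.zero)
  show "symp (ugl_rel TYPE('m) TYPE('n) :: (nat \<times> nat, 'k) free_algebra \<Rightarrow> _)"
    by (rule sympI) (metis ugl_rel_def ugl_ideal_uminus minus_diff_eq)
  show "transp (ugl_rel TYPE('m) TYPE('n) :: (nat \<times> nat, 'k) free_algebra \<Rightarrow> _)"
  proof (rule transpI)
    fix x y z :: "(nat \<times> nat, 'k) free_algebra"
    assume "ugl_rel TYPE('m) TYPE('n) x y" "ugl_rel TYPE('m) TYPE('n) y z"
    then have "(x - y) + (y - z) \<in> ugl_ideal (CARD('m)) (CARD('n))"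
      unfolding ugl_rel_def by (rule ugl_ideal.add)
    then show "ugl_rel TYPE('m) TYPE('n) x z"
      by (simp add: ugl_rel_def)
  qed
qed

quotient_type (overloaded) ('k, 'm, 'n) ugl =
    "(nat \<times> nat, 'k::comm_ring_1) free_algebra" / "ugl_rel TYPE('m::finite) TYPE('n::finite)"
  by (rule equivp_ugl_rel)

instantiation ugl :: (comm_ring_1, finite, finite) ring_1
begin

lift_definition zero_ugl :: "('a, 'b, 'c) ugl" is 0 .

lift_definition one_ugl :: "('a, 'b, 'c) ugl" is 1 .

lift_definition plus_ugl :: "('a, 'b, 'c) ugl \<Rightarrow> ('a, 'b, 'c) ugl \<Rightarrow> ('a, 'b, 'c) ugl" is "(+)"
  unfolding ugl_rel_def by (metis add_diff_add ugl_ideal.add)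

lift_definition uminus_ugl :: "('a, 'b, 'c) ugl \<Rightarrow> ('a, 'b, 'c) ugl" is uminus
  unfolding ugl_rel_def by (metis minus_diff_minus ugl_ideal_uminus)

lift_definition minus_ugl :: "('a, 'b, 'c) ugl \<Rightarrow> ('a, 'b, 'c) ugl \<Rightarrow> ('a, 'b, 'c) ugl" is "(-)"
proof -
  fix x x' y y' :: "(nat \<times> nat, 'a) free_algebra"
  assume "ugl_rel TYPE('b) TYPE('c) x x'" "ugl_rel TYPE('b) TYPE('c) y y'"
  then have "(x - x') + - (y - y') \<in> ugl_ideal (CARD('b)) (CARD('c))"
    unfolding ugl_rel_def by (intro ugl_ideal.add ugl_ideal_uminus)
  then show "ugl_rel TYPE('b) TYPE('c) (x - y) (x' - y')"
    by (simp add: ugl_rel_def algebra_simps)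
qed

lift_definition times_ugl :: "('a, 'b, 'c) ugl \<Rightarrow> ('a, 'b, 'c) ugl \<Rightarrow> ('a, 'b, 'c) ugl" is "(*)"
proof -
  fix x x' y y' :: "(nat \<times> nat, 'a) free_algebra"
  assume "ugl_rel TYPE('b) TYPE('c) x x'" "ugl_rel TYPE('b) TYPE('c) y y'"
  then have "(x - x') * y + x' * (y - y') \<in> ugl_ideal (CARD('b)) (CARD('c))"
    unfolding ugl_rel_def by (intro ugl_ideal.add ugl_ideal_left ugl_ideal_right)
  then show "ugl_rel TYPE('b) TYPE('c) (x * y) (x' * y')"
    by (simp add: ugl_rel_def algebra_simps)
qed

instance
proof
  show "(0 :: ('a, 'b, 'c) ugl) \<noteq> 1"
  proof (transfer, unfold ugl_rel_def, rule notI)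
    assume "0 - (1 :: (nat \<times> nat, 'a) free_algebra) \<in> ugl_ideal (CARD('b)) (CARD('c))"
    from ugl_ideal_uminus[OF this] show False
      by (simp add: one_notin_ugl_ideal)
  qed
qed (transfer; simp add: ugl_rel_def ugl_ideal.zero algebra_simps)+

end

lift_definition E :: "nat \<Rightarrow> nat \<Rightarrow> ('k::comm_ring_1, 'm::finite, 'n::finite) ugl"
  is "\<lambda>i j. fgen (i, j)" .

lift_definition scal :: "'k \<Rightarrow> ('k::comm_ring_1, 'm::finite, 'n::finite) ugl"
  is fconst .

section \<open>Weights and roots\<close>

text \<open>
  An element \<open>\<mu>\<close> of the dual of the Cartan subalgebra is given by its coordinates
  \<open>\<mu> i = \<mu>(e\<^sub>i\<^sub>,\<^sub>i)\<close>, and an element \<open>h\<close> of the Cartan subalgebra by its diagonal entries;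
  only the values at \<open>1, \<dots>, m + n\<close> are relevant.
\<close>

type_synonym 'k weight = "nat \<Rightarrow> 'k"

definition coord :: "nat \<Rightarrow> 'k::comm_ring_1 weight"
  where "coord i = (\<lambda>k. if k = i then 1 else 0)"

definition eps :: "nat \<Rightarrow> 'k::comm_ring_1 weight"
  where "eps i = coord i"

definition del :: "nat \<Rightarrow> nat \<Rightarrow> 'k::comm_ring_1 weight"
  where "del m j = coord (m + j)"

definition form :: "nat \<Rightarrow> nat \<Rightarrow> 'k::comm_ring_1 weight \<Rightarrow> 'k weight \<Rightarrow> 'k"
  where "form m n \<mu> \<nu> = (\<Sum>i=1..m. \<mu> i * \<nu> i) - (\<Sum>j=1..n. \<mu> (m + j) * \<nu> (m + j))"

text \<open>The positive root whose root vector is \<open>e\<^sub>i\<^sub>,\<^sub>j\<close> is encoded by the pair \<open>(i, j)\<close>.\<close>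

definition pos_roots :: "nat \<Rightarrow> nat \<Rightarrow> (nat \<times> nat) set"
  where "pos_roots m n = {(i, j). 1 \<le> i \<and> i < j \<and> j \<le> m + n}"

definition even_pos_roots :: "nat \<Rightarrow> nat \<Rightarrow> (nat \<times> nat) set"
  where "even_pos_roots m n = {\<alpha> \<in> pos_roots m n. parity m \<alpha> = 0}"

definition odd_pos_roots :: "nat \<Rightarrow> nat \<Rightarrow> (nat \<times> nat) set"
  where "odd_pos_roots m n = {\<alpha> \<in> pos_roots m n. parity m \<alpha> = 1}"

definition simple_roots :: "nat \<Rightarrow> nat \<Rightarrow> (nat \<times> nat) set"
  where "simple_roots m n = {(i, j) \<in> pos_roots m n. j = i + 1}"

definition root_weight :: "nat \<times> nat \<Rightarrow> 'k::comm_ring_1 weight"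
  where "root_weight = (\<lambda>(i, j) k. coord i k - coord j k)"

definition rho :: "nat \<Rightarrow> nat \<Rightarrow> 'k::field weight"
  where "rho m n = (\<lambda>k. 1/2 * (\<Sum>\<alpha>\<in>even_pos_roots m n. root_weight \<alpha> k)
                      - 1/2 * (\<Sum>\<alpha>\<in>odd_pos_roots m n. root_weight \<alpha> k))"

definition rho_shift :: "nat \<Rightarrow> nat \<Rightarrow> 'k::field weight \<Rightarrow> 'k weight"
  where "rho_shift m n lam = (\<lambda>k. lam k + rho m n k)"

definition coroot :: "nat \<Rightarrow> nat \<Rightarrow> 'k::field weight \<Rightarrow> 'k weight"
  where "coroot m n \<alpha> = (\<lambda>k. 2 * \<alpha> k / form m n \<alpha> \<alpha>)"

definition pairing :: "nat \<Rightarrow> nat \<Rightarrow> 'k::comm_ring_1 weight \<Rightarrow> (nat \<Rightarrow> 'k) \<Rightarrow> 'k"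
  where "pairing m n \<mu> h = (\<Sum>i=1..m+n. \<mu> i * h i)"

text \<open>
  \<open>h\<^sub>\<gamma>\<close> is determined by \<open>\<mu>(h\<^sub>\<gamma>) = (\<mu>, \<gamma>)\<close> for all \<open>\<mu>\<close>; its \<open>i\<close>-th diagonal entry is the
  value on it of the \<open>i\<close>-th coordinate function.
\<close>

definition h_of :: "nat \<Rightarrow> nat \<Rightarrow> 'k::comm_ring_1 weight \<Rightarrow> nat \<Rightarrow> 'k"
  where "h_of m n \<gamma> = (\<lambda>i. form m n (coord i) \<gamma>)"

lemma pairing_h_of: "pairing m n \<mu> (h_of m n \<gamma>) = form m n \<mu> \<gamma>"
proof -
  have 1: "h_of m n \<gamma> i = (if i \<le> m then \<gamma> i else - \<gamma> i)" if "i \<in> {1..m+n}" for i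
  proof (cases "i \<le> m")
    case True
    have "(\<Sum>k=1..m. coord i k * \<gamma> k) = (\<Sum>k=1..m. if k = i then \<gamma> k else 0)"
      by (intro sum.cong) (auto simp: coord_def)
    moreover have "(\<Sum>j=1..n. coord i (m + j) * \<gamma> (m + j)) = 0"
      using True by (intro sum.neutral) (auto simp: coord_def)
    ultimately show ?thesis using True that by (simp add: h_of_def form_def)
  next
    case False
    have "(\<Sum>j=1..n. coord i (m + j) * \<gamma> (m + j)) = (\<Sum>j=1..n. if j = i - m then \<gamma> i else 0)"
      using False by (intro sum.cong) (auto simp: coord_def)
    moreover have "(\<Sum>k=1..m. coord i k * \<gamma> k) = 0"
      using False by (intro sum.neutral) (auto simp: coord_def)
    ultimately show ?thesis using False that by (auto simp: h_of_def form_def)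
  qed
  have "pairing m n \<mu> (h_of m n \<gamma>) = (\<Sum>i=1..m+n. \<mu> i * (if i \<le> m then \<gamma> i else - \<gamma> i))"
    unfolding pairing_def by (intro sum.cong refl) (simp add: 1)
  also have "\<dots> = (\<Sum>i=1..m. \<mu> i * (if i \<le> m then \<gamma> i else - \<gamma> i))
      + (\<Sum>i=m+1..m+n. \<mu> i * (if i \<le> m then \<gamma> i else - \<gamma> i))"
    by (rule sum.ub_add_nat) simp
  also have "(\<Sum>i=m+1..m+n. \<mu> i * (if i \<le> m then \<gamma> i else - \<gamma> i))
      = (\<Sum>j=1..n. \<mu> (m + j) * (if m + j \<le> m then \<gamma> (m + j) else - \<gamma> (m + j)))"
    using sum.shift_bounds_cl_nat_ivl[of "\<lambda>i. \<mu> i * (if i \<le> m then \<gamma> i else - \<gamma> i)" 1 m n]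
    by (simp add: add.commute)
  also have "\<dots> = - (\<Sum>j=1..n. \<mu> (m + j) * \<gamma> (m + j))"
    unfolding sum_negf[symmetric] by (intro sum.cong) auto
  finally show ?thesis by (simp add: form_def)
qed

definition cartan :: "nat \<Rightarrow> nat \<Rightarrow> (nat \<Rightarrow> 'k) \<Rightarrow> ('k::comm_ring_1, 'm::finite, 'n::finite) ugl"
  where "cartan m n h = (\<Sum>i=1..m+n. scal (h i) * E i i)"

section \<open>Sapovalov elements\<close>

text \<open>
  As the Cartan subalgebra is abelian, its enveloping algebra is the polynomial algebra in
  \<open>e\<^sub>i\<^sub>,\<^sub>i\<close>, \<open>1 \<le> i \<le> m + n\<close>. A polynomial is a finitely supported family of
  coefficients indexed by exponent vectors \<open>nat \<Rightarrow>\<^sub>0 nat\<close>.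
\<close>

type_synonym 'k cartan_poly = "(nat \<Rightarrow>\<^sub>0 nat) \<Rightarrow>\<^sub>0 'k"

definition U_cartan :: "nat \<Rightarrow> nat \<Rightarrow> 'k::comm_ring_1 cartan_poly set"
  where "U_cartan m n = {p. \<forall>t \<in> Poly_Mapping.keys p. Poly_Mapping.keys t \<subseteq> {1..m+n}}"

definition cp_eval :: "nat \<Rightarrow> nat \<Rightarrow> 'k::comm_ring_1 weight \<Rightarrow> 'k cartan_poly \<Rightarrow> 'k"
  where "cp_eval m n lam p =
    (\<Sum>t \<in> Poly_Mapping.keys p. Poly_Mapping.lookup p t *
       (\<Prod>i=1..m+n. lam i ^ Poly_Mapping.lookup t i))"

definition cp_embed :: "nat \<Rightarrow> nat \<Rightarrow> 'k::comm_ring_1 cartan_poly \<Rightarrow> ('k, 'm::finite, 'n::finite) ugl"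
  where "cp_embed m n p =
    (\<Sum>t \<in> Poly_Mapping.keys p. scal (Poly_Mapping.lookup p t) *
       prod_list (map (\<lambda>i. E i i ^ Poly_Mapping.lookup t i) [1..<m+n+1]))"

text \<open>
  Every odd root of \<open>gl(m,n)\<close> is isotropic and may occur at most once in a partition. The set
  of partitions of a given root is finite: they correspond to the increasing chains from
  \<open>fst \<gamma>\<close> to \<open>snd \<gamma>\<close>.
\<close>

definition root_partitions ::
  "'k::comm_ring_1 itself \<Rightarrow> nat \<Rightarrow> nat \<Rightarrow> nat \<times> nat \<Rightarrow> (nat \<times> nat) multiset set"
  where "root_partitions _ m n \<gamma> =
    {\<pi>. set_mset \<pi> \<subseteq> pos_roots m n \<and>
        (\<forall>\<alpha> \<in> odd_pos_roots m n. count \<pi> \<alpha> \<le> 1) \<and>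
        (\<forall>k. (\<Sum>\<alpha>\<in>#\<pi>. root_weight \<alpha> k) = (root_weight \<gamma> k :: 'k))}"

text \<open>\<open>rs\<close> lists the positive roots in the order used to form the products \<open>e\<^sub>-\<^sub>\<pi>\<close>.\<close>

definition root_order :: "nat \<Rightarrow> nat \<Rightarrow> (nat \<times> nat) list \<Rightarrow> bool"
  where "root_order m n rs \<longleftrightarrow> distinct rs \<and> set rs = pos_roots m n"

definition e_minus ::
  "(nat \<times> nat) list \<Rightarrow> (nat \<times> nat) multiset \<Rightarrow> ('k::comm_ring_1, 'm::finite, 'n::finite) ugl"
  where "e_minus rs \<pi> = prod_list (map (\<lambda>(i, j). E j i ^ count \<pi> (i, j)) rs)"

definition sap_elem ::
  "nat \<Rightarrow> nat \<Rightarrow> (nat \<times> nat) list \<Rightarrow> nat \<times> nat \<Rightarrow>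
   ((nat \<times> nat) multiset \<Rightarrow> 'k::comm_ring_1 cartan_poly) \<Rightarrow> ('k, 'm::finite, 'n::finite) ugl"
  where "sap_elem m n rs \<gamma> H =
    (\<Sum>\<pi> \<in> root_partitions TYPE('k) m n \<gamma>. e_minus rs \<pi> * cp_embed m n (H \<pi>))"

definition sap_eval ::
  "nat \<Rightarrow> nat \<Rightarrow> (nat \<times> nat) list \<Rightarrow> nat \<times> nat \<Rightarrow>
   ((nat \<times> nat) multiset \<Rightarrow> 'k::comm_ring_1 cartan_poly) \<Rightarrow> 'k weight \<Rightarrow>
   ('k, 'm::finite, 'n::finite) ugl"
  where "sap_eval m n rs \<gamma> H lam =
    (\<Sum>\<pi> \<in> root_partitions TYPE('k) m n \<gamma>. scal (cp_eval m n lam (H \<pi>)) * e_minus rs \<pi>)"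

text \<open>\<open>U(g)(h\<^sub>\<gamma> + \<rho>(h\<^sub>\<gamma>)) + U(g)n\<^sup>+\<close>\<close>

definition sap_left_ideal ::
  "nat \<Rightarrow> nat \<Rightarrow> nat \<times> nat \<Rightarrow> ('k::field, 'm::finite, 'n::finite) ugl set"
  where "sap_left_ideal m n \<gamma> =
    {x * (cartan m n (h_of m n (root_weight \<gamma>))
            + scal (pairing m n (rho m n) (h_of m n (root_weight \<gamma>))))
       + (\<Sum>(i, j) \<in> pos_roots m n. y (i, j) * E i j) | x y. True}"

text \<open>
  The family \<open>H\<close> of coefficients defines a Sapovalov element for the positive odd root \<open>\<gamma>\<close>.
  That the element has weight \<open>-\<gamma>\<close> is built into its shape. The type arguments fix the
  algebra \<open>U(gl(m,n))\<close> in which the condition is imposed.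
\<close>

definition sapovalov ::
  "'m::finite itself \<Rightarrow> 'n::finite itself \<Rightarrow> (nat \<times> nat) list \<Rightarrow> nat \<times> nat \<Rightarrow>
   ((nat \<times> nat) multiset \<Rightarrow> 'k::field cartan_poly) \<Rightarrow> bool"
  where "sapovalov _ _ rs \<gamma> H \<longleftrightarrow>
    (let m = CARD('m); n = CARD('n) in
      (\<forall>\<pi> \<in> root_partitions TYPE('k) m n \<gamma>. H \<pi> \<in> U_cartan m n) \<and>
      (\<forall>\<pi> \<in> root_partitions TYPE('k) m n \<gamma>. set_mset \<pi> \<subseteq> simple_roots m n \<longrightarrow> H \<pi> = 1) \<and>
      (\<forall>(i, j) \<in> pos_roots m n.
         E i j * sap_elem m n rs \<gamma> H \<in> (sap_left_ideal m n \<gamma> :: ('k, 'm, 'n) ugl set)))"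

section \<open>Noncommutative determinants and the matrices A and B\<close>

text \<open>A \<open>k \<times> k\<close> matrix is a function of which only the values at \<open>1 \<le> i, j \<le> k\<close> matter.\<close>

definition det_right :: "nat \<Rightarrow> (nat \<Rightarrow> nat \<Rightarrow> 'a::ring_1) \<Rightarrow> 'a"
  where "det_right k B =
    (\<Sum>w | w permutes {1..k}. of_int (sign w) * prod_list (map (\<lambda>i. B (w i) i) [1..<k+1]))"

definition det_left :: "nat \<Rightarrow> (nat \<Rightarrow> nat \<Rightarrow> 'a::ring_1) \<Rightarrow> 'a"
  where "det_left k B =
    (\<Sum>w | w permutes {1..k}. of_int (sign w) * prod_list (map (\<lambda>i. B (w i) i) (rev [1..<k+1])))"

definition del_row :: "nat \<Rightarrow> (nat \<Rightarrow> nat \<Rightarrow> 'a) \<Rightarrow> nat \<Rightarrow> nat \<Rightarrow> 'a"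
  where "del_row j B = (\<lambda>k l. if k < j then B k l else B (k + 1) l)"

definition a_coef :: "nat \<Rightarrow> nat \<Rightarrow> 'k::field weight \<Rightarrow> nat \<Rightarrow> nat \<Rightarrow> 'k"
  where "a_coef m n lam r j =
    form m n (rho_shift m n lam) (coroot m n (\<lambda>k. eps r k - eps (r + j) k))"

definition b_coef :: "nat \<Rightarrow> nat \<Rightarrow> 'k::field weight \<Rightarrow> nat \<Rightarrow> nat \<Rightarrow> 'k"
  where "b_coef m n lam s i =
    form m n (rho_shift m n lam) (coroot m n (\<lambda>k. del m i k - del m s k))"

definition plus_matrix ::
  "nat \<Rightarrow> (nat \<Rightarrow> 'k) \<Rightarrow> nat \<Rightarrow> nat \<Rightarrow> ('k::comm_ring_1, 'm::finite, 'n::finite) ugl"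
  where "plus_matrix r a = (\<lambda>k l.
    if k \<le> l then E (r + l) (r + k - 1) else if k = l + 1 then - scal (a l) else 0)"

definition minus_matrix ::
  "nat \<Rightarrow> (nat \<Rightarrow> 'k) \<Rightarrow> nat \<Rightarrow> nat \<Rightarrow> ('k::comm_ring_1, 'm::finite, 'n::finite) ugl"
  where "minus_matrix m b = (\<lambda>k l.
    if k > l then E (m + k) (m + l) else if k = l then scal (b l) else 0)"

definition A_plus ::
  "nat \<Rightarrow> nat \<Rightarrow> 'k weight \<Rightarrow> nat \<Rightarrow> nat \<Rightarrow> nat \<Rightarrow> ('k::field, 'm::finite, 'n::finite) ugl"
  where "A_plus m n lam r = plus_matrix r (a_coef m n lam r)"

definition A_minus ::
  "nat \<Rightarrow> nat \<Rightarrow> 'k weight \<Rightarrow> nat \<Rightarrow> nat \<Rightarrow> nat \<Rightarrow> ('k::field, 'm::finite, 'n::finite) ugl"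
  where "A_minus m n lam s = minus_matrix m (b_coef m n lam s)"

definition B_plus ::
  "nat \<Rightarrow> nat \<Rightarrow> 'k weight \<Rightarrow> nat \<Rightarrow> nat \<Rightarrow> nat \<Rightarrow> ('k::field, 'm::finite, 'n::finite) ugl"
  where "B_plus m n lam r = plus_matrix r (\<lambda>l. a_coef m n lam r l - 1)"

definition B_minus ::
  "nat \<Rightarrow> nat \<Rightarrow> 'k weight \<Rightarrow> nat \<Rightarrow> nat \<Rightarrow> nat \<Rightarrow> ('k::field, 'm::finite, 'n::finite) ugl"
  where "B_minus m n lam s = minus_matrix m (\<lambda>l. b_coef m n lam s l - 1)"

end

theory Submission
  imports Defs "HOL-Library.Nat_Bijection"
begin

text \<open>
  A partition of \<open>\<epsilon>\<^sub>r - \<delta>\<^sub>s\<close> is a chain \<open>r = i\<^sub>0 < \<dots> < i\<^sub>k = m + s\<close>. Expanding the determinants, which are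
  Hessenberg up to a reversal of rows and columns, turns both formulas into sums over all chains
  of products of the links, weighted by a factor for each omitted site; they only differ in the
  order of neighbouring links at each site. As \<open>e\<^sub>p\<^sub>,\<^sub>x e\<^sub>x\<^sub>,\<^sub>k - e\<^sub>x\<^sub>,\<^sub>k e\<^sub>p\<^sub>,\<^sub>x = e\<^sub>p\<^sub>,\<^sub>k\<close>, exchanging the neighbours at \<open>x\<close>
  amounts to shifting the weight of \<open>x\<close> by one, so both sums equal the sum with all products
  taken in decreasing order. With these weights the sum is annihilated by \<open>e\<^sub>i\<^sub>,\<^sub>i\<^sub>+\<^sub>1\<close>, \<open>i + 1 < m + s\<close>, on
  a vector of highest weight \<open>\<lambda>\<close>, like \<open>\<theta>\<^sub>\<gamma>(\<lambda>)\<close>; a combination of chain products with this property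
  in which the longest chain does not occur vanishes, by induction on the end of the chain.
  The last step requires chain products to act independently on a highest weight vector of
  arbitrary weight. Instead of a Verma module, and the PBW theorem, it uses a Fock space: for each
  \<open>c\<close> there is a copy of the oscillator representation in which the variables with index below \<open>c\<close> are
  exchanged with their derivatives, the \<open>c\<close>-th variable has an arbitrary exponent, and the parity is
  chosen such that this variable is bosonic.
\<close>

section \<open>Noncommutative determinants\<close>

text \<open>In the first formula the links leaving a site x <= m are multiplied on the right and
  those leaving x > m on the left; in the second it is the other way round. Exchanging neighbours
  where the link stands on the right lowers the weights \<open>a\<close> to \<open>a - 1\<close> in
  the first formula and \<open>-(b - 1)\<close> to \<open>-b\<close> in the second, so both arrive
  at the same weights: this is the origin of the shift between A and B. At most one link of a chain
  is odd, so these exchanges involve no super signs; a sign enters only with the odd simple raising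
  operator at i = m. The defining condition on \<theta> holds modulo a left ideal, so it reaches the
  coefficients only through the action on a vector of highest weight lam, and lam is atypical for
  \<gamma>. Hence the need for a module in which lowering operators act freely for every lam. A
  single oscillator representation is too small; with one copy for each c, the exponent of the c-th
  variable adjusts the c-th coordinate of the weight, and copy p provides fresh modes in which the
  operators e(p,k), k < p, leave distinguishable traces.\<close>

typedef 'a opp = "UNIV :: 'a set" morphisms unopp opp ..

setup_lifting type_definition_opp

instantiation opp :: (ring_1) ring_1
begin

lift_definition zero_opp :: "'a opp" is 0 .
lift_definition one_opp :: "'a opp" is 1 .
lift_definition plus_opp :: "'a opp \<Rightarrow> 'a opp \<Rightarrow> 'a opp" is "(+)" .
lift_definition minus_opp :: "'a opp \<Rightarrow> 'a opp \<Rightarrow> 'a opp" is "(-)" .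
lift_definition uminus_opp :: "'a opp \<Rightarrow> 'a opp" is uminus .
lift_definition times_opp :: "'a opp \<Rightarrow> 'a opp \<Rightarrow> 'a opp" is "\<lambda>x y. y * x" .

instance by standard (transfer; simp add: algebra_simps)+

end

lemma unopp_add: "unopp (x + y) = unopp x + unopp y" by transfer simp
lemma unopp_mult: "unopp (x * y) = unopp y * unopp x" by transfer simp
lemma unopp_one: "unopp 1 = 1" by transfer simp
lemma unopp_zero: "unopp 0 = 0" by transfer simp
lemma unopp_uminus: "unopp (- x) = - unopp x" by transfer simp
lemma unopp_sum: "unopp (sum f A) = (\<Sum>a\<in>A. unopp (f a))"
  by (induction A rule: infinite_finite_induct) (simp_all add: unopp_zero unopp_add)
lemma unopp_prod_list: "unopp (prod_list xs) = prod_list (rev (map unopp xs))"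
  by (induction xs) (simp_all add: unopp_one unopp_mult)
lemma unopp_of_nat: "unopp (of_nat k) = of_nat k"
  by (induction k) (simp_all add: unopp_zero unopp_one unopp_add)
lemma unopp_of_int: "unopp (of_int k) = of_int k"
proof (cases k)
  case (neg n)
  have "unopp (- of_nat (Suc n)) = (- of_nat (Suc n) :: 'a)"
    by (simp only: unopp_uminus unopp_of_nat)
  then show ?thesis by (simp only: neg of_int_minus of_int_of_nat_eq)
qed (simp add: unopp_of_nat)

text \<open>Reversing all products is multiplication in the opposite ring, so each result on one
  determinant yields one on the other.\<close>

lemma det_left_opp: "det_left k B = unopp (det_right k (\<lambda>i j. opp (B i j)))"
proof -
  have c: "x * of_int z = of_int z * x" for x :: 'a and z
    by (rule mult_of_int_commute[symmetric])
  show ?thesis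
    unfolding det_left_def det_right_def
    by (simp add: unopp_sum unopp_mult unopp_of_int unopp_prod_list rev_map comp_def opp_inverse c)
qed

section \<open>Row operations and expansion along the last column\<close>

lemma det_right_cong:
  assumes "\<And>i j. i \<in> {1..k} \<Longrightarrow> j \<in> {1..k} \<Longrightarrow> B i j = C i j"
  shows "det_right k B = det_right k C"
  unfolding det_right_def
proof (rule sum.cong[OF refl])
  fix w assume "w \<in> {w. w permutes {1..k}}"
  then have w: "w permutes {1..k}" by simp
  have "B (w i) i = C (w i) i" if "i \<in> set [1..<k+1]" for i
    using that assms[of "w i" i] permutes_in_image[OF w, of i] by auto
  then have eq: "map (\<lambda>i. B (w i) i) [1..<k+1] = map (\<lambda>i. C (w i) i) [1..<k+1]"
    by (simp only: map_eq_conv) blast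
  then show "of_int (sign w) * prod_list (map (\<lambda>i. B (w i) i) [1..<k+1])
      = of_int (sign w) * prod_list (map (\<lambda>i. C (w i) i) [1..<k+1])"
    by (simp only: eq)
qed

lemma prod_list_zero_ring:
  fixes xs :: "'a::ring_1 list"
  shows "0 \<in> set xs \<Longrightarrow> prod_list xs = 0"
  by (induction xs) auto

lemma det_right_zero_row:
  assumes "i \<in> {1..k}" "\<And>j. j \<in> {1..k} \<Longrightarrow> B i j = 0"
  shows "det_right k B = 0"
  unfolding det_right_def
proof (rule sum.neutral, rule ballI)
  fix w assume "w \<in> {w. w permutes {1..k}}"
  then have w: "w permutes {1..k}" by simp
  obtain j where j: "j \<in> {1..k}" "w j = i"
    using assms(1) permutes_surj[OF w] permutes_in_image[OF w] by (metis surjD)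
  have "0 \<in> set (map (\<lambda>i. B (w i) i) [1..<k+1])"
    unfolding set_map by (rule image_eqI[of _ _ j]) (use j assms(2)[of j] in auto)
  from prod_list_zero_ring[OF this]
  show "of_int (sign w) * prod_list (map (\<lambda>i. B (w i) i) [1..<k+1]) = 0" by simp
qed

text \<open>The order of the factors is dictated by the columns, so rows may be permuted although
  the entries do not commute; for columns this would fail.\<close>

lemma det_right_permute_rows:
  assumes p: "p permutes {1..k}"
  shows "det_right k (\<lambda>i. B (p i)) = of_int (sign p) * det_right k B"
proof -
  have "det_right k B = (\<Sum>w | w permutes {1..k}.
      of_int (sign (p \<circ> w)) * prod_list (map (\<lambda>i. B ((p \<circ> w) i) i) [1..<k+1]))"
    unfolding det_right_def by (rule setum_permutations_compose_left[OF p])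
  also have "\<dots> = (\<Sum>w | w permutes {1..k}.
      of_int (sign p) * (of_int (sign w) * prod_list (map (\<lambda>i. B ((p \<circ> w) i) i) [1..<k+1])))"
  proof (rule sum.cong[OF refl])
    fix w assume "w \<in> {w. w permutes {1..k}}"
    then have "permutation w" "permutation p"
      using p permutes_imp_permutation by (blast intro: finite_atLeastAtMost)+
    then show "of_int (sign (p \<circ> w)) * prod_list (map (\<lambda>i. B ((p \<circ> w) i) i) [1..<k+1])
       = of_int (sign p) * (of_int (sign w) * prod_list (map (\<lambda>i. B ((p \<circ> w) i) i) [1..<k+1]))"
      by (simp add: sign_compose mult.assoc)
  qed
  also have "\<dots> = of_int (sign p) * det_right k (\<lambda>i. B (p i))"
    by (simp add: det_right_def sum_distrib_left)
  finally have "det_right k B = of_int (sign p) * det_right k (\<lambda>i. B (p i))" .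
  moreover have "of_int (sign p) * (of_int (sign p) * x) = x" for x :: 'a
    by (simp add: mult.assoc[symmetric] of_int_mult[symmetric] del: of_int_mult)
  ultimately show ?thesis by simp
qed

text \<open>\<open>c b\<close> is the cycle b -> b+1 -> ... -> k -> b, a product of k - b adjacent
  transpositions, which the downward induction on \<open>b\<close> collects one by one.\<close>

lemma cycle_permutes_sign:
  assumes "b \<le> k" "1 \<le> b"
  defines "c \<equiv> \<lambda>b i. if i < b \<or> k < i then i else if i = k then b else Suc i"
  shows "c b permutes {1..k} \<and> sign (c b) = (-1) ^ (k - b)"
  using assms(1,2)
proof (induction b rule: inc_induct)
  case base
  have "c k = id" by (auto simp: c_def)
  then show ?case by (simp add: permutes_id sign_id del: id_apply)
next
  case (step b)
  then have IH: "c (Suc b) permutes {1..k}" "sign (c (Suc b)) = (-1) ^ (k - Suc b)" by auto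
  have eq: "c b = transpose b (Suc b) \<circ> c (Suc b)"
    using step.hyps by (auto simp: c_def fun_eq_iff transpose_def)
  have t: "transpose b (Suc b) permutes {1..k}"
    using step by (intro permutes_swap_id) auto
  have "k - b = Suc (k - Suc b)" using step.hyps by simp
  moreover have "sign (c b) = - sign (c (Suc b))"
    unfolding eq using IH(1) t
    by (subst sign_compose) (auto intro: permutes_imp_permutation simp: sign_swap_id)
  ultimately show ?case using IH(2) permutes_compose[OF IH(1) t] by (simp add: eq[symmetric])
qed

text \<open>The entry of the last column is always the rightmost factor, so it splits off without
  commuting anything.\<close>

lemma det_right_Suc:
  "det_right (Suc k) B =
     (\<Sum>b=1..Suc k. (-1) ^ (k + 1 - b) * det_right k (del_row b B) * B b (Suc k))"
proof -
  have ins: "{1..Suc k} = insert (Suc k) {1..k}" by auto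
  have "det_right (Suc k) B = (\<Sum>b\<in>insert (Suc k) {1..k}. \<Sum>q | q permutes {1..k}.
      of_int (sign (transpose (Suc k) b \<circ> q)) *
      prod_list (map (\<lambda>i. B ((transpose (Suc k) b \<circ> q) i) i) [1..<Suc k+1]))"
    unfolding det_right_def ins by (rule sum_over_permutations_insert) auto
  also have "\<dots> = (\<Sum>b\<in>insert (Suc k) {1..k}.
      (-1) ^ (k + 1 - b) * det_right k (del_row b B) * B b (Suc k))"
  proof (rule sum.cong[OF refl])
    fix b assume b: "b \<in> insert (Suc k) {1..k}"
    \<comment> \<open>The coset decomposition of the permutations does not delete row
      \<open>b\<close> but puts the last row in its place; the cycle of
      \<open>cycle_permutes_sign\<close> later moves that row back to the end.\<close>
    define C where "C = (\<lambda>i. B (if i = b then Suc k else i))"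
    have "(\<Sum>q | q permutes {1..k}. of_int (sign (transpose (Suc k) b \<circ> q)) *
      prod_list (map (\<lambda>i. B ((transpose (Suc k) b \<circ> q) i) i) [1..<Suc k+1]))
      = (\<Sum>q | q permutes {1..k}. (if b = Suc k then 1 else -1) *
         (of_int (sign q) * prod_list (map (\<lambda>i. C (q i) i) [1..<k+1])) * B b (Suc k))"
    proof (rule sum.cong[OF refl])
      fix q assume "q \<in> {q. q permutes {1..k}}"
      then have q: "q permutes {1..k}" by simp
      have sgn: "sign (transpose (Suc k) b \<circ> q) = (if b = Suc k then 1 else -1) * sign q"
        using permutes_imp_permutation[OF _ q]
        by (simp add: sign_compose permutation_swap_id sign_swap_id)
      have "q (Suc k) = Suc k" using q by (simp add: permutes_not_in)
      moreover have "map (\<lambda>i. B ((transpose (Suc k) b \<circ> q) i) i) [1..<k+1] = map (\<lambda>i. C (q i) i) [1..<k+1]"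
      proof (rule map_cong[OF refl])
        fix i assume "i \<in> set [1..<k+1]"
        then have "q i \<in> {1..k}" using permutes_in_image[OF q, of i] by (simp del: upt_Suc)
        then show "B ((transpose (Suc k) b \<circ> q) i) i = C (q i) i"
          by (auto simp: C_def transpose_def)
      qed
      moreover have "[1..<Suc k+1] = [1..<k+1] @ [Suc k]" by simp
      ultimately have "prod_list (map (\<lambda>i. B ((transpose (Suc k) b \<circ> q) i) i) [1..<Suc k+1])
          = prod_list (map (\<lambda>i. C (q i) i) [1..<k+1]) * B b (Suc k)"
        by (simp only: map_append prod_list.append) simp
      then show "of_int (sign (transpose (Suc k) b \<circ> q)) *
          prod_list (map (\<lambda>i. B ((transpose (Suc k) b \<circ> q) i) i) [1..<Suc k+1])
        = (if b = Suc k then 1 else -1) *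
         (of_int (sign q) * prod_list (map (\<lambda>i. C (q i) i) [1..<k+1])) * B b (Suc k)"
        unfolding sgn by (simp add: mult.assoc)
    qed
    also have "\<dots> = (if b = Suc k then 1 else -1) * det_right k C * B b (Suc k)"
      by (simp add: det_right_def sum_distrib_left sum_distrib_right)
    also have "(if b = Suc k then 1 else -1) * det_right k C = (-1) ^ (k + 1 - b) * det_right k (del_row b B)"
    proof (cases "b = Suc k")
      case True
      have "det_right k C = det_right k (del_row b B)"
        by (rule det_right_cong) (simp add: C_def del_row_def True)
      then show ?thesis using True by simp
    next
      case False
      then have bk: "1 \<le> b" "b \<le> k" using b by auto
      define c where "c = (\<lambda>i. if i < b \<or> k < i then i else if i = k then b else Suc i)"
      have c: "c permutes {1..k}" "sign c = (-1) ^ (k - b)"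
        using cycle_permutes_sign[OF bk(2,1)] unfolding c_def by auto
      have "det_right k (del_row b B) = det_right k (\<lambda>i. C (c i))"
        by (rule det_right_cong) (use bk in \<open>auto simp: C_def c_def del_row_def\<close>)
      also have "\<dots> = of_int (sign c) * det_right k C"
        by (rule det_right_permute_rows[OF c(1)])
      finally have "(-1) ^ (k + 1 - b) * det_right k (del_row b B) 
        = (-1) ^ (k + 1 - b) * (-1) ^ (k - b) * det_right k C" by (simp add: c(2) mult.assoc)
      moreover have "k + 1 - b = Suc (k - b)" using bk by simp
      ultimately show ?thesis using False
        by (simp add: power_add[symmetric] mult_2[symmetric])
    qed
    finally show "(\<Sum>q | q permutes {1..k}. of_int (sign (transpose (Suc k) b \<circ> q)) *
      prod_list (map (\<lambda>i. B ((transpose (Suc k) b \<circ> q) i) i) [1..<Suc k+1]))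
      = (-1) ^ (k + 1 - b) * det_right k (del_row b B) * B b (Suc k)" .
  qed
  finally show ?thesis by (simp only: ins)
qed

text \<open>Conjugating a permutation by the order reversal keeps its sign and reverses the order in
  which the columns are read.\<close>

lemma det_right_reverse:
  "det_right k (\<lambda>i j. B (k + 1 - i) (k + 1 - j)) = det_left k B"
proof -
  define f where "f = (\<lambda>i. if i \<in> {1..k} then k + 1 - i else i)"
  have ff: "f (f i) = i" for i by (auto simp: f_def)
  have f: "f permutes {1..k}"
  proof (rule bij_imp_permutes)
    show "bij_betw f {1..k} {1..k}"
      by (rule bij_betw_byWitness[where f' = f]) (auto simp: ff, auto simp: f_def)
  qed (auto simp: f_def)
  have pf: "permutation f" using f permutes_imp_permutation by blast
  have "det_left k B = (\<Sum>w | w permutes {1..k}. of_int (sign (f \<circ> w)) *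
      prod_list (map (\<lambda>i. B ((f \<circ> w) i) i) (rev [1..<k+1])))"
    unfolding det_left_def by (rule setum_permutations_compose_left[OF f])
  also have "\<dots> = (\<Sum>w | w permutes {1..k}. of_int (sign (f \<circ> (w \<circ> f))) *
      prod_list (map (\<lambda>i. B ((f \<circ> (w \<circ> f)) i) i) (rev [1..<k+1])))"
    by (rule sum_permutations_compose_right[OF f])
  also have "\<dots> = det_right k (\<lambda>i j. B (k + 1 - i) (k + 1 - j))"
    unfolding det_right_def
  proof (rule sum.cong[OF refl])
    fix w assume "w \<in> {w. w permutes {1..k}}"
    then have w: "w permutes {1..k}" by simp
    then have pw: "permutation w" using permutes_imp_permutation by blast
    have "sign f * sign f = 1" using sign_idempotent by blast
    then have s: "sign (f \<circ> (w \<circ> f)) = sign w"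
      using pw pf by (simp add: sign_compose permutation_compose mult.left_commute)
    have r: "rev [1..<k+1] = map f [1..<k+1]"
      by (rule nth_equalityI) (auto simp: f_def rev_nth simp del: upt_Suc)
    have "map (\<lambda>i. B ((f \<circ> (w \<circ> f)) i) i) (rev [1..<k+1])
        = map (\<lambda>i. B (k + 1 - w i) (k + 1 - i)) [1..<k+1]"
      unfolding r map_map
    proof (rule map_cong[OF refl])
      fix i assume "i \<in> set [1..<k+1]"
      then have "i \<in> {1..k}" "w i \<in> {1..k}"
        using permutes_in_image[OF w, of i] by (simp_all del: upt_Suc)
      then show "((\<lambda>i. B ((f \<circ> (w \<circ> f)) i) i) \<circ> f) i = B (k + 1 - w i) (k + 1 - i)"
        by (simp add: ff) (simp add: f_def)
    qed
    then show "of_int (sign (f \<circ> (w \<circ> f))) * prod_list (map (\<lambda>i. B ((f \<circ> (w \<circ> f)) i) i) (rev [1..<k+1]))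
      = of_int (sign w) * prod_list (map (\<lambda>i. B (k + 1 - w i) (k + 1 - i)) [1..<k+1])"
      by (simp only: s)
  qed
  finally show ?thesis ..
qed

section \<open>Hessenberg matrices with central subdiagonal\<close>

text \<open>Abstracts \<open>scal\<close>, so that the determinant calculations can be instantiated
  in the opposite algebra as well.\<close>

locale central_scalars =
  fixes sc :: "'c::comm_ring_1 \<Rightarrow> 'a::ring_1"
  assumes sc_1: "sc 1 = 1"
    and sc_add: "sc (x + y) = sc x + sc y"
    and sc_mult: "sc (x * y) = sc x * sc y"
    and sc_central: "sc x * a = a * sc x"
begin

lemma sc_0: "sc 0 = 0" using sc_add[of 0 0] by simp

lemma sc_minus: "sc (- x) = - sc x"
  using sc_add[of x "- x"] by (simp add: sc_0 eq_neg_iff_add_eq_0 add.commute)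

lemma sc_diff: "sc (x - y) = sc x - sc y"
  using sc_add[of x "- y"] by (simp add: sc_minus)

lemma sc_power: "sc (x ^ k) = sc x ^ k"
  by (induction k) (simp_all add: sc_1 sc_mult)

lemma sc_left_commute: "a * (sc x * b) = sc x * (a * b)"
  by (metis mult.assoc sc_central)

text \<open>Without row \<open>j\<close> the matrix is block triangular: the upper left block is
  untouched, and the lower right one is upper triangular with the entries \<open>z l\<close>, l >=
  j, on its diagonal. As these are central, they can be pulled to the front.\<close>

lemma hessenberg_del_row:
  assumes z: "\<And>l. 1 \<le> l \<Longrightarrow> l \<le> p \<Longrightarrow> M (l + 1) l = sc (z l)"
    and 0: "\<And>k l. 1 \<le> l \<Longrightarrow> l \<le> p \<Longrightarrow> l + 1 < k \<Longrightarrow> k \<le> p + 1 \<Longrightarrow> M k l = 0"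
    and j: "1 \<le> j" "j \<le> p + 1"
  shows "det_right p (del_row j M) = sc (\<Prod>l=j..p. z l) * det_right (j - 1) M"
  using assms
proof (induction p)
  case 0
  then have "j = 1" by simp
  then show ?case by (simp add: sc_1 det_right_def)
next
  case (Suc p)
  show ?case
  proof (cases "j = Suc p + 1")
    case True
    have "det_right (Suc p) (del_row j M) = det_right (Suc p) M"
      by (rule det_right_cong) (simp add: del_row_def True)
    then show ?thesis using True by (simp add: sc_1)
  next
    case False
    then have j': "j \<le> p + 1" using Suc.prems(4) by simp
    have "det_right (Suc p) (del_row j M) = (\<Sum>b=1..Suc p. (-1) ^ (p + 1 - b) *
        det_right p (del_row b (del_row j M)) * del_row j M b (Suc p))"
      by (rule det_right_Suc)
    also have "\<dots> = (\<Sum>b=1..Suc p. if b = Suc p then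
        det_right p (del_row (Suc p) (del_row j M)) * M (Suc p + 1) (Suc p) else 0)"
    proof (rule sum.cong[OF refl])
      fix b assume b: "b \<in> {1..Suc p}"
      show "(-1) ^ (p + 1 - b) * det_right p (del_row b (del_row j M)) * del_row j M b (Suc p) =
        (if b = Suc p then det_right p (del_row (Suc p) (del_row j M)) * M (Suc p + 1) (Suc p) else 0)"
      proof (cases "b = Suc p")
        case True
        then show ?thesis using j' by (simp add: del_row_def)
      next
        case False
        \<comment> \<open>The last remaining row is row p + 2 of \<open>M\<close>, which lies
          strictly below the subdiagonal in the columns up to p.\<close>
        have "det_right p (del_row b (del_row j M)) = 0"
        proof (rule det_right_zero_row[where i = p])
          show "p \<in> {1..p}" using False b by auto
          show "del_row b (del_row j M) p l = 0" if "l \<in> {1..p}" for l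
            using Suc.prems(2)[of l "p + 2"] that False b j' by (auto simp: del_row_def)
        qed
        then show ?thesis using False by simp
      qed
    qed
    also have "\<dots> = det_right p (del_row (Suc p) (del_row j M)) * sc (z (Suc p))"
      using Suc.prems(1)[of "Suc p"] by simp
    also have "det_right p (del_row (Suc p) (del_row j M)) = det_right p (del_row j M)"
      by (rule det_right_cong) (simp add: del_row_def)
    also have "\<dots> = sc (\<Prod>l=j..p. z l) * det_right (j - 1) M"
      by (rule Suc.IH) (use Suc.prems j' in auto)
    also have "\<dots> * sc (z (Suc p)) = sc (\<Prod>l=j..Suc p. z l) * det_right (j - 1) M"
    proof -
      have "(\<Prod>l=j..Suc p. z l) = (\<Prod>l=j..p. z l) * z (Suc p)"
        using j' by simp
      then show ?thesis
        by (simp only: sc_mult mult.assoc sc_central[of "z (Suc p)" "det_right (j - 1) M"])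
    qed
    finally show ?thesis .
  qed
qed

text \<open>Every cofactor of the last column is a Hessenberg matrix with a deleted row. Its sign is
  absorbed by negating the q - k subdiagonal entries that it contributes.\<close>

lemma hessenberg_recursion:
  assumes z: "\<And>l. 1 \<le> l \<Longrightarrow> l < q \<Longrightarrow> M (l + 1) l = sc (z l)"
    and 0: "\<And>k l. 1 \<le> l \<Longrightarrow> l < q \<Longrightarrow> l + 1 < k \<Longrightarrow> k \<le> q \<Longrightarrow> M k l = 0"
    and q: "1 \<le> q"
  shows "det_right q M = (\<Sum>k=1..q. sc (\<Prod>l=k..<q. - z l) * det_right (k - 1) M * M k q)"
proof -
  obtain p where p: "q = Suc p" using q by (cases q) auto
  have "det_right q M = (\<Sum>b=1..q. (-1) ^ (p + 1 - b) * det_right p (del_row b M) * M b q)"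
    unfolding p by (rule det_right_Suc)
  also have "\<dots> = (\<Sum>k=1..q. sc (\<Prod>l=k..<q. - z l) * det_right (k - 1) M * M k q)"
  proof (rule sum.cong[OF refl])
    fix k assume k: "k \<in> {1..q}"
    have "det_right p (del_row k M) = sc (\<Prod>l=k..p. z l) * det_right (k - 1) M"
      by (rule hessenberg_del_row) (use assms k p in auto)
    moreover have "(-1) ^ (p + 1 - k) * sc (\<Prod>l=k..p. z l) = sc (\<Prod>l=k..<q. - z l)"
    proof -
      have "(\<Prod>l=k..<q. - z l) = (-1) ^ (p + 1 - k) * (\<Prod>l=k..p. z l)"
        by (simp add: p prod_uminus atLeastLessThanSuc_atLeastAtMost)
      then show ?thesis by (simp add: sc_mult sc_power sc_minus sc_1)
    qed
    ultimately show "(-1) ^ (p + 1 - k) * det_right p (del_row k M) * M k q =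
        sc (\<Prod>l=k..<q. - z l) * det_right (k - 1) M * M k q"
      by (simp only: mult.assoc[symmetric])
  qed
  finally show ?thesis .
qed

lemma central_scalars_opp: "central_scalars (\<lambda>x. opp (sc x))"
proof
  show "opp (sc x) * a = a * opp (sc x)" for x and a :: "'a opp"
    by (simp only: unopp_inject[symmetric] unopp_mult opp_inverse[OF UNIV_I] sc_central)
qed (simp_all only: unopp_inject[symmetric] unopp_mult unopp_add unopp_one opp_inverse[OF UNIV_I]
  sc_1 sc_add sc_mult sc_central[of y "sc x" for x y])

end

section \<open>The Fock space\<close>

text \<open>The operators act on all functions of states, not only on finitely supported ones:
  \<open>up\<close> and \<open>down\<close> read a single value of the argument, so no question of
  finiteness arises.\<close>

typedef (overloaded) ('s, 'k::field) lop =
    "{L :: ('s \<Rightarrow> 'k) \<Rightarrow> 's \<Rightarrow> 'k.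
       (\<forall>f g. L (\<lambda>x. f x + g x) = (\<lambda>x. L f x + L g x)) \<and>
       (\<forall>c f. L (\<lambda>x. c * f x) = (\<lambda>x. c * L f x))}"
  morphisms app Lop
  by (rule exI[of _ "\<lambda>f. f"]) simp

setup_lifting type_definition_lop

instantiation lop :: (type, field) ring_1
begin

lift_definition zero_lop :: "('a, 'b) lop" is "\<lambda>f x. 0" by simp
lift_definition one_lop :: "('a, 'b) lop" is "\<lambda>f. f" by simp
lift_definition plus_lop :: "('a, 'b) lop \<Rightarrow> ('a, 'b) lop \<Rightarrow> ('a, 'b) lop"
  is "\<lambda>L M f x. L f x + M f x" by (simp add: algebra_simps)
lift_definition minus_lop :: "('a, 'b) lop \<Rightarrow> ('a, 'b) lop \<Rightarrow> ('a, 'b) lop"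
  is "\<lambda>L M f x. L f x - M f x" by (simp add: algebra_simps)
lift_definition uminus_lop :: "('a, 'b) lop \<Rightarrow> ('a, 'b) lop"
  is "\<lambda>L f x. - L f x" by simp
lift_definition times_lop :: "('a, 'b) lop \<Rightarrow> ('a, 'b) lop \<Rightarrow> ('a, 'b) lop"
  is "\<lambda>L M f. L (M f)" by simp

instance
proof
  show "(0 :: ('a, 'b) lop) \<noteq> 1"
    by transfer (metis one_neq_zero)
qed (transfer; simp add: fun_eq_iff algebra_simps)+

end

lift_definition lscal :: "'k \<Rightarrow> ('s, 'k::field) lop" is "\<lambda>c f x. c * f x"
  by (simp add: algebra_simps)

lemma lop_eqI: "(\<And>f s. app X f s = app Y f s) \<Longrightarrow> X = Y"
  by (metis app_inject ext)

lemma app_0_left: "app 0 f = (\<lambda>x. 0)" by transfer simp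
lemma app_1: "app 1 f = f" by transfer simp
lemma app_plus: "app (X + Y) f s = app X f s + app Y f s" by transfer simp
lemma app_minus: "app (X - Y) f s = app X f s - app Y f s" by transfer simp
lemma app_uminus: "app (- X) f s = - app X f s" by transfer simp
lemma app_times: "app (X * Y) f = app X (app Y f)" by transfer simp
lemma app_lscal: "app (lscal c) f s = c * f s" by transfer simp
lemma app_sum: "app (sum X A) f s = (\<Sum>a\<in>A. app (X a) f s)"
  by (induction A rule: infinite_finite_induct) (simp_all add: app_0_left app_plus)
lemma app_scale: "app X (\<lambda>x. c * f x) = (\<lambda>x. c * app X f x)"
  by transfer simp
lemma app_0_right: "app X (\<lambda>x. 0) = (\<lambda>x. 0)"
  using app_scale[of X 0 "\<lambda>x. 0"] by simp

lemma lscal_0: "lscal 0 = 0" and lscal_1: "lscal 1 = 1"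
  and lscal_add: "lscal (a + b) = lscal a + lscal b"
  and lscal_mult: "lscal (a * b) = lscal a * lscal b"
  and lscal_central: "lscal a * X = X * lscal a"
  by (transfer; simp add: fun_eq_iff algebra_simps)+

text \<open>
  A state assigns an exponent to every mode \<open>(i, c)\<close>, where \<open>c\<close> numbers the copy. For \<open>i < c\<close> the
  exponent \<open>-1 - x\<close> stands for the \<open>x\<close>-th power of the dual variable, so the vacuum has exponent
  \<open>-1\<close> there. All integers are admitted as exponents: the coefficients vanish where needed, and
  fermionic modes only see the parity of the exponent. The Jordan--Wigner sign \<open>jw\<close> orders
  the modes by \<open>prod_encode\<close>.
\<close>

definition fermi :: "nat \<Rightarrow> nat \<times> nat \<Rightarrow> bool"
  where "fermi m = (\<lambda>(i, c). (i \<le> m) \<noteq> (c \<le> m))"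

definition jw :: "nat \<Rightarrow> nat \<times> nat \<Rightarrow> (nat \<times> nat \<Rightarrow> int) \<Rightarrow> 'k::field"
  where "jw m q s = (if fermi m q then
    (\<Prod>k<prod_encode q. if fermi m (prod_decode k) \<and> odd (s (prod_decode k)) then -1 else 1)
    else 1)"

text \<open>The argument \<open>x\<close> is the exponent after the operation. For a bosonic mode
  with i < c, \<open>up\<close> sends the n-th power of the dual variable to -n times the power n -
  1, hence it is minus the derivative; for i >= c it is multiplication by the variable.\<close>

definition up_coef :: "nat \<Rightarrow> nat \<times> nat \<Rightarrow> int \<Rightarrow> 'k::field"
  where "up_coef m q x = (if fermi m q then if odd x then 1 else 0
     else if fst q < snd q then of_int x else 1)"

text \<open>For a bosonic mode with i >= c this is the derivative. The shift \<open>al\<close>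
  concerns only the modes (c, c), which are always bosonic: the variable has exponent x + al
  there.\<close>

definition down_coef :: "nat \<Rightarrow> (nat \<Rightarrow> 'k) \<Rightarrow> nat \<times> nat \<Rightarrow> int \<Rightarrow> 'k::field"
  where "down_coef m al q x = (if fermi m q then if even x then 1 else 0
     else if fst q < snd q then 1
     else of_int (x + 1) + (if fst q = snd q then al (fst q) else 0))"

lift_definition up :: "nat \<Rightarrow> nat \<times> nat \<Rightarrow> (nat \<times> nat \<Rightarrow> int, 'k::field) lop"
  is "\<lambda>m q f s. jw m q s * up_coef m q (s q) * f (s(q := s q - 1))"
  by (simp add: algebra_simps)

lift_definition down ::
  "nat \<Rightarrow> (nat \<Rightarrow> 'k) \<Rightarrow> nat \<times> nat \<Rightarrow> (nat \<times> nat \<Rightarrow> int, 'k::field) lop"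
  is "\<lambda>m al q f s. jw m q s * down_coef m al q (s q) * f (s(q := s q + 1))"
  by (simp add: algebra_simps)

section \<open>Canonical commutation and anticommutation relations\<close>

definition koszul :: "nat \<Rightarrow> nat \<times> nat \<Rightarrow> nat \<times> nat \<Rightarrow> int"
  where "koszul m q p = (if fermi m q \<and> fermi m p then -1 else 1)"

lemma jw_square: "jw m q s * jw m q s = (1 :: 'k::field)"
  by (auto simp: jw_def prod.distrib[symmetric] simp del: prod.distrib intro!: prod.neutral)

lemma jw_neq_0: "jw m q s \<noteq> (0 :: 'k::field)"
  using jw_square[of m q s, where 'k='k] by (metis mult_zero_left one_neq_zero)

lemma jw_upd_same: "jw m q (s(q := x)) = jw m q s"
  unfolding jw_def by (intro if_cong refl prod.cong) auto

definition jw_sign :: "nat \<Rightarrow> nat \<times> nat \<Rightarrow> nat \<times> nat \<Rightarrow> int"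
  where "jw_sign m q p =
    (if fermi m q \<and> fermi m p \<and> prod_encode p < prod_encode q then -1 else 1)"

text \<open>A change of parity at \<open>p\<close> flips exactly one factor of the product defining
  \<open>jw m q\<close> if \<open>p\<close> is fermionic and precedes the fermionic mode
  \<open>q\<close>, and none otherwise.\<close>

lemma jw_upd_other:
  assumes "odd (x - s p)" "p \<noteq> q"
  shows "jw m q (s(p := x)) = of_int (jw_sign m q p) * (jw m q s :: 'k::field)"
proof (cases "fermi m q \<and> fermi m p \<and> prod_encode p < prod_encode q")
  case True
  let ?g = "\<lambda>s k. if fermi m (prod_decode k) \<and> odd (s (prod_decode k)) then -1 else (1::'k)"
  have s: "{..<prod_encode q} = insert (prod_encode p) ({..<prod_encode q} - {prod_encode p})"
    using True by auto
  have "(\<Prod>k<prod_encode q. ?g (s(p := x)) k)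
     = ?g (s(p := x)) (prod_encode p) * (\<Prod>k\<in>{..<prod_encode q} - {prod_encode p}. ?g (s(p := x)) k)"
    by (subst s, subst prod.insert) auto
  also have "(\<Prod>k\<in>{..<prod_encode q} - {prod_encode p}. ?g (s(p := x)) k)
      = (\<Prod>k\<in>{..<prod_encode q} - {prod_encode p}. ?g s k)"
    by (intro prod.cong refl) auto
  also have "?g (s(p := x)) (prod_encode p) = - ?g s (prod_encode p)"
    using assms True by auto
  also have "- ?g s (prod_encode p) * (\<Prod>k\<in>{..<prod_encode q} - {prod_encode p}. ?g s k)
      = - (\<Prod>k<prod_encode q. ?g s k)"
    by (subst (2) s, subst prod.insert) auto
  finally show ?thesis using True by (simp add: jw_def jw_sign_def)
next
  case False
  have "jw m q (s(p := x)) = (jw m q s :: 'k)"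
    unfolding jw_def
  proof (intro if_cong refl prod.cong)
    fix k assume q: "fermi m q" and k: "k \<in> {..<prod_encode q}"
    show "(fermi m (prod_decode k) \<and> odd ((s(p := x)) (prod_decode k))) =
          (fermi m (prod_decode k) \<and> odd (s (prod_decode k)))"
      using False q k by (cases "prod_decode k = p") auto
  qed
  then show ?thesis using False by (auto simp: jw_sign_def)
qed

text \<open>Of two distinct modes exactly one precedes the other, so if both are fermionic exactly
  one of the two signs is -1.\<close>

lemma jw_sign_koszul: "jw_sign m p q = koszul m q p * jw_sign m q p" if "p \<noteq> q"
proof -
  have "prod_encode p \<noteq> prod_encode q" using that by simp
  then show ?thesis by (auto simp: jw_sign_def koszul_def)
qed

lemma up_up: "up m q * up m p = of_int (koszul m q p) * (up m p * up m q :: (_, 'k::field) lop)"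
proof (cases "p = q")
  case True
  show ?thesis
    by (rule lop_eqI) (auto simp: True koszul_def app_times app_uminus app_1 up.rep_eq up_coef_def)
next
  case False
  then have "q \<noteq> p" by auto
  have k: "of_int (koszul m q p) * X = lscal (of_int (koszul m q p)) * X" for X :: "(nat \<times> nat \<Rightarrow> int, 'k) lop"
    by (rule lop_eqI) (auto simp: koszul_def app_times app_uminus app_1 app_lscal)
  show ?thesis
    unfolding k
    by (rule lop_eqI)
      (simp add: app_times app_lscal up.rep_eq jw_upd_other False \<open>q \<noteq> p\<close> jw_sign_koszul[OF False]
        fun_upd_twist[OF False] algebra_simps)
qed

lemma down_down:
  "down m al q * down m al p = of_int (koszul m q p) * (down m al p * down m al q :: (_, 'k::field) lop)"
proof (cases "p = q")
  case True
  show ?thesis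
    by (rule lop_eqI) (auto simp: True koszul_def app_times app_uminus app_1 down.rep_eq down_coef_def)
next
  case False
  then have "q \<noteq> p" by auto
  have k: "of_int (koszul m q p) * X = lscal (of_int (koszul m q p)) * X" for X :: "(nat \<times> nat \<Rightarrow> int, 'k) lop"
    by (rule lop_eqI) (auto simp: koszul_def app_times app_uminus app_1 app_lscal)
  show ?thesis
    unfolding k
    by (rule lop_eqI)
      (simp add: app_times app_lscal down.rep_eq jw_upd_other False \<open>q \<noteq> p\<close> jw_sign_koszul[OF False]
        fun_upd_twist[OF False] algebra_simps)
qed

text \<open>For a single bosonic mode the coefficients of the two products differ by one at every
  exponent, whatever the shift \<open>al\<close>; this is what allows an arbitrary exponent.\<close>

lemma down_up: "down m al q * up m p =
    of_int (koszul m q p) * (up m p * down m al q) + (if p = q then 1 else 0 :: (_, 'k::field) lop)"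
proof (cases "p = q")
  case True
  have j: "jw m q s * (a * (jw m q s * (b * c))) = a * b * (c :: 'k)" for s a b c
    using jw_square[of m q s, where 'k='k] by (metis (no_types) mult.assoc mult.left_commute mult_1)
  show ?thesis
    by (rule lop_eqI)
      (auto simp: True koszul_def app_times app_plus app_1 app_uminus up.rep_eq down.rep_eq j mult.assoc
        jw_upd_same jw_square up_coef_def down_coef_def algebra_simps)
next
  case False
  then have "q \<noteq> p" by auto
  have k: "of_int (koszul m q p) * X = lscal (of_int (koszul m q p)) * X" for X :: "(nat \<times> nat \<Rightarrow> int, 'k) lop"
    by (rule lop_eqI) (auto simp: koszul_def app_times app_uminus app_1 app_lscal)
  show ?thesis
    unfolding k
    by (rule lop_eqI)
      (simp add: app_times app_lscal up.rep_eq down.rep_eq jw_upd_other False \<open>q \<noteq> p\<close> jw_sign_koszul[OF False]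
        fun_upd_twist[OF False] algebra_simps)
qed

section \<open>Oscillator realization of gl(m,n)\<close>

definition fock_E :: "nat \<Rightarrow> nat \<Rightarrow> (nat \<Rightarrow> 'k) \<Rightarrow> nat \<times> nat \<Rightarrow> (nat \<times> nat \<Rightarrow> int, 'k::field) lop"
  where "fock_E m N al = (\<lambda>(i, j). if i \<in> {1..N} \<and> j \<in> {1..N}
    then \<Sum>c=1..N. up m (i, c) * down m al (j, c) else 0)"

lemma of_int_left_commute: "y * (of_int a * x) = of_int a * (y * (x :: 'a::ring_1))"
  by (metis mult.assoc mult_of_int_commute)

text \<open>Exchanging two bilinears produces four Koszul signs. Their product is the sign of the
  superbracket, because (i, c) and (j, c) have different statistics iff (i, j) is odd, independently
  of the copy \<open>c\<close>.\<close>

lemma bilinear_supercommutator: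
  fixes m al i j k l c d
  defines "u \<equiv> up m" and "v \<equiv> down m al"
  shows "(u (i, c) * v (j, c)) * (u (k, d) * v (l, d))
     - (-1) ^ (parity m (i, j) * parity m (k, l)) * ((u (k, d) * v (l, d)) * (u (i, c) * v (j, c)))
   = (if j = k \<and> c = d then u (i, c) * v (l, c) else 0)
     - (-1) ^ (parity m (i, j) * parity m (k, l)) * (if l = i \<and> c = d then u (k, c) * v (j, c) else 0)"
proof -
  let ?s = "(-1) ^ (parity m (i, j) * parity m (k, l)) :: int"
  let ?e = "koszul m"
  let ?q = "(i, c)" and ?p = "(j, c)" and ?q' = "(k, d)" and ?p' = "(l, d)"
  have s: "?e ?p ?q' = ?s * ?e ?p' ?q * ?e ?q' ?q * ?e ?p' ?p"
    by (auto simp: koszul_def fermi_def parity_def)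
  have 1: "(u ?q * v ?p) * (u ?q' * v ?p')
      = of_int (?e ?p ?q') * (u ?q * (u ?q' * (v ?p * v ?p'))) + (if ?q' = ?p then u ?q * v ?p' else 0)"
  proof -
    have "(u ?q * v ?p) * (u ?q' * v ?p') = u ?q * ((v ?p * u ?q') * v ?p')" by (simp add: mult.assoc)
    also have "\<dots> = u ?q * ((of_int (?e ?p ?q') * (u ?q' * v ?p) + (if ?q' = ?p then 1 else 0)) * v ?p')"
      unfolding u_def v_def by (subst down_up) simp
    also have "\<dots> = of_int (?e ?p ?q') * (u ?q * (u ?q' * (v ?p * v ?p'))) + (if ?q' = ?p then u ?q * v ?p' else 0)"
      by (simp add: distrib_left distrib_right mult.assoc of_int_left_commute)
    finally show ?thesis .
  qed
  have 2: "(u ?q' * v ?p') * (u ?q * v ?p)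
      = of_int (?e ?p' ?q * ?e ?q' ?q * ?e ?p' ?p) * (u ?q * (u ?q' * (v ?p * v ?p')))
        + (if ?q = ?p' then u ?q' * v ?p else 0)"
  proof -
    have "(u ?q' * v ?p') * (u ?q * v ?p) = u ?q' * ((v ?p' * u ?q) * v ?p)" by (simp add: mult.assoc)
    also have "\<dots> = u ?q' * ((of_int (?e ?p' ?q) * (u ?q * v ?p') + (if ?q = ?p' then 1 else 0)) * v ?p)"
      unfolding u_def v_def by (subst down_up) simp
    also have "\<dots> = of_int (?e ?p' ?q) * ((u ?q' * u ?q) * (v ?p' * v ?p)) + (if ?q = ?p' then u ?q' * v ?p else 0)"
      by (simp add: distrib_left distrib_right mult.assoc of_int_left_commute)
    also have "u ?q' * u ?q = of_int (?e ?q' ?q) * (u ?q * u ?q')" unfolding u_def by (rule up_up)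
    also have "v ?p' * v ?p = of_int (?e ?p' ?p) * (v ?p * v ?p')" unfolding v_def by (rule down_down)
    finally show ?thesis
      by (simp only: of_int_mult mult.assoc of_int_left_commute[of "u _"])
  qed
  have "of_int (?e ?p ?q') * X - of_int ?s * (of_int (?e ?p' ?q * ?e ?q' ?q * ?e ?p' ?p) * X) = 0"
    for X :: "(nat \<times> nat \<Rightarrow> int, 'a) lop"
    unfolding s by (simp add: mult.assoc)
  then show ?thesis
    unfolding 1 2 by (auto simp: algebra_simps)
qed

lemma fock_E_relation:
  assumes "i \<in> {1..N}" "j \<in> {1..N}" "k \<in> {1..N}" "l \<in> {1..N}"
  shows "fock_E m N al (i, j) * fock_E m N al (k, l)
     - (-1) ^ (parity m (i, j) * parity m (k, l)) * (fock_E m N al (k, l) * fock_E m N al (i, j))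
   = (if j = k then fock_E m N al (i, l) else 0)
     - (-1) ^ (parity m (i, j) * parity m (k, l)) * (if l = i then fock_E m N al (k, j) else 0)"
proof -
  let ?s = "(-1) ^ (parity m (i, j) * parity m (k, l)) :: (nat \<times> nat \<Rightarrow> int, 'a) lop"
  let ?b = "\<lambda>i j c. up m (i, c) * down m al (j, c)"
  have prod: "fock_E m N al (i, j) * fock_E m N al (k, l) = (\<Sum>c=1..N. \<Sum>d=1..N. ?b i j c * ?b k l d)"
    if "i \<in> {1..N}" "j \<in> {1..N}" "k \<in> {1..N}" "l \<in> {1..N}" for i j k l
    using that by (simp add: fock_E_def sum_product)
  have "fock_E m N al (k, l) * fock_E m N al (i, j) = (\<Sum>c=1..N. \<Sum>d=1..N. ?b k l d * ?b i j c)"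
    using prod[OF assms(3,4,1,2)] sum.swap by simp
  then have "fock_E m N al (i, j) * fock_E m N al (k, l) - ?s * (fock_E m N al (k, l) * fock_E m N al (i, j))
    = (\<Sum>c=1..N. \<Sum>d=1..N. ?b i j c * ?b k l d - ?s * (?b k l d * ?b i j c))"
    using prod[OF assms] by (simp add: sum_distrib_left sum_subtractf)
  also have "\<dots> = (\<Sum>c=1..N. \<Sum>d=1..N. (if j = k \<and> c = d then ?b i l c else 0)
      - ?s * (if l = i \<and> c = d then ?b k j c else 0))"
    unfolding bilinear_supercommutator ..
  also have "\<dots> = (\<Sum>c=1..N. (if j = k then ?b i l c else 0) - ?s * (if l = i then ?b k j c else 0))"
  proof (rule sum.cong[OF refl])
    fix c assume c: "c \<in> {1..N}"
    have "(if j = k \<and> c = d then ?b i l c else 0) - ?s * (if l = i \<and> c = d then ?b k j c else 0)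
      = (if c = d then (if j = k then ?b i l c else 0) - ?s * (if l = i then ?b k j c else 0) else 0)" for d
      by simp
    then show "(\<Sum>d=1..N. (if j = k \<and> c = d then ?b i l c else 0)
      - ?s * (if l = i \<and> c = d then ?b k j c else 0))
      = (if j = k then ?b i l c else 0) - ?s * (if l = i then ?b k j c else 0)"
      using c by simp
  qed
  also have "\<dots> = (if j = k then fock_E m N al (i, l) else 0) - ?s * (if l = i then fock_E m N al (k, j) else 0)"
    using assms by (auto simp: fock_E_def sum_subtractf sum_distrib_left)
  finally show ?thesis .
qed

section \<open>The vacuum and the independence of the lowering operators\<close>

definition vac :: "nat \<times> nat \<Rightarrow> int"
  where "vac = (\<lambda>(i, c). if i < c then -1 else 0)"

definition vacuum :: "(nat \<times> nat \<Rightarrow> int) \<Rightarrow> 'k::field"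
  where "vacuum s = (if s = vac then 1 else 0)"

text \<open>A support condition that holds for everything produced from the vacuum by operators with
  indices up to \<open>k\<close>: all modes in which a later link could be detected are still in
  their vacuum state.\<close>

definition boxed :: "nat \<Rightarrow> ((nat \<times> nat \<Rightarrow> int) \<Rightarrow> 'k::field) \<Rightarrow> bool"
  where "boxed k f \<longleftrightarrow> (\<forall>s i c. f s \<noteq> 0 \<longrightarrow> k < i \<or> k < c \<longrightarrow> s (i, c) = vac (i, c))"

lemma boxedD: "boxed k f \<Longrightarrow> k < i \<or> k < c \<Longrightarrow> s (i, c) \<noteq> vac (i, c) \<Longrightarrow> f s = 0"
  unfolding boxed_def by blast

lemma app_up_down:
  "app (up m q * down m al p) f s =
     (jw m q s * jw m p (s(q := s q - 1))) * up_coef m q (s q) *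
     down_coef m al p ((s(q := s q - 1)) p) * f (s(q := s q - 1, p := (s(q := s q - 1)) p + 1))"
  by (simp only: app_times up.rep_eq down.rep_eq mult_ac)

lemma app_up_down_same:
  "app (up m q * down m al q) f s = up_coef m q (s q) * down_coef m al q (s q - 1) * f s"
  by (simp add: app_up_down jw_upd_same jw_square)

lemma app_fock_E:
  assumes "i \<in> {1..N}" "j \<in> {1..N}"
  shows "app (fock_E m N al (i, j)) f s = (\<Sum>c=1..N. app (up m (i, c) * down m al (j, c)) f s)"
  using assms by (simp add: fock_E_def app_sum)

text \<open>A diagonal operator does not change states. For i \<noteq> j, in a copy c > k, both
  indices are below c, and \<open>up\<close> annihilates the vacuum of the mode (i, c).\<close>

lemma boxed_fock_E:
  assumes f: "boxed k f" and "i \<le> k" "j \<le> k"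
  shows "boxed k (app (fock_E m N al (i, j)) f)"
proof (cases "i \<in> {1..N} \<and> j \<in> {1..N}")
  case True
  show ?thesis
    unfolding boxed_def
  proof (intro allI impI)
    fix s i' c'
    assume "app (fock_E m N al (i, j)) f s \<noteq> 0" and out: "k < i' \<or> k < c'"
    then have "(\<Sum>c=1..N. app (up m (i, c) * down m al (j, c)) f s) \<noteq> 0"
      using True by (simp only: app_fock_E not_False_eq_True)
    then obtain c where c: "app (up m (i, c) * down m al (j, c)) f s \<noteq> 0"
      by (rule sum.not_neutral_contains_not_neutral)
    show "s (i', c') = vac (i', c')"
    proof (cases "i = j")
      case True
      then have "f s \<noteq> 0" using c by (auto simp: app_up_down_same)
      then show ?thesis using f out by (auto simp: boxed_def)
    next
      case False
      let ?s = "s((i, c) := s (i, c) - 1, (j, c) := (s((i, c) := s (i, c) - 1)) (j, c) + 1)"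
      have nz: "f ?s \<noteq> 0" "up_coef m (i, c) (s (i, c)) \<noteq> (0 :: 'a)"
        using c by (auto simp: app_up_down)
      then have v: "?s (i'', c'') = vac (i'', c'')" if "k < i'' \<or> k < c''" for i'' c''
        using f that unfolding boxed_def by blast
      have "c \<le> k"
      proof (rule ccontr)
        assume "\<not> c \<le> k"
        then have "s (i, c) = 0" using v[of i c] False assms by (auto simp: vac_def split: if_splits)
        then show False using nz(2) \<open>\<not> c \<le> k\<close> assms by (auto simp: up_coef_def split: if_splits)
      qed
      then show ?thesis using v[OF out] out assms by (auto split: if_splits)
    qed
  qed
next
  case False
  then show ?thesis by (auto simp: fock_E_def boxed_def app_0_left)
qed

lemma boxed_vacuum: "boxed k vacuum"
  by (simp add: boxed_def vacuum_def)

text \<open>Each copy contributes zero: for i < c, \<open>up\<close> annihilates the exponent -1;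
  otherwise c <= i < j, and \<open>down\<close> annihilates the exponent 0 of (j, c), a mode without
  shift.\<close>

lemma fock_E_raising:
  assumes "i < j"
  shows "app (fock_E m N al (i, j)) vacuum = (\<lambda>s. 0 :: 'k::field)"
proof (cases "i \<in> {1..N} \<and> j \<in> {1..N}")
  case True
  have "app (up m (i, c) * down m al (j, c)) vacuum s = (0 :: 'k)" for c s
  proof (rule ccontr)
    assume nz: "app (up m (i, c) * down m al (j, c)) vacuum s \<noteq> (0 :: 'k)"
    let ?s = "s((i, c) := s (i, c) - 1, (j, c) := (s((i, c) := s (i, c) - 1)) (j, c) + 1)"
    have "?s = vac" and u: "up_coef m (i, c) (s (i, c)) \<noteq> (0 :: 'k)"
      and d: "down_coef m al (j, c) (s (j, c)) \<noteq> (0 :: 'k)"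
      using nz assms by (auto simp: app_up_down vacuum_def split: if_splits)
    then have "?s (i, c) = vac (i, c)" "?s (j, c) = vac (j, c)" by metis+
    then have s: "s (i, c) = vac (i, c) + 1" "s (j, c) = vac (j, c) - 1" using assms by auto
    show False
      using u d assms by (cases "i < c") (auto simp: s vac_def up_coef_def down_coef_def split: if_splits)
  qed
  then show ?thesis using True by (auto simp: app_fock_E fun_eq_iff)
qed (auto simp: fock_E_def app_0_left)

text \<open>The subtracted sum is the contribution of the copies c > i to the eigenvalue of e(i,i)
  on the vacuum: 1 from an occupied fermionic mode, -1 from a bosonic one.\<close>

definition fock_param :: "nat \<Rightarrow> nat \<Rightarrow> (nat \<Rightarrow> 'k::field) \<Rightarrow> nat \<Rightarrow> 'k"
  where "fock_param m N lam i = lam i - (\<Sum>c=i+1..N. if fermi m (i, c) then 1 else -1)"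

lemma fock_E_diagonal:
  assumes "i \<in> {1..N}"
  shows "app (fock_E m N (fock_param m N lam) (i, i)) vacuum = (\<lambda>s. lam i * vacuum s)"
proof
  fix s
  let ?al = "fock_param m N lam"
  have "app (fock_E m N ?al (i, i)) vacuum s =
      (\<Sum>c=1..N. up_coef m (i, c) (s (i, c)) * down_coef m ?al (i, c) (s (i, c) - 1) * vacuum s)"
    using assms by (simp add: app_fock_E app_up_down_same)
  also have "\<dots> = (\<Sum>c=1..N. (if c < i then 0 else if c = i then ?al i
      else if fermi m (i, c) then 1 else -1) * vacuum s)"
    by (rule sum.cong[OF refl])
      (auto simp: vacuum_def vac_def up_coef_def down_coef_def, auto simp: fermi_def)
  also have "\<dots> = (\<Sum>c=1..N. if c < i then 0 else if c = i then ?al i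
      else if fermi m (i, c) then 1 else -1) * vacuum s"
    by (simp only: sum_distrib_right)
  also have "(\<Sum>c=1..N. if c < i then 0 else if c = i then ?al i
      else if fermi m (i, c) then 1 else -1) = lam i"
  proof -
    have "{1..N} = {1..<i} \<union> ({i} \<union> {i+1..N})" using assms by auto
    then have "(\<Sum>c=1..N. if c < i then 0 else if c = i then ?al i
        else if fermi m (i, c) then 1 else -1) =
      (\<Sum>c=1..<i. if c < i then 0 else if c = i then ?al i
        else if fermi m (i, c) then 1 else -1) +
      (\<Sum>c\<in>{i} \<union> {i+1..N}. if c < i then 0 else if c = i then ?al i
        else if fermi m (i, c) then 1 else -1)"
      by (simp only:) (rule sum.union_disjoint, auto)
    also have "\<dots> = ?al i + (\<Sum>c=i+1..N. if fermi m (i, c) then 1 else -1)"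
      by (subst sum.union_disjoint) (auto intro!: sum.cong)
    finally show ?thesis by (simp add: fock_param_def)
  qed
  finally show "app (fock_E m N ?al (i, i)) vacuum s = lam i * vacuum s" .
qed

text \<open>In copy \<open>p\<close>, e(p,k) multiplies by the variable of (p, p) and by the dual
  variable of (k, p), both still unexcited in \<open>Y k\<close>. For the largest \<open>K\<close>
  with \<open>Y K\<close> nonzero this trace cannot come from any other term: smaller indices do not
  touch the mode (K, p), and other copies do not touch (p, p).\<close>

lemma fock_lowering_independent:
  fixes Y :: "nat \<Rightarrow> (nat \<times> nat \<Rightarrow> int) \<Rightarrow> 'k::field"
  assumes p: "1 \<le> r" "p \<le> N"
    and Y: "\<And>k. k \<in> {r..<p} \<Longrightarrow> boxed k (Y k)"
    and sum: "\<And>s. (\<Sum>k=r..<p. app (fock_E m N al (p, k)) (Y k) s) = 0"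
    and k: "k \<in> {r..<p}"
  shows "Y k = (\<lambda>s. 0)"
proof (rule ccontr)
  assume nz: "Y k \<noteq> (\<lambda>s. 0)"
  define K where "K = Max {k \<in> {r..<p}. Y k \<noteq> (\<lambda>s. 0)}"
  have "K \<in> {k \<in> {r..<p}. Y k \<noteq> (\<lambda>s. 0)}"
    unfolding K_def by (rule Max_in) (use k nz in auto)
  then have K: "K \<in> {r..<p}" "Y K \<noteq> (\<lambda>s. 0)" by auto
  have big: "Y k' = (\<lambda>s. 0)" if "k' \<in> {r..<p}" "K < k'" for k'
  proof (rule ccontr)
    assume "Y k' \<noteq> (\<lambda>s. 0)"
    then have "k' \<le> K" unfolding K_def by (intro Max_ge) (use that in auto)
    then show False using that by simp
  qed
  obtain t where t: "Y K t \<noteq> 0" using K by auto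
  have tv: "t (p, p) = 0" "t (K, p) = -1"
    using t Y[OF K(1)] K(1) by (auto simp: boxed_def vac_def)
  \<comment> \<open>The state that the part of e(p,K) in copy \<open>p\<close> produces from
    \<open>t\<close>: one quantum at (p, p), and one more power of the dual variable, from exponent
    -1 to -2, at (K, p).\<close>
  define s where "s = t((p, p) := 1, (K, p) := -2)"
  have trm: "app (up m (p, c) * down m al (k', c)) (Y k') s = (if k' = K \<and> c = p then
      jw m (p, p) s * jw m (K, p) (s((p, p) := 0)) * Y K t else 0)"
    if k': "k' \<in> {r..<p}" for k' c
  proof -
    let ?s = "s((p, c) := s (p, c) - 1, (k', c) := (s((p, c) := s (p, c) - 1)) (k', c) + 1)"
    consider "K < k'" | "c \<noteq> p" | "c = p" "k' < K" | "c = p" "k' = K" by linarith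
    then show ?thesis
    proof cases
      case 1
      then show ?thesis using big[OF k'] by (simp add: app_0_right)
    next
      case 2
      have "?s (p, p) = 1" using 2 k' K by (auto simp: s_def)
      then have "Y k' ?s = 0"
        using k' by (intro boxedD[OF Y[OF k'], of p p]) (simp_all add: vac_def)
      then show ?thesis using 2 by (simp add: app_up_down)
    next
      case 3
      have "?s (K, p) = -2" using 3 k' K by (auto simp: s_def)
      then have "Y k' ?s = 0"
        using 3 K by (intro boxedD[OF Y[OF k'], of K p]) (simp_all add: vac_def)
      then show ?thesis using 3 by (simp add: app_up_down)
    next
      case 4
      have "?s = t" using 4 K tv by (auto simp: s_def fun_eq_iff)
      moreover have "s (p, p) = 1" "(s((p, p) := 0)) (K, p) = -2" using K by (auto simp: s_def)
      moreover have "up_coef m (p, p) 1 = (1 :: 'k)" "down_coef m al (K, p) (-2) = 1"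
        using K by (auto simp: up_coef_def down_coef_def fermi_def)
      ultimately show ?thesis using 4 by (simp add: app_up_down)
    qed
  qed
  have "(\<Sum>k'=r..<p. app (fock_E m N al (p, k')) (Y k') s) =
      (\<Sum>k'=r..<p. \<Sum>c=1..N. if k' = K \<and> c = p then
        jw m (p, p) s * jw m (K, p) (s((p, p) := 0)) * Y K t else 0)"
  proof (rule sum.cong[OF refl])
    fix k' assume k': "k' \<in> {r..<p}"
    then show "app (fock_E m N al (p, k')) (Y k') s = (\<Sum>c=1..N. if k' = K \<and> c = p then
        jw m (p, p) s * jw m (K, p) (s((p, p) := 0)) * Y K t else 0)"
      using p K(1) by (subst app_fock_E) (auto intro!: sum.cong simp: trm)
  qed
  also have "\<dots> = (\<Sum>k'=r..<p. if k' = K then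
        jw m (p, p) s * jw m (K, p) (s((p, p) := 0)) * Y K t else 0)"
    using p K(1) by (intro sum.cong refl) auto
  also have "\<dots> = jw m (p, p) s * jw m (K, p) (s((p, p) := 0)) * Y K t"
    using K(1) by simp
  finally show False using sum[of s] t by (simp add: jw_neq_0)
qed

section \<open>Action of the enveloping algebra\<close>

definition feval ::
  "('a \<Rightarrow> ('s, 'k::field) lop) \<Rightarrow> ('a, 'k) free_algebra \<Rightarrow> ('s, 'k) lop"
  where "feval g x = (\<Sum>w \<in> Poly_Mapping.keys x.
     lscal (Poly_Mapping.lookup x w) * prod_list (map g (letters w)))"

lemma feval_superset:
  assumes "finite S" "Poly_Mapping.keys x \<subseteq> S"
  shows "feval g x = (\<Sum>w\<in>S. lscal (Poly_Mapping.lookup x w) * prod_list (map g (letters w)))"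
  unfolding feval_def using assms
  by (intro sum.mono_neutral_left) (auto simp: in_keys_iff lscal_0)

lemma feval_add: "feval g (x + y) = feval g x + feval g y"
proof -
  let ?S = "Poly_Mapping.keys x \<union> Poly_Mapping.keys y"
  have S: "finite ?S" "Poly_Mapping.keys (x + y) \<subseteq> ?S"
    by (auto simp: keys_add)
  show ?thesis
    by (simp add: feval_superset[OF S] feval_superset[of ?S x] feval_superset[of ?S y]
      lookup_add lscal_add distrib_right sum.distrib)
qed

lemma feval_0: "feval g 0 = 0"
  by (simp add: feval_def)

lemma feval_single: "feval g (Poly_Mapping.single w c) = lscal c * prod_list (map g (letters w))"
  by (cases "c = 0") (simp_all add: feval_def lscal_0)

lemma feval_minus: "feval g (x - y) = feval g x - feval g y"
  using feval_add[of g "x - y" y] by simp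

lemma feval_sum: "feval g (sum f A) = (\<Sum>a\<in>A. feval g (f a))"
  by (induction A rule: infinite_finite_induct) (simp_all add: feval_0 feval_add)

lemma poly_mapping_sum_single:
  "x = (\<Sum>w\<in>Poly_Mapping.keys x. Poly_Mapping.single w (Poly_Mapping.lookup x w))"
proof (rule poly_mapping_eqI)
  fix v
  have "(\<Sum>w\<in>Poly_Mapping.keys x. Poly_Mapping.lookup x w when w = v) =
     (\<Sum>w\<in>Poly_Mapping.keys x. if w = v then Poly_Mapping.lookup x v else 0)"
    by (intro sum.cong) auto
  then show "Poly_Mapping.lookup x v = Poly_Mapping.lookup
      (\<Sum>w\<in>Poly_Mapping.keys x. Poly_Mapping.single w (Poly_Mapping.lookup x w)) v"
    by (simp add: lookup_sum lookup_single in_keys_iff)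
qed

lemma lscal_left_commute: "X * (lscal a * Y) = lscal a * (X * Y)"
  by (simp only: mult.assoc[symmetric] lscal_central[of a X])

lemma feval_mult: "feval g (x * y) = feval g x * feval g y"
proof -
  let ?sx = "\<lambda>w. Poly_Mapping.single w (Poly_Mapping.lookup x w)"
  let ?sy = "\<lambda>w. Poly_Mapping.single w (Poly_Mapping.lookup y w)"
  have "feval g (x * y) = feval g (sum ?sx (Poly_Mapping.keys x) * sum ?sy (Poly_Mapping.keys y))"
    by (intro arg_cong[of _ _ "feval g"] arg_cong2[of _ _ _ _ times] poly_mapping_sum_single)
  also have "\<dots> = (\<Sum>v\<in>Poly_Mapping.keys x. \<Sum>w\<in>Poly_Mapping.keys y. feval g (?sx v * ?sy w))"
    by (simp only: sum_product feval_sum)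
  also have "\<dots> = (\<Sum>v\<in>Poly_Mapping.keys x. \<Sum>w\<in>Poly_Mapping.keys y. feval g (?sx v) * feval g (?sy w))"
  proof (intro sum.cong refl)
    fix v w
    show "feval g (?sx v * ?sy w) = feval g (?sx v) * feval g (?sy w)"
      by (simp add: mult_single feval_single plus_fword_def lscal_mult mult.assoc
        lscal_left_commute[of "prod_list _"])
  qed
  also have "\<dots> = feval g x * feval g y"
    unfolding sum_product[symmetric] feval_sum[symmetric]
    by (intro arg_cong[of _ _ "feval g"] arg_cong2[of _ _ _ _ times] poly_mapping_sum_single[symmetric])
  finally show ?thesis .
qed

lemma feval_fgen: "feval g (fgen a) = g a"
  by (simp add: fgen_def feval_single lscal_1)

lemma feval_fconst: "feval g (fconst c) = lscal c"
  by (simp add: fconst_def feval_single zero_fword_def)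

lemma feval_1: "feval g 1 = 1"
  using feval_fconst[of g 1] by (simp add: fconst_def lscal_1)

lemma feval_sign: "feval g ((-1) ^ k) = (-1) ^ k"
proof (induction k)
  case (Suc k)
  have "feval g (- x) = - feval g x" for x
    using feval_minus[of g 0 x] by (simp add: feval_0)
  then show ?case using Suc by simp
qed (simp add: feval_1)

lemma feval_fock_E_ideal:
  assumes "x \<in> ugl_ideal m n"
  shows "feval (fock_E m (m + n) al) x = 0"
  using assms
proof induction
  case (super_comm i j k l)
  then show ?case
    using fock_E_relation[of i "m + n" j k l m al]
    by (simp add: feval_minus feval_mult feval_fgen feval_sign feval_0 if_distrib[of "feval _"] cong: if_cong)
next
  case (out_of_range i j)
  then show ?case by (auto simp: feval_fgen fock_E_def)
qed (simp_all add: feval_0 feval_add feval_mult)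

lift_definition fock_rep ::
  "(nat \<Rightarrow> 'k) \<Rightarrow> ('k::field, 'm::finite, 'n::finite) ugl \<Rightarrow> (nat \<times> nat \<Rightarrow> int, 'k) lop"
  is "\<lambda>lam. feval (fock_E (CARD('m)) (CARD('m) + CARD('n)) (fock_param (CARD('m)) (CARD('m) + CARD('n)) lam))"
  by (simp add: ugl_rel_def) (metis feval_fock_E_ideal feval_minus eq_iff_diff_eq_0)

lemma fock_rep_add: "fock_rep lam (x + y) = fock_rep lam x + fock_rep lam y"
  by transfer (rule feval_add)
lemma fock_rep_minus: "fock_rep lam (x - y) = fock_rep lam x - fock_rep lam y"
  by transfer (rule feval_minus)
lemma fock_rep_mult: "fock_rep lam (x * y) = fock_rep lam x * fock_rep lam y"
  by transfer (rule feval_mult)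
lemma fock_rep_0: "fock_rep lam 0 = 0"
  by transfer (rule feval_0)
lemma fock_rep_1: "fock_rep lam 1 = 1"
  by transfer (rule feval_1)
lemma fock_rep_scal: "fock_rep lam (scal c) = lscal c"
  by transfer (rule feval_fconst)
lemma fock_rep_E: "fock_rep lam (E i j :: ('k::field, 'm::finite, 'n::finite) ugl) =
    fock_E (CARD('m)) (CARD('m) + CARD('n)) (fock_param (CARD('m)) (CARD('m) + CARD('n)) lam) (i, j)"
  by transfer (rule feval_fgen)

section \<open>Combinations of chain products\<close>

lemma scal_1: "scal 1 = 1"
  by transfer (simp add: ugl_rel_def fconst_def ugl_ideal.zero)

lemma scal_add: "scal (a + b) = scal a + scal b"
  by transfer (simp add: ugl_rel_def fconst_def single_add ugl_ideal.zero)

lemma scal_mult: "scal (a * b) = scal a * scal b"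
  by transfer (simp add: ugl_rel_def fconst_def mult_single ugl_ideal.zero)

lemma fconst_central: "fconst c * x = x * fconst c"
proof -
  have "fconst c * (\<Sum>w\<in>Poly_Mapping.keys x. Poly_Mapping.single w (Poly_Mapping.lookup x w))
      = (\<Sum>w\<in>Poly_Mapping.keys x. Poly_Mapping.single w (Poly_Mapping.lookup x w)) * fconst c"
    by (simp add: sum_distrib_left sum_distrib_right fconst_def mult_single mult.commute)
  then show ?thesis
    by (simp only: poly_mapping_sum_single[symmetric])
qed

lemma scal_central: "scal c * x = x * scal c"
  by transfer (simp add: ugl_rel_def fconst_central ugl_ideal.zero)

interpretation scal: central_scalars "scal :: 'k::comm_ring_1 \<Rightarrow> ('k, 'm::finite, 'n::finite) ugl"
  by standard (rule scal_1 scal_add scal_mult scal_central)+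

definition swap_sign :: "nat \<Rightarrow> nat \<times> nat \<Rightarrow> nat \<times> nat \<Rightarrow> 'k::comm_ring_1"
  where "swap_sign m x y = (if parity m x = 1 \<and> parity m y = 1 then -1 else 1)"

lemma E_relation:
  fixes i j k l :: nat
  defines "N \<equiv> CARD('m::finite) + CARD('n::finite)"
    and "\<sigma> \<equiv> swap_sign (CARD('m)) (i, j) (k, l)"
  assumes "i \<in> {1..N}" "j \<in> {1..N}" "k \<in> {1..N}" "l \<in> {1..N}"
  shows "(E i j * E k l :: ('k::comm_ring_1, 'm, 'n) ugl) = scal \<sigma> * (E k l * E i j)
     + ((if j = k then E i l else 0) - scal \<sigma> * (if l = i then E k j else 0))"
proof (cases "parity (CARD('m)) (i, j) = 1 \<and> parity (CARD('m)) (k, l) = 1")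
  case True
  have *: "(E i j * E k l + E k l * E i j - ((if j = k then E i l else 0) + (if l = i then E k j else 0))
      :: ('k, 'm, 'n) ugl) = 0"
    by (transfer fixing: i j k l)
      (use ugl_ideal.super_comm[of i "CARD('m)" "CARD('n)" j k l, where 'k='k] assms True
        in \<open>simp add: ugl_rel_def\<close>)
  have "\<sigma> = -1" using True by (simp add: \<sigma>_def swap_sign_def)
  then show ?thesis using *
    by (simp add: scal.sc_minus scal_1 algebra_simps split: if_splits)
next
  case False
  then have p: "parity (CARD('m)) (i, j) * parity (CARD('m)) (k, l) = 0"
    by (auto simp: parity_def split: if_splits)
  have *: "(E i j * E k l - E k l * E i j - ((if j = k then E i l else 0) - (if l = i then E k j else 0))
      :: ('k, 'm, 'n) ugl) = 0"
    by (transfer fixing: i j k l)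
      (use ugl_ideal.super_comm[of i "CARD('m)" "CARD('n)" j k l, where 'k='k] assms p
        in \<open>simp add: ugl_rel_def\<close>)
  have "\<sigma> = 1" using False by (auto simp: \<sigma>_def swap_sign_def)
  then show ?thesis using * by (simp add: scal_1 algebra_simps)
qed

text \<open>
  \<open>chain_comb r p c X\<close>: \<open>X\<close> is a linear combination of products of links, in decreasing order, over
  the chains from \<open>r\<close> to \<open>p\<close>, and \<open>c\<close> is the coefficient of the longest chain.
\<close>

inductive chain_comb :: "nat \<Rightarrow> nat \<Rightarrow> 'k::field \<Rightarrow> ('k, 'm::finite, 'n::finite) ugl \<Rightarrow> bool"
  for r where
  start: "chain_comb r r c (scal c)"
| step: "r < p \<Longrightarrow> (\<forall>k\<in>{r..<p}. chain_comb r k (d k) (X k)) \<Longrightarrow>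
    chain_comb r p (d (p - 1)) (\<Sum>k=r..<p. E p k * X k)"

lemma chain_comb_ge: "chain_comb r p c X \<Longrightarrow> r \<le> p"
  by (induction rule: chain_comb.induct) auto

lemma chain_comb_stepI:
  assumes "r < p" "\<And>k. k \<in> {r..<p} \<Longrightarrow> chain_comb r k (d k) (X k)"
    "Y = (\<Sum>k=r..<p. E p k * X k)" "c = d (p - 1)"
  shows "chain_comb r p c Y"
  unfolding assms(3,4) by (rule chain_comb.step) (use assms in auto)

lemma chain_comb_stepE:
  assumes "chain_comb r p c Y" "r < p"
  obtains d X where "\<And>k. k \<in> {r..<p} \<Longrightarrow> chain_comb r k (d k) (X k)"
    "Y = (\<Sum>k=r..<p. E p k * X k)" "c = d (p - 1)"
  using assms(1)
proof (cases rule: chain_comb.cases)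
  case start
  then show ?thesis using assms(2) by simp
next
  case (step d X)
  then show ?thesis by (intro that[of d X]) auto
qed

lemma chain_comb_startE:
  assumes "chain_comb r r c Y"
  shows "Y = scal c"
  using assms by (cases rule: chain_comb.cases) auto

lemma chain_comb_scal:
  assumes "chain_comb r p c X"
  shows "chain_comb r p (a * c) (scal a * X)"
  using assms
proof (induction rule: chain_comb.induct)
  case (start c)
  then show ?case using chain_comb.start[of r "a * c"] by (simp add: scal_mult)
next
  case (step p d X)
  show ?case
    by (rule chain_comb_stepI[where d = "\<lambda>k. a * d k" and X = "\<lambda>k. scal a * X k"])
      (use step in \<open>auto simp: sum_distrib_left scal.sc_left_commute\<close>)
qed

lemma chain_comb_0: "r \<le> p \<Longrightarrow> chain_comb r p 0 0"
proof (induction p rule: less_induct)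
  case (less p)
  show ?case
  proof (cases "p = r")
    case True
    then show ?thesis using chain_comb.start[of r 0] by (simp add: scal.sc_0)
  next
    case False
    show ?thesis
      by (rule chain_comb_stepI[where d = "\<lambda>_. 0" and X = "\<lambda>_. 0"]) (use False less in auto)
  qed
qed

lemma chain_comb_add:
  assumes "chain_comb r p c X" "chain_comb r p c' X'"
  shows "chain_comb r p (c + c') (X + X')"
  using assms
proof (induction arbitrary: c' X' rule: chain_comb.induct)
  case (start c)
  then show ?case using chain_comb.start[of r "c + c'"] 
    by (simp add: chain_comb_startE[OF start.prems] scal_add)
next
  case (step p d X)
  obtain d' Z where Z: "\<And>k. k \<in> {r..<p} \<Longrightarrow> chain_comb r k (d' k) (Z k)"
    "X' = (\<Sum>k=r..<p. E p k * Z k)" "c' = d' (p - 1)"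
    using chain_comb_stepE[OF step.prems step.hyps] by blast
  show ?case
    by (rule chain_comb_stepI[where d = "\<lambda>k. d k + d' k" and X = "\<lambda>k. X k + Z k"])
      (use step Z in \<open>auto simp: sum.distrib distrib_left\<close>)
qed

lemma chain_comb_diff:
  assumes "chain_comb r p c X" "chain_comb r p c' X'"
  shows "chain_comb r p (c - c') (X - X')"
  using chain_comb_add[OF assms(1) chain_comb_scal[OF assms(2), of "-1"]]
  by (simp add: scal.sc_minus scal_1)

lemma chain_comb_sum:
  assumes "r \<le> p" "\<And>a. a \<in> A \<Longrightarrow> chain_comb r p (c a) (X a)"
  shows "chain_comb r p (sum c A) (sum X A)"
  using assms(2)
  by (induction A rule: infinite_finite_induct)
    (auto intro: chain_comb_add simp: chain_comb_0[OF assms(1)])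

lemma chain_comb_link_left:
  assumes "chain_comb r k c X" "k < p"
  shows "chain_comb r p (if p = Suc k then c else 0) (E p k * X)"
proof (rule chain_comb_stepI[where d = "\<lambda>j. if j = k then c else 0" and X = "\<lambda>j. if j = k then X else 0"])
  have k: "r \<le> k" using chain_comb_ge[OF assms(1)] .
  then show "r < p" using assms(2) by simp
  show "chain_comb r j (if j = k then c else 0) (if j = k then X else 0)" if "j \<in> {r..<p}" for j
    using that assms(1) by (auto intro: chain_comb_0)
  have "(\<Sum>j=r..<p. E p j * (if j = k then X else 0)) = (\<Sum>j=r..<p. if j = k then E p k * X else 0)"
    by (intro sum.cong) auto
  then show "E p k * X = (\<Sum>j=r..<p. E p j * (if j = k then X else 0))"
    using k assms(2) by simp
  show "(if p = Suc k then c else 0) = (if p - 1 = k then c else 0)"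
    using assms(2) by auto
qed

section \<open>Commutation of a link with a chain\<close>

text \<open>The sign is 1: if both were odd, then i <= m < j and k <= m < p, contradicting j <
  k.\<close>

lemma lower_commute:
  assumes "1 \<le> i" "i < j" "j < k" "k < p" "p \<le> CARD('m) + CARD('n)"
  shows "(E p k * E j i :: ('k::field, 'm::finite, 'n::finite) ugl) = E j i * E p k"
proof -
  have "swap_sign (CARD('m)) (p, k) (j, i) = (1 :: 'k)"
    using assms by (auto simp: swap_sign_def parity_def split: if_splits)
  then show ?thesis
    using E_relation[of p k j i, where 'k='k and 'm='m and 'n='n] assms by (simp add: scal_1)
qed

lemma lower_bracket:
  assumes "1 \<le> i" "i < k" "k < p" "p \<le> CARD('m) + CARD('n)"
  shows "(E p k * E k i :: ('k::field, 'm::finite, 'n::finite) ugl) = E k i * E p k + E p i"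
proof -
  have "swap_sign (CARD('m)) (p, k) (k, i) = (1 :: 'k)"
    using assms by (auto simp: swap_sign_def parity_def split: if_splits)
  then show ?thesis
    using E_relation[of p k k i, where 'k='k and 'm='m and 'n='n] assms by (simp add: scal_1)
qed

lemma chain_comb_commute:
  assumes "chain_comb r j c (X :: ('k::field, 'm::finite, 'n::finite) ugl)" "1 \<le> r" "j < k" "k < p"
    "p \<le> CARD('m) + CARD('n)"
  shows "E p k * X = X * E p k"
  using assms
proof (induction rule: chain_comb.induct)
  case (start c)
  then show ?case by (simp add: scal_central)
next
  case (step j d X)
  have "E p k * (E j i * X i) = E j i * X i * E p k" if "i \<in> {r..<j}" for i
  proof -
    have "E p k * X i = X i * E p k" using step that by auto
    moreover have "E p k * E j i = (E j i * E p k :: ('k, 'm, 'n) ugl)"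
      using that step.prems by (intro lower_commute) auto
    ultimately show ?thesis by (metis mult.assoc)
  qed
  then show ?case by (simp add: sum_distrib_left sum_distrib_right)
qed

text \<open>\<open>E p k\<close> commutes with everything in \<open>X\<close> except the leading
  links e(k,i), with which it merges to e(p,i). All chains in the result therefore avoid the site
  \<open>k\<close>, and the longest chain does not occur.\<close>

lemma chain_comb_bracket:
  assumes X: "chain_comb r k c (X :: ('k::field, 'm::finite, 'n::finite) ugl)"
    and "1 \<le> r" "k < p" "p \<le> CARD('m) + CARD('n)"
  shows "chain_comb r p 0 (E p k * X - X * E p k)"
proof (cases "k = r")
  case True
  then have "X = scal c" using X chain_comb_startE by blast
  then show ?thesis using True assms by (simp add: scal_central chain_comb_0)
next
  case False
  then have "r < k" using chain_comb_ge[OF X] by simp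
  then obtain d Z where Z: "\<And>i. i \<in> {r..<k} \<Longrightarrow> chain_comb r i (d i) (Z i)"
    "X = (\<Sum>i=r..<k. E k i * Z i)"
    using chain_comb_stepE[OF X] by metis
  have "E p k * (E k i * Z i) - E k i * Z i * E p k = E p i * Z i" if "i \<in> {r..<k}" for i
  proof -
    have "E p k * Z i = Z i * E p k"
      using Z(1)[OF that] that assms by (intro chain_comb_commute) auto
    moreover have "E p k * E k i = (E k i * E p k + E p i :: ('k, 'm, 'n) ugl)"
      using that assms by (intro lower_bracket) auto
    ultimately show ?thesis
      by (metis (no_types, lifting) add_diff_cancel_left' distrib_right mult.assoc)
  qed
  then have "E p k * X - X * E p k = (\<Sum>i=r..<k. E p i * Z i)"
    by (simp add: Z(2) sum_distrib_left sum_distrib_right sum_subtractf[symmetric])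
  also have "\<dots> = (\<Sum>i=r..<p. E p i * (if i < k then Z i else 0))"
    using assms by (intro sum.mono_neutral_cong_left) auto
  finally have eq: "E p k * X - X * E p k = (\<Sum>i=r..<p. E p i * (if i < k then Z i else 0))" .
  show ?thesis
    by (rule chain_comb_stepI[where d = "\<lambda>i. if i < k then d i else 0", OF _ _ eq])
      (use Z(1) assms \<open>r < k\<close> in \<open>auto intro: chain_comb_0\<close>)
qed

lemma chain_comb_link_right:
  assumes X: "chain_comb r k c (X :: ('k::field, 'm::finite, 'n::finite) ugl)"
    and "1 \<le> r" "k < p" "p \<le> CARD('m) + CARD('n)"
  shows "chain_comb r p (if p = Suc k then c else 0) (X * E p k)"
  using chain_comb_diff[OF chain_comb_link_left[OF X] chain_comb_bracket[OF assms]] assms by simp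

section \<open>Action on a highest weight vector\<close>

text \<open>Equality of these vectors is weaker than equality in the enveloping algebra; for chain
  combinations \<open>chain_comb_faithful\<close> closes the gap.\<close>

definition hv :: "(nat \<Rightarrow> 'k) \<Rightarrow> ('k::field, 'm::finite, 'n::finite) ugl \<Rightarrow> (nat \<times> nat \<Rightarrow> int) \<Rightarrow> 'k"
  where "hv lam X = app (fock_rep lam X) vacuum"

lemma hv_mult: "hv lam (X * Y) = app (fock_rep lam X) (hv lam Y)"
  by (simp add: hv_def fock_rep_mult app_times)
lemma hv_add: "hv lam (X + Y) s = hv lam X s + hv lam Y s"
  by (simp add: hv_def fock_rep_add app_plus)
lemma hv_diff: "hv lam (X - Y) s = hv lam X s - hv lam Y s"
  by (simp add: hv_def fock_rep_minus app_minus)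
lemma hv_0: "hv lam 0 = (\<lambda>s. 0)"
  by (simp add: hv_def fock_rep_0 app_0_left)
lemma hv_scal_mult: "hv lam (scal c * X) = (\<lambda>s. c * hv lam X s)"
  by (simp add: hv_mult fock_rep_scal fun_eq_iff app_lscal)
lemma hv_scal: "hv lam (scal c) = (\<lambda>s. c * vacuum s)"
  by (simp add: hv_def fock_rep_scal fun_eq_iff app_lscal)
lemma hv_sum: "hv lam (sum X A) s = (\<Sum>a\<in>A. hv lam (X a) s)"
  by (induction A rule: infinite_finite_induct) (simp_all add: hv_0 hv_add)
lemma hv_mult_0: "hv lam Y = (\<lambda>s. 0) \<Longrightarrow> hv lam (X * Y) = (\<lambda>s. 0)"
  by (simp add: hv_mult app_0_right)
lemma hv_sum_0: "(\<And>a. a \<in> A \<Longrightarrow> hv lam (X a) = (\<lambda>s. 0)) \<Longrightarrow> hv lam (sum X A) = (\<lambda>s. 0)"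
  by (simp add: fun_eq_iff hv_sum)
lemma hv_cong_mult: "hv lam Y = hv lam Z \<Longrightarrow> hv lam (X * Y) = hv lam (X * Z)"
  by (simp add: hv_mult)

lemma hv_raising: "i < j \<Longrightarrow> hv lam (E i j) = (\<lambda>s. 0)"
  by (simp add: hv_def fock_rep_E fock_E_raising)

lemma hv_diagonal:
  "i \<in> {1..CARD('m) + CARD('n)} \<Longrightarrow>
    hv lam (E i i :: ('k::field, 'm::finite, 'n::finite) ugl) = (\<lambda>s. lam i * vacuum s)"
  by (simp add: hv_def fock_rep_E fock_E_diagonal)

lemma boxed_mono: "boxed k f \<Longrightarrow> k \<le> k' \<Longrightarrow> boxed k' f"
  by (auto simp: boxed_def)

lemma boxed_diff: "boxed k f \<Longrightarrow> boxed k g \<Longrightarrow> boxed k (\<lambda>s. a * f s - b * g s)"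
  by (auto simp: boxed_def) (metis diff_zero mult_zero_right)+

lemma boxed_sum:
  "(\<And>a. a \<in> A \<Longrightarrow> boxed k (f a)) \<Longrightarrow> boxed k (\<lambda>s. \<Sum>a\<in>A. f a s)"
  unfolding boxed_def by (metis sum.not_neutral_contains_not_neutral)

lemma boxed_E: "boxed k (hv lam X) \<Longrightarrow> i \<le> k \<Longrightarrow> j \<le> k \<Longrightarrow> boxed k (hv lam (E i j * X))"
  by (simp add: hv_mult fock_rep_E boxed_fock_E)

lemma chain_comb_boxed: "chain_comb r p c X \<Longrightarrow> boxed p (hv lam X)"
proof (induction rule: chain_comb.induct)
  case (start c)
  then show ?case using boxed_vacuum[of r] by (auto simp: hv_scal boxed_def)
next
  case (step p d X)
  have "boxed p (\<lambda>s. \<Sum>k=r..<p. hv lam (E p k * X k) s)"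
  proof (rule boxed_sum, rule boxed_E)
    fix k assume k: "k \<in> {r..<p}"
    then have "boxed k (hv lam (X k))" using step by blast
    then show "boxed p (hv lam (X k))" by (rule boxed_mono) (use k in simp)
    show "p \<le> p" "k \<le> p" using k by auto
  qed
  then show ?case by (simp add: hv_sum[abs_def] fun_eq_iff boxed_def)
qed

lemma lowering_independent:
  fixes Z :: "nat \<Rightarrow> ('k::field, 'm::finite, 'n::finite) ugl"
  assumes "1 \<le> r" "p \<le> CARD('m) + CARD('n)"
    and "\<And>k. k \<in> {r..<p} \<Longrightarrow> boxed k (hv lam (Z k))"
    and "hv lam (\<Sum>k=r..<p. E p k * Z k) = (\<lambda>s. 0)"
    and "k \<in> {r..<p}"
  shows "hv lam (Z k) = (\<lambda>s. 0)"
proof (rule fock_lowering_independent[OF assms(1,2) assms(3) _ assms(5)])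
  fix s
  show "(\<Sum>k=r..<p. app (fock_E (CARD('m)) (CARD('m) + CARD('n))
      (fock_param (CARD('m)) (CARD('m) + CARD('n)) lam) (p, k)) (hv lam (Z k)) s) = 0"
    using fun_cong[OF assms(4), of s] by (simp add: hv_sum hv_mult fock_rep_E)
qed

text \<open>The cofactor of e(p,k) only involves indices up to \<open>k\<close>, so the independence
  of the lowering operators strips off the last links, and the induction continues with the shorter
  chains.\<close>

lemma chain_comb_faithful:
  assumes "chain_comb r p c (X :: ('k::field, 'm::finite, 'n::finite) ugl)"
    "1 \<le> r" "p \<le> CARD('m) + CARD('n)" "hv lam X = (\<lambda>s. 0)"
  shows "X = 0"
  using assms
proof (induction rule: chain_comb.induct)
  case (start c)
  have "c = 0" using fun_cong[OF start(3), of vac] by (simp add: hv_scal vacuum_def)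
  then show ?case by (simp add: scal.sc_0)
next
  case (step p d X)
  have "X k = 0" if k: "k \<in> {r..<p}" for k
  proof -
    have "hv lam (X k) = (\<lambda>s. 0)"
      by (rule lowering_independent[OF step.prems(1,2) _ step.prems(3) k])
        (use step in \<open>auto intro: chain_comb_boxed\<close>)
    then show ?thesis using step k by auto
  qed
  then show ?case by simp
qed

section \<open>Raising operators and uniqueness\<close>

lemma raising_lowering:
  fixes i p k :: nat
  defines "\<sigma> \<equiv> \<lambda>k. swap_sign (CARD('m::finite)) (i, i + 1) (p, k)"
  assumes "1 \<le> k" "k < p" "p \<le> CARD('m) + CARD('n)" "1 \<le> i" "i + 1 \<le> CARD('m) + CARD('n)"
  shows "(E i (i + 1) * E p k :: ('k::field, 'm, 'n::finite) ugl) = scal (\<sigma> k) * (E p k * E i (i + 1))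
    + ((if p = i + 1 then E i k else 0) - scal (\<sigma> k) * (if k = i then E p (i + 1) else 0))"
  using E_relation[of i "i + 1" p k, where 'k='k and 'm='m and 'n='n] assms
  by (auto simp: \<sigma>_def)

text \<open>For p <= i no link in \<open>X\<close> ends at i + 1 or starts at i, so both correction
  terms of \<open>raising_lowering\<close> vanish and the raising operator passes through to the
  vacuum.\<close>

lemma chain_comb_raise_0:
  assumes "chain_comb r p c (X :: ('k::field, 'm::finite, 'n::finite) ugl)"
    "1 \<le> r" "p \<le> i" "i + 1 \<le> CARD('m) + CARD('n)"
  shows "hv lam (E i (i + 1) * X) = (\<lambda>s. 0)"
  using assms
proof (induction rule: chain_comb.induct)
  case (start c)
  have "hv lam (E i (i + 1) * scal c :: ('k, 'm, 'n) ugl) = hv lam (scal c * E i (i + 1) :: ('k, 'm, 'n) ugl)"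
    by (simp only: scal_central)
  then show ?case by (simp add: hv_scal_mult hv_raising)
next
  case (step p d X)
  have "hv lam (E i (i + 1) * (E p k * X k)) = (\<lambda>s. 0)" if k: "k \<in> {r..<p}" for k
  proof -
    have "E i (i + 1) * (E p k * X k) = scal (swap_sign (CARD('m)) (i, i + 1) (p, k)) * (E p k * (E i (i + 1) * X k))"
      using raising_lowering[of k p i, where 'k='k and 'm='m and 'n='n] step k
      by (simp add: mult.assoc[symmetric])
    then show ?thesis using step k by (simp add: hv_scal_mult hv_mult_0)
  qed
  then show ?case unfolding sum_distrib_left by (intro hv_sum_0) simp
qed

text \<open>Moving e(i,i+1) past the last links e(p,k) gives again a combination of these links,
  whose cofactors must all annihilate the vacuum. This makes the cofactor of e(p,p-1) satisfy the
  assumptions with p - 1 in place of p, and lets vanishing spread from \<open>Z (i + 1)\<close> to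
  \<open>Z i\<close>, down to r.\<close>

lemma chain_comb_unique:
  assumes "chain_comb r p 0 (X :: ('k::field, 'm::finite, 'n::finite) ugl)"
    and r: "1 \<le> r" and "p \<le> CARD('m) + CARD('n)"
    and "\<And>i. r \<le> i \<Longrightarrow> i + 1 < p \<Longrightarrow> hv lam (E i (i + 1) * X) = (\<lambda>s. 0)"
  shows "X = 0"
  using assms(1,3,4)
proof (induction p arbitrary: X rule: less_induct)
  case (less p)
  show ?case
  proof (cases "p = r")
    case True
    then show ?thesis using less.prems(1) chain_comb_startE scal.sc_0 by metis
  next
    case False
    then have rp: "r < p" using chain_comb_ge[OF less.prems(1)] by simp
    obtain d Z where Z: "\<And>k. k \<in> {r..<p} \<Longrightarrow> chain_comb r k (d k) (Z k)"
      and X: "X = (\<Sum>k=r..<p. E p k * Z k)" and d: "0 = d (p - 1)"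
      using chain_comb_stepE[OF less.prems(1) rp] by metis
    have key: "(k \<noteq> i + 1 \<longrightarrow> hv lam (E i (i + 1) * Z k) = (\<lambda>s. 0)) \<and>
        (Z (i + 1) = 0 \<longrightarrow> hv lam (Z i) = (\<lambda>s. 0))"
      if i: "r \<le> i" "i + 1 < p" and k: "k \<in> {r..<p}" for i k
    proof -
      let ?\<sigma> = "\<lambda>k. swap_sign (CARD('m)) (i, i + 1) (p, k) :: 'k"
      \<comment> \<open>The correction from k = i carries the link e(p,i+1), so it is booked in the
        cofactor with index i + 1.\<close>
      define W where "W = (\<lambda>k. scal (?\<sigma> k) * (E i (i + 1) * Z k)
        - (if k = i + 1 then scal (?\<sigma> i) * Z i else 0))"
      have "E i (i + 1) * X = (\<Sum>k=r..<p. E p k * (scal (?\<sigma> k) * (E i (i + 1) * Z k))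
          - (if k = i then E p (i + 1) * (scal (?\<sigma> i) * Z i) else 0))"
        unfolding X sum_distrib_left
      proof (rule sum.cong[OF refl])
        fix k assume k: "k \<in> {r..<p}"
        have "E i (i + 1) * (E p k * Z k) = (E i (i + 1) * E p k) * Z k" by (simp add: mult.assoc)
        also have "E i (i + 1) * E p k = (scal (?\<sigma> k) * (E p k * E i (i + 1))
           - scal (?\<sigma> k) * (if k = i then E p (i + 1) else 0) :: ('k, 'm, 'n) ugl)"
          using raising_lowering[of k p i, where 'k='k and 'm='m and 'n='n] i r k less.prems(2) by simp
        finally show "E i (i + 1) * (E p k * Z k) = E p k * (scal (?\<sigma> k) * (E i (i + 1) * Z k))
          - (if k = i then E p (i + 1) * (scal (?\<sigma> i) * Z i) else 0)"
          by (simp add: left_diff_distrib mult.assoc scal.sc_left_commute)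
      qed
      also have "\<dots> = (\<Sum>k=r..<p. E p k * W k)"
      proof -
        have "(\<Sum>k=r..<p. if k = i then E p (i + 1) * (scal (?\<sigma> i) * Z i) else 0)
          = (\<Sum>k=r..<p. E p k * (if k = i + 1 then scal (?\<sigma> i) * Z i else 0))"
        proof -
          have "(\<Sum>k=r..<p. E p k * (if k = i + 1 then scal (?\<sigma> i) * Z i else 0))
            = (\<Sum>k=r..<p. if k = i + 1 then E p (i + 1) * (scal (?\<sigma> i) * Z i) else 0)"
            by (intro sum.cong) auto
          then show ?thesis using i by simp
        qed
        then show ?thesis unfolding W_def right_diff_distrib sum_subtractf by simp
      qed
      finally have "hv lam (\<Sum>k=r..<p. E p k * W k) = (\<lambda>s. 0)"
        using less.prems(3)[OF i] by simp
      \<comment> \<open>For k <= i the index i + 1 exceeds k, but there the raising operator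
        annihilates \<open>Z k\<close> on the vacuum; for k > i both indices are within the
        box.\<close>
      moreover have "boxed k (hv lam (W k))" if k: "k \<in> {r..<p}" for k
      proof (cases "k \<le> i")
        case True
        have "hv lam (E i (i + 1) * Z k) = (\<lambda>s. 0)"
          using chain_comb_raise_0[OF Z[OF k] r True] i less.prems(2) by simp
        then show ?thesis using True by (simp add: W_def hv_scal_mult boxed_def)
      next
        case False
        then have "boxed k (hv lam (E i (i + 1) * Z k))"
          using chain_comb_boxed[OF Z[OF k], of lam] by (intro boxed_E) auto
        moreover have "boxed k (hv lam (Z i))"
          using chain_comb_boxed[OF Z[of i], of lam] i False by (intro boxed_mono[of i _ k]) auto
        ultimately have "boxed k (\<lambda>s. ?\<sigma> k * hv lam (E i (i + 1) * Z k) s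
            - (if k = i + 1 then ?\<sigma> i else 0) * hv lam (Z i) s)"
          by (rule boxed_diff)
        also have "(\<lambda>s. ?\<sigma> k * hv lam (E i (i + 1) * Z k) s
            - (if k = i + 1 then ?\<sigma> i else 0) * hv lam (Z i) s) = hv lam (W k)"
          by (simp add: fun_eq_iff W_def hv_diff hv_scal_mult hv_0)
        finally show ?thesis .
      qed
      ultimately have W0: "hv lam (W k) = (\<lambda>s. 0)" if "k \<in> {r..<p}" for k
        using lowering_independent[OF r less.prems(2)] that by blast
      have \<sigma>0: "?\<sigma> j \<noteq> 0" for j by (simp add: swap_sign_def)
      have "hv lam (E i (i + 1) * Z k) = (\<lambda>s. 0)" if "k \<noteq> i + 1"
        using W0[OF k] that \<sigma>0[of k] by (simp add: W_def hv_scal_mult fun_eq_iff)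
      moreover have "hv lam (Z i) = (\<lambda>s. 0)" if "Z (i + 1) = 0"
        using W0[of "i + 1"] that \<sigma>0[of i] i
        by (simp add: W_def fun_eq_iff hv_diff hv_scal_mult hv_0)
      ultimately show ?thesis by blast
    qed
    have top: "Z (p - 1) = 0"
    proof (rule less.IH)
      show "chain_comb r (p - 1) 0 (Z (p - 1))" using Z[of "p - 1"] rp d by auto
      show "hv lam (E i (i + 1) * Z (p - 1)) = (\<lambda>s. 0)" if "r \<le> i" "i + 1 < p - 1" for i
        using key[of i "p - 1"] that rp by auto
    qed (use rp less.prems(2) in auto)
    have "Z k = 0" if "k \<le> p - 1" "r \<le> k" for k
      using that
    proof (induction k rule: inc_induct)
      case base
      show ?case by (rule top)
    next
      case (step k)
      then have "hv lam (Z k) = (\<lambda>s. 0)" using key[of k k] by auto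
      then show ?case
        using chain_comb_faithful[OF Z[of k] r] step less.prems(2) by auto
    qed
    then show ?thesis unfolding X by (intro sum.neutral) auto
  qed
qed

section \<open>Weighted sums over chains\<close>

text \<open>
  The sum over all chains from \<open>r\<close> to \<open>p\<close>, where the sites omitted by a chain contribute their
  weights \<open>u\<close> and the link leaving \<open>k\<close> is multiplied from the right iff \<open>rt k\<close>.
\<close>

function csum :: "('c::comm_ring_1 \<Rightarrow> 'a::ring_1) \<Rightarrow> (nat \<Rightarrow> nat \<Rightarrow> 'a) \<Rightarrow> nat \<Rightarrow>
    (nat \<Rightarrow> bool) \<Rightarrow> (nat \<Rightarrow> 'c) \<Rightarrow> nat \<Rightarrow> 'a"
  where "csum sc F r rt u p = (if p \<le> r then 1 else
    \<Sum>k=r..<p. sc (\<Prod>x\<in>{k<..<p}. u x) *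
      (if rt k then csum sc F r rt u k * F p k else F p k * csum sc F r rt u k))"
  by auto
termination by (relation "measure (\<lambda>(_, _, _, _, _, p). p)") auto

declare csum.simps [simp del]

lemma csum_start: "p \<le> r \<Longrightarrow> csum sc F r rt u p = 1"
  by (simp add: csum.simps)

lemma csum_rec: "r < p \<Longrightarrow> csum sc F r rt u p = (\<Sum>k=r..<p. sc (\<Prod>x\<in>{k<..<p}. u x) *
      (if rt k then csum sc F r rt u k * F p k else F p k * csum sc F r rt u k))"
  by (subst csum.simps) simp

lemma csum_cong:
  assumes "\<And>x. r \<le> x \<Longrightarrow> x < p \<Longrightarrow> rt x = rt' x" "\<And>x. r < x \<Longrightarrow> x < p \<Longrightarrow> u x = u' x"
  shows "csum sc F r rt u p = csum sc F r rt' u' p"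
  using assms
proof (induction p rule: less_induct)
  case (less p)
  show ?case
  proof (cases "p \<le> r")
    case False
    have "(\<Prod>x\<in>{k<..<p}. u x) = (\<Prod>x\<in>{k<..<p}. u' x)" if "k \<in> {r..<p}" for k
      using that less.prems by (intro prod.cong) auto
    moreover have "csum sc F r rt u k = csum sc F r rt' u' k" if "k \<in> {r..<p}" for k
      using that less.prems by (intro less.IH) auto
    moreover have "r < p" using False by simp
    ultimately show ?thesis
      unfolding csum_rec[OF \<open>r < p\<close>] using less.prems(1) by (intro sum.cong refl) auto
  qed (simp add: csum_start)
qed

text \<open>The difference of two products, replacing one factor at a time: the summand of
  \<open>k\<close> has \<open>v\<close> below \<open>k\<close> and \<open>u\<close> above
  it.\<close>

lemma prod_telescope:
  fixes u v :: "nat \<Rightarrow> 'c::comm_ring_1"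
  assumes "j < p"
  shows "(\<Prod>x\<in>{j<..<p}. u x)
    - (\<Sum>k\<in>{j<..<p}. (\<Prod>x\<in>{k<..<p}. u x) * (u k - v k) * (\<Prod>x\<in>{j<..<k}. v x))
    = (\<Prod>x\<in>{j<..<p}. v x)"
proof -
  have "Suc j \<le> p" using assms by simp
  then show ?thesis
  proof (induction p rule: dec_induct)
    case base
    have "{j<..<Suc j} = {}" by auto
    then show ?case by simp
  next
    case (step p)
    have ins: "{k<..<Suc p} = insert p {k<..<p}" if "k < p" for k using that by auto
    have "(\<Sum>k\<in>{j<..<p}. (\<Prod>x\<in>{k<..<Suc p}. u x) * (u k - v k) * (\<Prod>x\<in>{j<..<k}. v x))
      = u p * (\<Sum>k\<in>{j<..<p}. (\<Prod>x\<in>{k<..<p}. u x) * (u k - v k) * (\<Prod>x\<in>{j<..<k}. v x))"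
      unfolding sum_distrib_left by (intro sum.cong refl) (simp add: ins mult.assoc)
    moreover have "{p<..<Suc p} = {}" by auto
    ultimately have "(\<Prod>x\<in>{j<..<Suc p}. u x)
      - (\<Sum>k\<in>{j<..<Suc p}. (\<Prod>x\<in>{k<..<Suc p}. u x) * (u k - v k) * (\<Prod>x\<in>{j<..<k}. v x))
      = u p * ((\<Prod>x\<in>{j<..<p}. u x) - (\<Sum>k\<in>{j<..<p}. (\<Prod>x\<in>{k<..<p}. u x) * (u k - v k) * (\<Prod>x\<in>{j<..<k}. v x)))
        - (u p - v p) * (\<Prod>x\<in>{j<..<p}. v x)"
      using step.hyps by (simp add: ins algebra_simps)
    also have "\<dots> = (\<Prod>x\<in>{j<..<Suc p}. v x)"
      unfolding step.IH using step.hyps by (simp add: ins algebra_simps)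
    finally show ?case .
  qed
qed

lemma sum_triangle_swap:
  fixes f :: "nat \<Rightarrow> nat \<Rightarrow> 'a::comm_monoid_add"
  shows "(\<Sum>k=r..<p. \<Sum>j=r..<k. f k j) = (\<Sum>j=r..<p. \<Sum>k\<in>{j<..<p}. f k j)"
proof -
  have "(\<Sum>k=r..<p. \<Sum>j=r..<k. f k j) = (\<Sum>k=r..<p. \<Sum>j=r..<p. if j < k then f k j else 0)"
    by (intro sum.cong refl sum.mono_neutral_cong_left) auto
  also have "\<dots> = (\<Sum>j=r..<p. \<Sum>k=r..<p. if j < k then f k j else 0)"
    by (rule sum.swap)
  also have "\<dots> = (\<Sum>j=r..<p. \<Sum>k\<in>{j<..<p}. f k j)"
    by (intro sum.cong refl sum.mono_neutral_cong_right) auto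
  finally show ?thesis .
qed

section \<open>Exchange of neighbouring links\<close>

locale chain_algebra = central_scalars sc for sc :: "'c::comm_ring_1 \<Rightarrow> 'a::ring_1" +
  fixes F :: "nat \<Rightarrow> nat \<Rightarrow> 'a" and r N :: nat
  assumes F_commute: "r \<le> i \<Longrightarrow> i < j \<Longrightarrow> j < k \<Longrightarrow> k < p \<Longrightarrow> p \<le> N \<Longrightarrow> F p k * F j i = F j i * F p k"
    and F_bracket: "r \<le> i \<Longrightarrow> i < k \<Longrightarrow> k < p \<Longrightarrow> p \<le> N \<Longrightarrow> F p k * F k i = F k i * F p k + F p i"
begin

lemma csum_commute:
  assumes "j < k" "k < p" "p \<le> N"
  shows "F p k * csum sc F r rt u j = csum sc F r rt u j * F p k"
  using assms(1)
proof (induction j rule: less_induct)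
  case (less j)
  show ?case
  proof (cases "j \<le> r")
    case False
    let ?T = "csum sc F r rt u"
    have "F p k * (sc c * (if rt i then ?T i * F j i else F j i * ?T i))
        = sc c * (if rt i then ?T i * F j i else F j i * ?T i) * F p k" if "i \<in> {r..<j}" for i c
    proof -
      have a: "F p k * ?T i = ?T i * F p k" using less that by auto
      have b: "F p k * F j i = F j i * F p k"
        using that less.prems assms by (intro F_commute) auto
      have "F p k * (?T i * F j i) = (?T i * F j i) * F p k" "F p k * (F j i * ?T i) = (F j i * ?T i) * F p k"
        using a b by (metis mult.assoc)+
      then show ?thesis by (simp add: sc_left_commute mult.assoc split: if_splits)
    qed
    then show ?thesis
      using False by (simp add: csum_rec sum_distrib_left sum_distrib_right)
  qed (simp add: csum_start)
qed

text \<open>The merging of links as in \<open>chain_comb_bracket\<close>, now with the weights of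
  the omitted sites recorded.\<close>

lemma csum_bracket:
  fixes u :: "nat \<Rightarrow> 'c"
  assumes "r \<le> k" "k < p" "p \<le> N"
  defines "T \<equiv> csum sc F r (\<lambda>_. False) u"
  shows "F p k * T k - T k * F p k = (\<Sum>j=r..<k. sc (\<Prod>x\<in>{j<..<k}. u x) * (F p j * T j))"
proof (cases "k = r")
  case True
  then show ?thesis by (simp add: T_def csum_start)
next
  case False
  have Tk: "T k = (\<Sum>j=r..<k. sc (\<Prod>x\<in>{j<..<k}. u x) * (F k j * T j))"
    using False assms(1) by (simp add: T_def csum_rec)
  have "F p k * (sc c * (F k j * T j)) - sc c * (F k j * T j) * F p k = sc c * (F p j * T j)"
    if "j \<in> {r..<k}" for j c
  proof -
    have "F p k * (F k j * T j) - F k j * (T j * F p k) = F p j * T j"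
    proof -
      have "F p k * F k j = F k j * F p k + F p j"
        using that assms by (intro F_bracket) auto
      moreover have "F p k * T j = T j * F p k"
        unfolding T_def using that assms by (intro csum_commute) auto
      ultimately show ?thesis
        by (metis (no_types, lifting) add_diff_cancel_left' distrib_right mult.assoc)
    qed
    then show ?thesis
      by (simp add: sc_left_commute mult.assoc right_diff_distrib[symmetric])
  qed
  then show ?thesis
    unfolding Tk by (simp add: sum_distrib_left sum_distrib_right sum_subtractf[symmetric])
qed

text \<open>Moving a factor past its neighbour at the site \<open>k\<close> merges two links, which is compensated
  by lowering the weight of \<open>k\<close> by one.\<close>

lemma csum_flip:
  assumes "p \<le> N"
  shows "csum sc F r rt u p = csum sc F r (\<lambda>_. False) (\<lambda>x. if rt x then u x - 1 else u x) p"
  using assms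
proof (induction p rule: less_induct)
  case (less p)
  define v where "v = (\<lambda>x. if rt x then u x - 1 else u x)"
  define T where "T = csum sc F r (\<lambda>_. False) v"
  show ?case
  proof (cases "p \<le> r")
    case False
    let ?U = "\<lambda>k p. \<Prod>x\<in>{k<..<p}. u x" and ?V = "\<lambda>k p. \<Prod>x\<in>{k<..<p}. v x"
    have "csum sc F r rt u p = (\<Sum>k=r..<p. sc (?U k p) *
      (if rt k then csum sc F r rt u k * F p k else F p k * csum sc F r rt u k))"
      using False by (simp add: csum_rec)
    also have "\<dots> = (\<Sum>k=r..<p. sc (?U k p) * (F p k * T k)
        - (\<Sum>j=r..<k. sc (?U k p * (u k - v k) * ?V j k) * (F p j * T j)))"
    proof (rule sum.cong[OF refl])
      fix k assume k: "k \<in> {r..<p}"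
      have T: "csum sc F r rt u k = T k"
        unfolding T_def v_def using k less by auto
      have b: "F p k * T k - T k * F p k = (\<Sum>j=r..<k. sc (?V j k) * (F p j * T j))"
        unfolding T_def using k less by (intro csum_bracket) auto
      have "(\<Sum>j=r..<k. sc (?U k p * (u k - v k) * ?V j k) * (F p j * T j))
        = sc (?U k p) * (sc (u k - v k) * (F p k * T k - T k * F p k))"
        unfolding b by (simp add: sum_distrib_left sc_mult mult.assoc)
      \<comment> \<open>The difference is 1 exactly at the sites where an exchange takes place, so
        one formula covers both orders.\<close>
      moreover have "u k - v k = (if rt k then 1 else 0)" by (simp add: v_def)
      ultimately show "sc (?U k p) * (if rt k then csum sc F r rt u k * F p k else F p k * csum sc F r rt u k)
        = sc (?U k p) * (F p k * T k)
        - (\<Sum>j=r..<k. sc (?U k p * (u k - v k) * ?V j k) * (F p j * T j))"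
        unfolding T by (simp add: sc_0 sc_1 right_diff_distrib split: if_splits)
    qed
    also have "\<dots> = (\<Sum>j=r..<p. sc (?U j p) * (F p j * T j)
        - (\<Sum>k\<in>{j<..<p}. sc (?U k p * (u k - v k) * ?V j k) * (F p j * T j)))"
      by (simp only: sum_subtractf sum_triangle_swap)
    \<comment> \<open>For fixed \<open>j\<close> the link from \<open>j\<close> to \<open>p\<close>
      collects what arises from merging at all sites between; with the original coefficient this
      telescopes to the product of the lowered weights.\<close>
    also have "\<dots> = (\<Sum>j=r..<p. sc (?V j p) * (F p j * T j))"
    proof (rule sum.cong[OF refl])
      fix j assume j: "j \<in> {r..<p}"
      have sc_sum: "sc (sum g A) = (\<Sum>a\<in>A. sc (g a))" for g and A :: "nat set"
        by (induction A rule: infinite_finite_induct) (simp_all add: sc_0 sc_add)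
      have "sc (?V j p) = sc (?U j p) - (\<Sum>k\<in>{j<..<p}. sc (?U k p * (u k - v k) * ?V j k))"
        unfolding sc_sum[symmetric] sc_diff[symmetric]
        by (subst prod_telescope) (use j in auto)
      then show "sc (?U j p) * (F p j * T j) - (\<Sum>k\<in>{j<..<p}. sc (?U k p * (u k - v k) * ?V j k) * (F p j * T j))
        = sc (?V j p) * (F p j * T j)"
        by (simp only: left_diff_distrib sum_distrib_right)
    qed
    also have "\<dots> = csum sc F r (\<lambda>_. False) v p"
      using False by (simp add: csum_rec T_def)
    finally show ?thesis by (simp add: v_def)
  qed (simp add: csum_start)
qed

end

lemma chain_algebra_ugl:
  assumes "1 \<le> r"
  shows "chain_algebra (scal :: 'k::field \<Rightarrow> ('k, 'm::finite, 'n::finite) ugl) E r (CARD('m) + CARD('n))"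
  by (unfold_locales) (use assms in \<open>auto intro!: lower_commute lower_bracket\<close>)

lemma chain_comb_csum:
  fixes u :: "nat \<Rightarrow> 'k::field" and r :: nat
  defines "T \<equiv> csum (scal :: 'k \<Rightarrow> ('k, 'm::finite, 'n::finite) ugl) E r (\<lambda>_. False) u"
  shows "r \<le> p \<Longrightarrow> chain_comb r p 1 (T p)"
proof (induction p rule: less_induct)
  case (less p)
  show ?case
  proof (cases "p = r")
    case True
    then show ?thesis using chain_comb.start[of r 1] by (simp add: T_def csum_start scal_1)
  next
    case False
    have e: "{p - Suc 0<..<p} = {}" by auto
    show ?thesis
    proof (rule chain_comb_stepI)
      show "r < p" using False less.prems by simp
      then show "T p = (\<Sum>k=r..<p. E p k * (scal (\<Prod>x\<in>{k<..<p}. u x) * T k))"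
        by (simp add: T_def csum_rec scal.sc_left_commute)
      show "chain_comb r k ((\<Prod>x\<in>{k<..<p}. u x) * 1)
          (scal (\<Prod>x\<in>{k<..<p}. u x) * T k)" if "k \<in> {r..<p}" for k
        by (rule chain_comb_scal, rule less.IH) (use that in auto)
    qed (simp add: e)
  qed
qed

section \<open>The highest weight condition for weighted chain sums\<close>

lemma move_right:
  assumes "a * b = scal \<sigma> * (b * a) + w"
  shows "a * (scal c * (b * t)) = scal c * (scal \<sigma> * (b * (a * t)) + w * t)"
proof -
  have "a * (scal c * (b * t)) = scal c * ((a * b) * t)"
    by (simp only: scal.sc_left_commute mult.assoc)
  then show ?thesis by (simp only: assms distrib_right mult.assoc)
qed

lemma chain_comb_weight:
  assumes "chain_comb r p c (X :: ('k::field, 'm::finite, 'n::finite) ugl)"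
    "1 \<le> r" "p \<le> CARD('m) + CARD('n)" "j \<in> {1..CARD('m) + CARD('n)}"
  shows "hv lam (E j j * X) =
    (\<lambda>s. (lam j + (if j = p then 1 else 0) - (if j = r then 1 else 0)) * hv lam X s)"
  using assms
proof (induction rule: chain_comb.induct)
  case (start c)
  have "E j j * scal c = (scal c * E j j :: ('k, 'm, 'n) ugl)" by (simp only: scal_central)
  then show ?case
    by (simp add: hv_scal_mult hv_diagonal[OF start(3)] hv_scal mult.left_commute)
next
  case (step p d X)
  have "hv lam (E j j * (E p k * X k)) =
    (\<lambda>s. (lam j + (if j = p then 1 else 0) - (if j = r then 1 else 0)) * hv lam (E p k * X k) s)"
    if k: "k \<in> {r..<p}" for k
  proof -
    let ?w = "\<lambda>p. lam j + (if j = p then 1 else 0) - (if j = r then 1 else 0)"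
    have "swap_sign (CARD('m)) (j, j) (p, k) = (1 :: 'k)"
      by (simp add: swap_sign_def parity_def)
    then have "E j j * E p k = scal 1 * (E p k * E j j)
        + (scal ((if j = p then 1 else 0) - (if k = j then 1 else 0)) * E p k :: ('k, 'm, 'n) ugl)"
      using E_relation[of j j p k, where 'k='k and 'm='m and 'n='n] step k
      by (auto simp: scal_1 scal.sc_0 scal.sc_minus)
    from move_right[OF this, of 1 "X k"]
    have "E j j * (E p k * X k) = E p k * (E j j * X k)
        + scal ((if j = p then 1 else 0) - (if k = j then 1 else 0)) * (E p k * X k)"
      by (simp only: scal_1 mult_1 mult.assoc)
    moreover have "hv lam (E p k * (E j j * X k)) = (\<lambda>s. ?w k * hv lam (E p k * X k) s)"
    proof -
      have "hv lam (E j j * X k) = hv lam (scal (?w k) * X k)"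
        using step k by (auto simp: hv_scal_mult)
      then have "hv lam (E p k * (E j j * X k)) = hv lam (E p k * (scal (?w k) * X k))"
        by (rule hv_cong_mult)
      then show ?thesis by (simp only: scal.sc_left_commute[of "E p k"] hv_scal_mult)
    qed
    ultimately show ?thesis
      by (auto simp: fun_eq_iff hv_add hv_scal_mult algebra_simps)
  qed
  then show ?case by (simp add: fun_eq_iff sum_distrib_left hv_sum)
qed

text \<open>The last links e(i+1,k) with k < i turn into e(i,k). The site i is omitted by these
  chains, which supplies the factor \<open>u i\<close>, and what remains is the recursion for
  \<open>T i\<close>. The link e(i+1,i) yields the Cartan element e(i,i) - e(i+1,i+1), with a plus
  sign at i = m; the summand 1 is the weight that \<open>T i\<close> adds to the coordinate
  i.\<close>

lemma csum_raise_last: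
  fixes u :: "nat \<Rightarrow> 'k::field" and r :: nat
  defines "T \<equiv> csum (scal :: 'k \<Rightarrow> ('k, 'm::finite, 'n::finite) ugl) E r (\<lambda>_. False) u"
  assumes r: "1 \<le> r" "r \<le> i" "i + 1 \<le> CARD('m) + CARD('n)"
  shows "hv lam (E i (i + 1) * T (i + 1)) = hv lam (scal ((if i = r then 0 else u i + 1)
    + lam i - (if i = CARD('m) then -1 else 1) * lam (i + 1)) * T i)"
proof -
  let ?K = "\<lambda>k p. \<Prod>x\<in>{k<..<p}. u x"
  let ?s = "if i = CARD('m) then -1 else 1 :: 'k"
  have T: "chain_comb r k 1 (T k)" if "r \<le> k" for k
    unfolding T_def using that by (rule chain_comb_csum)
  have Trec: "T (i + 1) = (\<Sum>k=r..<i. scal (?K k (i + 1)) * (E (i + 1) k * T k)) + E (i + 1) i * T i"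
  proof -
    have e: "{i<..<Suc i} = {}" by auto
    show ?thesis using r(2) by (simp add: T_def csum_rec[of r "Suc i"] e scal_1)
  qed
  have low: "hv lam (E i (i + 1) * (scal c * (E (i + 1) k * T k))) = hv lam (scal c * (E i k * T k))"
    if k: "k \<in> {r..<i}" for k c
  proof -
    define \<sigma> :: 'k where "\<sigma> = swap_sign (CARD('m)) (i, i + 1) (i + 1, k)"
    have "E i (i + 1) * E (i + 1) k = (scal \<sigma> * (E (i + 1) k * E i (i + 1)) + E i k :: ('k, 'm, 'n) ugl)"
      using raising_lowering[of k "i + 1" i, where 'k='k and 'm='m and 'n='n] r k by (simp add: \<sigma>_def)
    then have "E i (i + 1) * (scal c * (E (i + 1) k * T k))
        = scal c * (scal \<sigma> * (E (i + 1) k * (E i (i + 1) * T k)) + E i k * T k)"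
      by (rule move_right)
    moreover have "hv lam (E i (i + 1) * T k) = (\<lambda>s. 0)"
      using chain_comb_raise_0[OF T[of k] r(1)] k r by auto
    ultimately show ?thesis
      by (simp add: hv_scal_mult fun_eq_iff hv_add hv_mult_0)
  qed
  have last: "hv lam (E i (i + 1) * (E (i + 1) i * T i)) =
      hv lam (scal ((if i = r then 0 else 1) + lam i - ?s * lam (i + 1)) * T i)"
  proof -
    have "swap_sign (CARD('m)) (i, i + 1) (i + 1, i) = ?s"
      by (auto simp: swap_sign_def parity_def)
    then have "E i (i + 1) * E (i + 1) i = (scal ?s * (E (i + 1) i * E i (i + 1))
        + (E i i - scal ?s * E (i + 1) (i + 1)) :: ('k, 'm, 'n) ugl)"
      using raising_lowering[of i "i + 1" i, where 'k='k and 'm='m and 'n='n] r by simp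
    then have "E i (i + 1) * (E (i + 1) i * T i) = scal ?s * (E (i + 1) i * (E i (i + 1) * T i))
        + (E i i * T i - scal ?s * (E (i + 1) (i + 1) * T i))"
      by (simp only: mult.assoc[symmetric] distrib_right left_diff_distrib)
    moreover have "hv lam (E i (i + 1) * T i) = (\<lambda>s. 0)"
      using chain_comb_raise_0[OF T[of i] r(1)] r by auto
    then have "hv lam (E (i + 1) i * (E i (i + 1) * T i)) = (\<lambda>s. 0)"
      by (rule hv_mult_0)
    ultimately have "hv lam (E i (i + 1) * (E (i + 1) i * T i)) =
        (\<lambda>s. hv lam (E i i * T i) s - ?s * hv lam (E (i + 1) (i + 1) * T i) s)"
      by (simp only: fun_eq_iff hv_add hv_diff hv_scal_mult) simp
    also have "\<dots> = hv lam (scal ((if i = r then 0 else 1) + lam i - ?s * lam (i + 1)) * T i)"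
      using r by (simp add: chain_comb_weight[OF T[of i]] hv_scal_mult fun_eq_iff algebra_simps)
    finally show ?thesis .
  qed
  have "hv lam (E i (i + 1) * T (i + 1)) = (\<lambda>s. (\<Sum>k=r..<i. hv lam (scal (?K k (i + 1)) * (E i k * T k)) s)
     + hv lam (scal ((if i = r then 0 else 1) + lam i - ?s * lam (i + 1)) * T i) s)"
    unfolding Trec distrib_left sum_distrib_left
    by (rule ext) (simp only: hv_add hv_sum last low cong: sum.cong)
  also have "\<dots> = hv lam (scal ((if i = r then 0 else u i) + ((if i = r then 0 else 1) + lam i - ?s * lam (i + 1))) * T i)"
  proof (cases "i = r")
    case True
    then show ?thesis by simp
  next
    case False
    have K: "?K k (i + 1) = u i * ?K k i" if "k \<in> {r..<i}" for k
    proof -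
      have "{k<..<i + 1} = insert i {k<..<i}" using that by auto
      then show ?thesis by simp
    qed
    have Ti: "T i = (\<Sum>k=r..<i. scal (?K k i) * (E i k * T k))"
      using False r by (simp add: T_def csum_rec[of r i])
    have "(\<Sum>k=r..<i. scal (?K k (i + 1)) * (E i k * T k))
        = (\<Sum>k=r..<i. scal (u i) * (scal (?K k i) * (E i k * T k)))"
      by (rule sum.cong[OF refl]) (simp only: K scal_mult mult.assoc)
    also have "\<dots> = scal (u i) * T i"
      by (subst Ti) (simp only: sum_distrib_left)
    finally have "(\<Sum>k=r..<i. scal (?K k (i + 1)) * (E i k * T k)) = scal (u i) * T i" .
    then show ?thesis
      by (simp only: fun_eq_iff hv_sum[symmetric] hv_add[symmetric] False if_False)
        (simp only: scal_add[of "u i"] distrib_right simp_thms)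
  qed
  finally show ?thesis by (simp add: algebra_simps)
qed

text \<open>For p > i + 1 the raising operator reacts only with the last links leaving i and i + 1.
  Their contributions cancel because a chain from i that omits i + 1 carries the factor
  \<open>u (i + 1)\<close>; the assumed recursion on \<open>u\<close> says that raising
  \<open>T (i + 1)\<close> yields, on the vacuum, the same factor up to the odd sign.\<close>

lemma csum_highest_weight:
  fixes u :: "nat \<Rightarrow> 'k::field" and r :: nat
  defines "T \<equiv> csum (scal :: 'k \<Rightarrow> ('k, 'm::finite, 'n::finite) ugl) E r (\<lambda>_. False) u"
  assumes r: "1 \<le> r" "q \<le> CARD('m) + CARD('n)"
    and u: "\<And>i. r \<le> i \<Longrightarrow> i + 1 < q \<Longrightarrow> (if i = CARD('m) then -1 else 1) * u (i + 1) =
      (if i = r then 0 else u i + 1) + lam i - (if i = CARD('m) then -1 else 1) * lam (i + 1)"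
    and i: "r \<le> i" "i + 1 < q"
  shows "hv lam (E i (i + 1) * T q) = (\<lambda>s. 0)"
proof -
  let ?K = "\<lambda>k p. \<Prod>x\<in>{k<..<p}. u x"
  let ?s = "if i = CARD('m) then -1 else 1 :: 'k"
  have T: "chain_comb r k 1 (T k)" if "r \<le> k" for k
    unfolding T_def using that by (rule chain_comb_csum)
  have last: "hv lam (E i (i + 1) * T (i + 1)) = hv lam (scal (?s * u (i + 1)) * T i)"
  proof -
    have "?s * u (i + 1) = (if i = r then 0 else u i + 1) + lam i - ?s * lam (i + 1)"
      by (rule u[OF i])
    moreover have "hv lam (E i (i + 1) * T (i + 1)) =
        hv lam (scal ((if i = r then 0 else u i + 1) + lam i - ?s * lam (i + 1)) * T i)"
      unfolding T_def by (rule csum_raise_last) (use r i in auto)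
    ultimately show ?thesis by simp
  qed
  have "hv lam (E i (i + 1) * T p) = (\<lambda>s. 0)" if "i + 1 < p" "p \<le> q" for p
    using that
  proof (induction p rule: less_induct)
    case (less p)
    \<comment> \<open>The contribution of k = i + 1, and the negative of that of k = i.\<close>
    define A where "A = (\<lambda>s. ?s * ?K i p * hv lam (E p (i + 1) * T i) s)"
    have Kip: "?K i p = u (i + 1) * ?K (i + 1) p"
    proof -
      have "{i<..<p} = insert (i + 1) {i + 1<..<p}" using less.prems by auto
      then show ?thesis by simp
    qed
    have "hv lam (E i (i + 1) * (scal (?K k p) * (E p k * T k))) s =
        (if k = i + 1 then A s else 0) - (if k = i then A s else 0)" if k: "k \<in> {r..<p}" for k s
    proof -
      define \<sigma> :: 'k where "\<sigma> = swap_sign (CARD('m)) (i, i + 1) (p, k)"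
      have "E i (i + 1) * E p k = (scal \<sigma> * (E p k * E i (i + 1))
          + (- (scal \<sigma> * (if k = i then E p (i + 1) else 0))) :: ('k, 'm, 'n) ugl)"
        using raising_lowering[of k p i, where 'k='k and 'm='m and 'n='n] r k i less.prems
        by (simp add: \<sigma>_def)
      then have "E i (i + 1) * (scal (?K k p) * (E p k * T k)) = scal (?K k p) *
          (scal \<sigma> * (E p k * (E i (i + 1) * T k)) + (- (scal \<sigma> * (if k = i then E p (i + 1) else 0))) * T k)"
        by (rule move_right)
      then have eq: "hv lam (E i (i + 1) * (scal (?K k p) * (E p k * T k))) s = ?K k p *
          (\<sigma> * hv lam (E p k * (E i (i + 1) * T k)) s - (if k = i then \<sigma> * hv lam (E p (i + 1) * T k) s else 0))"
        by (simp add: hv_scal_mult hv_diff hv_0 mult.assoc)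
      consider "k < i" | "k = i" | "k = i + 1" | "i + 1 < k" by linarith
      then show ?thesis
      proof cases
        case 1
        have "hv lam (E i (i + 1) * T k) = (\<lambda>s. 0)"
          using chain_comb_raise_0[OF T[of k] r(1)] 1 k r less.prems by auto
        then show ?thesis using 1 unfolding eq by (simp add: hv_mult_0)
      next
        case 2
        have "hv lam (E i (i + 1) * T k) = (\<lambda>s. 0)"
          using chain_comb_raise_0[OF T[of k] r(1)] 2 k r less.prems by auto
        moreover have "\<sigma> = ?s"
          using 2 less.prems by (auto simp: \<sigma>_def swap_sign_def parity_def)
        ultimately show ?thesis using 2 unfolding eq by (simp add: hv_mult_0 A_def)
      next
        case 3
        have "\<sigma> = 1"
          using 3 less.prems by (auto simp: \<sigma>_def swap_sign_def parity_def)
        moreover have "hv lam (E p k * (E i (i + 1) * T k)) = (\<lambda>s. ?s * u (i + 1) * hv lam (E p k * T i) s)"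
          using hv_cong_mult[OF last, of "E p k"] 3 by (simp only: scal.sc_left_commute hv_scal_mult)
        ultimately show ?thesis using 3 unfolding eq by (simp add: A_def Kip)
      next
        case 4
        have "hv lam (E i (i + 1) * T k) = (\<lambda>s. 0)"
          using 4 k less by auto
        then show ?thesis using 4 unfolding eq by (simp add: hv_mult_0)
      qed
    qed
    moreover have "T p = (\<Sum>k=r..<p. scal (?K k p) * (E p k * T k))"
      using i less.prems by (simp add: T_def csum_rec[of r p])
    ultimately show ?case
      using i less.prems
      by (simp add: fun_eq_iff sum_distrib_left hv_sum sum_subtractf)
  qed
  then show ?thesis using i by blast
qed

section \<open>Partitions of a root and Sapovalov elements\<close>

inductive chain_ms :: "nat \<Rightarrow> nat \<Rightarrow> (nat \<times> nat) multiset \<Rightarrow> bool" for a where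
  nil: "chain_ms a a {#}"
| link: "chain_ms a k \<pi> \<Longrightarrow> k < p \<Longrightarrow> chain_ms a p (add_mset (k, p) \<pi>)"

lemma chain_ms_ge: "chain_ms a p \<pi> \<Longrightarrow> a \<le> p"
  by (induction rule: chain_ms.induct) auto

lemma chain_ms_elem: "chain_ms a p \<pi> \<Longrightarrow> (i, j) \<in># \<pi> \<Longrightarrow> a \<le> i \<and> i < j \<and> j \<le> p"
proof (induction rule: chain_ms.induct)
  case (link k \<pi> p)
  then show ?case using chain_ms_ge[OF link(1)] by auto
qed simp

lemma chain_ms_count: "chain_ms a p \<pi> \<Longrightarrow> count \<pi> x \<le> 1"
proof (induction rule: chain_ms.induct)
  case (link k \<pi> p)
  have "(k, p) \<notin># \<pi>" using chain_ms_elem[OF link(1), of k p] link(2) by auto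
  then have "count \<pi> (k, p) = 0" by (simp add: not_in_iff)
  then show ?case using link by auto
qed simp

lemma chain_ms_last_unique:
  "chain_ms a p \<pi> \<Longrightarrow> (i, p) \<in># \<pi> \<Longrightarrow> (i', p) \<in># \<pi> \<Longrightarrow> i = i'"
proof (induction rule: chain_ms.induct)
  case (link k \<pi> p)
  have "(x, p) \<notin># \<pi>" for x using chain_ms_elem[OF link(1), of x p] link(2) by auto
  then show ?case using link by auto
qed simp

lemma chain_ms_weight:
  "chain_ms a p \<pi> \<Longrightarrow> (\<Sum>\<alpha>\<in>#\<pi>. root_weight \<alpha> k) = (root_weight (a, p) k :: 'k::comm_ring_1)"
  by (induction rule: chain_ms.induct) (auto simp: root_weight_def)

lemma sum_root_weight:
  "(\<Sum>\<alpha>\<in>#\<pi>. root_weight \<alpha> k) =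
     (of_nat (size (filter_mset (\<lambda>\<alpha>. fst \<alpha> = k) \<pi>))
      - of_nat (size (filter_mset (\<lambda>\<alpha>. snd \<alpha> = k) \<pi>)) :: 'k::comm_ring_1)"
  by (induction \<pi>) (auto simp: root_weight_def coord_def algebra_simps split: prod.splits)

text \<open>Let J be the largest upper end. No root of the multiset starts at J, so the coordinate J
  of the sum is minus the number of roots ending there. In characteristic 0 this forces J = b, and
  removing a root (k, b) leaves a sum for (a, k).\<close>

lemma root_sum_chain_ms:
  assumes "\<And>i j. (i, j) \<in># \<pi> \<Longrightarrow> i < j"
    and "\<And>k. (\<Sum>\<alpha>\<in>#\<pi>. root_weight \<alpha> k) = (root_weight (a, b) k :: 'k::field_char_0)"
  shows "chain_ms a b \<pi>"
  using assms
proof (induction "size \<pi>" arbitrary: b \<pi>)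
  case 0
  then have "\<pi> = {#}" by simp
  moreover have "a = b" using 0(3)[of a] \<open>\<pi> = {#}\<close>
    by (auto simp: root_weight_def coord_def split: if_splits)
  ultimately show ?case by (auto intro: chain_ms.nil)
next
  case (Suc n)
  define J where "J = Max (snd ` set_mset \<pi>)"
  have ne: "set_mset \<pi> \<noteq> {}" using Suc(2) by auto
  have le: "j \<le> J" if "(i, j) \<in># \<pi>" for i j
    unfolding J_def using that by (intro Max_ge) force+
  have "J \<in> snd ` set_mset \<pi>"
    unfolding J_def by (rule Max_in) (use ne in auto)
  then obtain k where k: "(k, J) \<in># \<pi>" by auto
  have "filter_mset (\<lambda>\<alpha>. fst \<alpha> = J) \<pi> = {#}"
  proof (rule multiset_eqI)
    fix \<alpha>
    have "fst \<alpha> \<noteq> J" if "\<alpha> \<in># \<pi>"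
      using le[of "fst \<alpha>" "snd \<alpha>"] Suc.prems(1)[of "fst \<alpha>" "snd \<alpha>"] that by auto
    then show "count (filter_mset (\<lambda>\<alpha>. fst \<alpha> = J) \<pi>) \<alpha> = count {#} \<alpha>"
      by (cases "\<alpha> \<in># \<pi>") (auto simp: not_in_iff)
  qed
  moreover have "size (filter_mset (\<lambda>\<alpha>. snd \<alpha> = J) \<pi>) > 0"
  proof -
    have "(k, J) \<in># filter_mset (\<lambda>\<alpha>. snd \<alpha> = J) \<pi>" using k by simp
    then show ?thesis by (metis empty_iff nonempty_has_size set_mset_empty)
  qed
  then obtain l where "size (filter_mset (\<lambda>\<alpha>. snd \<alpha> = J) \<pi>) = Suc l"
    using gr0_implies_Suc by blast
  ultimately have l: "(\<Sum>\<alpha>\<in>#\<pi>. root_weight \<alpha> J) = (- of_nat (Suc l) :: 'k)"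
    by (simp add: sum_root_weight)
  have b: "b = J"
  proof (rule ccontr)
    assume "b \<noteq> J"
    then have "- of_nat (Suc l) = (if J = a then 1 else 0 :: 'k)"
      using l Suc.prems(2)[of J] by (auto simp: root_weight_def coord_def)
    then have "of_nat (Suc l) + (if J = a then 1 else 0) = (0 :: 'k)"
      by (metis add.right_inverse)
    then have "of_nat (Suc l + (if J = a then 1 else 0)) = (0 :: 'k)"
      by (simp only: of_nat_add if_distrib[of of_nat] of_nat_1 of_nat_0)
    then show False by (simp only: of_nat_eq_0_iff add_Suc nat.distinct)
  qed
  define \<pi>' where "\<pi>' = \<pi> - {#(k, J)#}"
  have \<pi>: "\<pi> = add_mset (k, J) \<pi>'" using k by (simp add: \<pi>'_def)
  have "chain_ms a k \<pi>'"
  proof (rule Suc.hyps(1))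
    show "n = size \<pi>'" using Suc.hyps(2) by (simp add: \<pi>)
    show "i < j" if "(i, j) \<in># \<pi>'" for i j using Suc.prems(1) that by (simp add: \<pi>)
    show "(\<Sum>\<alpha>\<in>#\<pi>'. root_weight \<alpha> x) = (root_weight (a, k) x :: 'k)" for x
      using Suc.prems(2)[of x] by (simp add: \<pi> b root_weight_def algebra_simps)
  qed
  then show ?case unfolding \<pi> b by (rule chain_ms.link) (use Suc.prems(1) k in auto)
qed

lemma root_partitions_eq:
  assumes "1 \<le> r" "q \<le> m + n"
  shows "root_partitions TYPE('k::field_char_0) m n (r, q) = {\<pi>. chain_ms r q \<pi>}"
proof (intro equalityI subsetI)
  fix \<pi> assume "\<pi> \<in> root_partitions TYPE('k) m n (r, q)"
  then have "\<And>i j. (i, j) \<in># \<pi> \<Longrightarrow> i < j"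
    "\<And>k. (\<Sum>\<alpha>\<in>#\<pi>. root_weight \<alpha> k) = (root_weight (r, q) k :: 'k)"
    by (auto simp: root_partitions_def pos_roots_def)
  then show "\<pi> \<in> {\<pi>. chain_ms r q \<pi>}" using root_sum_chain_ms by blast
next
  fix \<pi> assume "\<pi> \<in> {\<pi>. chain_ms r q \<pi>}"
  then have "chain_ms r q \<pi>" by simp
  then show "\<pi> \<in> root_partitions TYPE('k) m n (r, q)"
    using assms chain_ms_elem[of r q \<pi>] chain_ms_count[of r q \<pi>] chain_ms_weight[of r q \<pi>, where 'k='k]
    by (force simp: root_partitions_def pos_roots_def)
qed

lemma finite_chain_ms: "finite {\<pi>. chain_ms a p \<pi>}"
proof (rule finite_subset)
  show "{\<pi>. chain_ms a p \<pi>} \<subseteq> mset_set ` Pow ({a..p} \<times> {a..p})"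
  proof
    fix \<pi> assume "\<pi> \<in> {\<pi>. chain_ms a p \<pi>}"
    then have c: "chain_ms a p \<pi>" by simp
    have "\<pi> = mset_set (set_mset \<pi>)"
    proof (rule multiset_eqI)
      fix x
      have "count \<pi> x \<le> 1" by (rule chain_ms_count[OF c])
      then have "x \<in># \<pi> \<Longrightarrow> count \<pi> x = 1" by (simp add: le_antisym)
      then show "count \<pi> x = count (mset_set (set_mset \<pi>)) x"
        by (cases "x \<in># \<pi>") (auto simp: not_in_iff)
    qed
    moreover have "set_mset \<pi> \<subseteq> {a..p} \<times> {a..p}"
      using chain_ms_elem[OF c] by fastforce
    ultimately show "\<pi> \<in> mset_set ` Pow ({a..p} \<times> {a..p})" by blast
  qed
qed auto

section \<open>Ordered products along a chain and their leading coefficients\<close>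

lemma prod_list_commute:
  fixes c :: "'a::monoid_mult"
  shows "(\<And>x. x \<in> set xs \<Longrightarrow> c * x = x * c) \<Longrightarrow> c * prod_list xs = prod_list xs * c"
proof (induction xs)
  case (Cons x xs)
  then have "c * x = x * c" "c * prod_list xs = prod_list xs * c" by auto
  then show ?case by (simp add: mult.assoc) (metis mult.assoc)
qed simp

text \<open>The factors of \<open>e_minus rs \<pi>\<close> that do not commute with the last link of the chain are
  all on one side of it, as there is at most one of them.\<close>

lemma e_minus_add_last:
  assumes rs: "root_order (CARD('m::finite)) (CARD('n::finite)) rs"
    and \<pi>: "chain_ms r k \<pi>" and k: "1 \<le> r" "k < p" "p \<le> CARD('m) + CARD('n)"
  defines "e \<equiv> e_minus rs :: _ \<Rightarrow> ('k::field, 'm, 'n) ugl"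
  shows "e (add_mset (k, p) \<pi>) = E p k * e \<pi> \<or> e (add_mset (k, p) \<pi>) = e \<pi> * E p k"
proof -
  have d: "distinct rs" and s: "set rs = pos_roots (CARD('m)) (CARD('n))"
    using rs by (auto simp: root_order_def)
  have rk: "r \<le> k" using chain_ms_ge[OF \<pi>] .
  then have "(k, p) \<in> set rs" using k by (auto simp: s pos_roots_def)
  then obtain l1 l2 where l: "rs = l1 @ (k, p) # l2" by (meson split_list)
  have nin: "(k, p) \<notin> set l1" "(k, p) \<notin> set l2" using d l by auto
  define g :: "(nat \<times> nat) multiset \<Rightarrow> nat \<times> nat \<Rightarrow> ('k, 'm, 'n) ugl"
    where "g = (\<lambda>\<pi> (i, j). E j i ^ count \<pi> (i, j))"
  have "(k, p) \<notin># \<pi>" using chain_ms_elem[OF \<pi>, of k p] k by auto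
  then have c0: "count \<pi> (k, p) = 0" by (simp add: not_in_iff)
  have e: "e \<pi> = prod_list (map (g \<pi>) rs)" for \<pi>
    by (simp add: e_def e_minus_def g_def)
  have g1: "map (g (add_mset (k, p) \<pi>)) l1 = map (g \<pi>) l1"
    and g2: "map (g (add_mset (k, p) \<pi>)) l2 = map (g \<pi>) l2"
    using nin by (auto simp: g_def)
  let ?A = "prod_list (map (g \<pi>) l1)" and ?B = "prod_list (map (g \<pi>) l2)"
  have new: "e (add_mset (k, p) \<pi>) = ?A * (E p k * ?B)"
    unfolding e l map_append list.map g1 g2 by (simp add: g_def c0)
  have old: "e \<pi> = ?A * ?B"
    unfolding e l by (simp add: g_def c0)
  have comm: "E p k * g \<pi> x = g \<pi> x * E p k" if x: "\<not> (x \<in># \<pi> \<and> snd x = k)" for x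
  proof (cases "x \<in># \<pi>")
    case True
    obtain i j where ij: "x = (i, j)" by (cases x)
    have "r \<le> i \<and> i < j \<and> j \<le> k" using chain_ms_elem[OF \<pi>] True ij by auto
    then have "E p k * E j i = (E j i * E p k :: ('k, 'm, 'n) ugl)"
      using x True ij k by (intro lower_commute) auto
    then show ?thesis by (simp add: g_def ij power_commuting_commutes)
  next
    case False
    then show ?thesis by (cases x) (simp add: g_def not_in_iff)
  qed
  show ?thesis
  proof (cases "\<exists>x\<in>set l2. x \<in># \<pi> \<and> snd x = k")
    case False
    then have "E p k * ?B = ?B * E p k" by (intro prod_list_commute) (auto intro: comm)
    then show ?thesis unfolding new old by (simp add: mult.assoc)
  next
    case True
    then obtain i where i: "(i, k) \<in> set l2" "(i, k) \<in># \<pi>" by auto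
    have "\<not> (x \<in># \<pi> \<and> snd x = k)" if "x \<in> set l1" for x
    proof
      assume x: "x \<in># \<pi> \<and> snd x = k"
      then have "x = (i, k)" using chain_ms_last_unique[OF \<pi>, of "fst x" i] i(2) by (cases x) auto
      then show False using d l that i(1) by auto
    qed
    then have "E p k * ?A = ?A * E p k" by (intro prod_list_commute) (auto intro: comm)
    then have "e (add_mset (k, p) \<pi>) = E p k * e \<pi>"
      unfolding new old by (simp only: mult.assoc[symmetric])
    then show ?thesis ..
  qed
qed

text \<open>Multiplying by a link from the left or from the right has the same effect on the leading
  coefficient, so the order of the roots does not matter.\<close>

lemma chain_comb_e_minus:
  assumes "chain_ms r p \<pi>" and rs: "root_order (CARD('m::finite)) (CARD('n::finite)) rs"
    and "1 \<le> r" "p \<le> CARD('m) + CARD('n)"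
  shows "chain_comb r p (if set_mset \<pi> \<subseteq> simple_roots (CARD('m)) (CARD('n)) then 1 else 0)
     (e_minus rs \<pi> :: ('k::field, 'm, 'n) ugl)"
  using assms(1,4)
proof (induction rule: chain_ms.induct)
  case nil
  have "e_minus rs {#} = (1 :: ('k, 'm, 'n) ugl)"
    by (induction rs) (auto simp: e_minus_def)
  then show ?case using chain_comb.start[of r 1] by (simp add: scal_1)
next
  case (link k \<pi> p)
  let ?S = "simple_roots (CARD('m)) (CARD('n))"
  let ?c = "\<lambda>\<pi>. if set_mset \<pi> \<subseteq> ?S then 1 else 0 :: 'k"
  have IH: "chain_comb r k (?c \<pi>) (e_minus rs \<pi> :: ('k, 'm, 'n) ugl)"
    using link by auto
  have c: "?c (add_mset (k, p) \<pi>) = (if p = Suc k then ?c \<pi> else 0)"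
    using link chain_ms_ge[OF link(1)] assms(3) by (auto simp: simple_roots_def pos_roots_def)
  show ?case
    unfolding c
    using e_minus_add_last[OF rs link(1) assms(3) link(2) link.prems, where 'k='k]
      chain_comb_link_left[OF IH link(2)] chain_comb_link_right[OF IH assms(3) link(2) link.prems]
    by (elim disjE) (simp_all only:)
qed

definition simple_chain :: "nat \<Rightarrow> nat \<Rightarrow> (nat \<times> nat) multiset"
  where "simple_chain r p = mset (map (\<lambda>i. (i, Suc i)) [r..<p])"

lemma simple_chain_Suc: "r \<le> p \<Longrightarrow> simple_chain r (Suc p) = add_mset (p, Suc p) (simple_chain r p)"
  by (simp add: simple_chain_def)

lemma chain_ms_simple_chain: "r \<le> p \<Longrightarrow> chain_ms r p (simple_chain r p)"
proof (induction p rule: dec_induct)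
  case base
  then show ?case by (simp add: simple_chain_def chain_ms.nil)
next
  case (step p)
  then show ?case by (auto simp: simple_chain_Suc intro: chain_ms.link)
qed

lemma chain_ms_simple_unique:
  "chain_ms r p \<pi> \<Longrightarrow> set_mset \<pi> \<subseteq> simple_roots m n \<Longrightarrow> \<pi> = simple_chain r p"
proof (induction rule: chain_ms.induct)
  case nil
  then show ?case by (simp add: simple_chain_def)
next
  case (link k \<pi> p)
  then have "p = Suc k" by (auto simp: simple_roots_def)
  then show ?case using link chain_ms_ge[OF link(1)] by (simp add: simple_chain_Suc)
qed

lemma simple_chain_simple:
  "1 \<le> r \<Longrightarrow> p \<le> m + n \<Longrightarrow> set_mset (simple_chain r p) \<subseteq> simple_roots m n"
  by (auto simp: simple_chain_def simple_roots_def pos_roots_def)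

lemma cp_eval_1: "cp_eval m n lam 1 = (1 :: 'k::field)"
  by (simp add: cp_eval_def lookup_one)

lemma chain_comb_sap_eval:
  assumes H: "sapovalov TYPE('m::finite) TYPE('n::finite) rs (r, q) H"
    and rs: "root_order (CARD('m)) (CARD('n)) rs"
    and r: "1 \<le> r" "r \<le> q" "q \<le> CARD('m) + CARD('n)"
  shows "chain_comb r q 1
    (sap_eval (CARD('m)) (CARD('n)) rs (r, q) H lam :: ('k::field_char_0, 'm, 'n) ugl)"
proof -
  let ?P = "{\<pi>. chain_ms r q \<pi>}" and ?S = "simple_roots (CARD('m)) (CARD('n))"
  let ?ev = "\<lambda>\<pi>. cp_eval (CARD('m)) (CARD('n)) lam (H \<pi>)"
  have P: "root_partitions TYPE('k) (CARD('m)) (CARD('n)) (r, q) = ?P"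
    using r by (intro root_partitions_eq) auto
  have "chain_comb r q (\<Sum>\<pi>\<in>?P. ?ev \<pi> * (if set_mset \<pi> \<subseteq> ?S then 1 else 0))
    (\<Sum>\<pi>\<in>?P. scal (?ev \<pi>) * e_minus rs \<pi> :: ('k, 'm, 'n) ugl)"
    using r rs by (intro chain_comb_sum chain_comb_scal chain_comb_e_minus) auto
  also have "(\<Sum>\<pi>\<in>?P. scal (?ev \<pi>) * e_minus rs \<pi> :: ('k, 'm, 'n) ugl)
      = sap_eval (CARD('m)) (CARD('n)) rs (r, q) H lam"
    by (simp add: sap_eval_def P)
  also have "(\<Sum>\<pi>\<in>?P. ?ev \<pi> * (if set_mset \<pi> \<subseteq> ?S then 1 else 0)) =
      (\<Sum>\<pi>\<in>?P. if \<pi> = simple_chain r q then 1 else 0)"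
  proof (rule sum.cong[OF refl])
    fix \<pi> assume "\<pi> \<in> ?P"
    then have \<pi>: "chain_ms r q \<pi>" by simp
    show "?ev \<pi> * (if set_mset \<pi> \<subseteq> ?S then 1 else 0) = (if \<pi> = simple_chain r q then 1 else 0)"
    proof (cases "set_mset \<pi> \<subseteq> ?S")
      case True
      then have "H \<pi> = 1" using H \<pi> unfolding sapovalov_def Let_def P by blast
      then show ?thesis using True chain_ms_simple_unique[OF \<pi> True] by (simp add: cp_eval_1)
    next
      case False
      then have "\<pi> \<noteq> simple_chain r q" using simple_chain_simple[OF r(1,3)] by auto
      then show ?thesis using False by simp
    qed
  qed
  also have "\<dots> = 1"
    using finite_chain_ms[of r q] chain_ms_simple_chain[OF r(2)] by simp
  finally show ?thesis .
qed

section \<open>From the Sapovalov element to its evaluation\<close>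

lemma hv_E_power:
  assumes "i \<in> {1..CARD('m) + CARD('n)}" "hv lam X = (\<lambda>s. c * vacuum s)"
  shows "hv lam (E i i ^ k * X :: ('k::field, 'm::finite, 'n::finite) ugl) = (\<lambda>s. lam i ^ k * c * vacuum s)"
proof (induction k)
  case (Suc k)
  have "hv lam (E i i ^ Suc k * X) = app (fock_rep lam (E i i :: ('k, 'm, 'n) ugl)) (hv lam (E i i ^ k * X))"
    by (simp only: power_Suc mult.assoc hv_mult)
  also have "\<dots> = (\<lambda>s. (lam i ^ k * c) * app (fock_rep lam (E i i :: ('k, 'm, 'n) ugl)) vacuum s)"
    by (simp only: Suc app_scale)
  also have "\<dots> = (\<lambda>s. lam i ^ Suc k * c * vacuum s)"
    using hv_diagonal[OF assms(1), of lam] by (simp add: hv_def fun_eq_iff)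
  finally show ?case .
qed (simp add: assms)

lemma hv_cp_embed:
  "hv lam (cp_embed (CARD('m)) (CARD('n)) p :: ('k::field, 'm::finite, 'n::finite) ugl)
    = hv lam (scal (cp_eval (CARD('m)) (CARD('n)) lam p) :: ('k, 'm, 'n) ugl)"
proof -
  let ?N = "CARD('m) + CARD('n)"
  have *: "hv lam (prod_list (map (\<lambda>i. E i i ^ t i) is) :: ('k, 'm, 'n) ugl)
      = (\<lambda>s. (\<Prod>i\<in>set is. lam i ^ t i) * vacuum s)"
    if "distinct is" "set is \<subseteq> {1..?N}" for t "is"
    using that
  proof (induction "is")
    case Nil
    then show ?case by (simp add: hv_def fock_rep_1 app_1)
  next
    case (Cons i "is")
    then show ?case by (simp add: hv_E_power mult.assoc)
  qed
  have s: "set [1..<?N+1] = {1..?N}" by auto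
  have "hv lam (prod_list (map (\<lambda>i. E i i ^ t i) [1..<?N+1]) :: ('k, 'm, 'n) ugl)
      = (\<lambda>s. (\<Prod>i=1..?N. lam i ^ t i) * vacuum s)" for t
    using *[of "[1..<?N+1]" t] unfolding s by simp
  then show ?thesis
    by (simp add: cp_embed_def cp_eval_def fun_eq_iff hv_sum hv_scal_mult hv_scal sum_distrib_right mult.assoc
      del: upt_Suc)
qed

text \<open>The Cartan coefficients stand to the right of the lowering products, so they meet the
  vacuum first and act by their values at \<open>lam\<close>.\<close>

lemma hv_sap_elem:
  "hv lam (sap_elem (CARD('m)) (CARD('n)) rs \<gamma> H :: ('k::field, 'm::finite, 'n::finite) ugl)
    = hv lam (sap_eval (CARD('m)) (CARD('n)) rs \<gamma> H lam :: ('k, 'm, 'n) ugl)"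
proof -
  have "hv lam (e_minus rs \<pi> * cp_embed (CARD('m)) (CARD('n)) (H \<pi>) :: ('k, 'm, 'n) ugl)
      = hv lam (scal (cp_eval (CARD('m)) (CARD('n)) lam (H \<pi>)) * e_minus rs \<pi> :: ('k, 'm, 'n) ugl)" for \<pi>
    using hv_cong_mult[OF hv_cp_embed, where X = "e_minus rs \<pi>"] by (simp only: scal_central)
  then show ?thesis
    by (simp add: sap_elem_def sap_eval_def fun_eq_iff hv_sum)
qed

text \<open>On the vacuum h_\<gamma> + \<rho>(h_\<gamma>) acts by the scalar (\<lambda> + \<rho>,
  \<gamma>) = 0, and the positive root vectors act by zero.\<close>

lemma hv_sap_left_ideal:
  assumes lam: "form (CARD('m)) (CARD('n)) (rho_shift (CARD('m)) (CARD('n)) lam) (root_weight \<gamma>) = 0"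
    and x: "x \<in> (sap_left_ideal (CARD('m)) (CARD('n)) \<gamma> :: ('k::field, 'm::finite, 'n::finite) ugl set)"
  shows "hv lam x = (\<lambda>s. 0)"
proof -
  let ?m = "CARD('m)" and ?n = "CARD('n)"
  let ?h = "h_of ?m ?n (root_weight \<gamma>)"
  let ?z = "cartan ?m ?n ?h + scal (pairing ?m ?n (rho ?m ?n) ?h) :: ('k, 'm, 'n) ugl"
  obtain a y where x: "x = a * ?z + (\<Sum>(i, j) \<in> pos_roots ?m ?n. y (i, j) * E i j)"
    using x by (auto simp: sap_left_ideal_def)
  have "hv lam (cartan ?m ?n ?h :: ('k, 'm, 'n) ugl) = (\<lambda>s. pairing ?m ?n lam ?h * vacuum s)"
    by (rule ext) (simp add: cartan_def pairing_def hv_sum hv_scal_mult hv_diagonal sum_distrib_left mult_ac)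
  then have "hv lam ?z = (\<lambda>s. (pairing ?m ?n lam ?h + pairing ?m ?n (rho ?m ?n) ?h) * vacuum s)"
    by (simp add: fun_eq_iff hv_add hv_scal distrib_right)
  also have "pairing ?m ?n lam ?h + pairing ?m ?n (rho ?m ?n) ?h = pairing ?m ?n (rho_shift ?m ?n lam) ?h"
    by (simp add: pairing_def rho_shift_def distrib_right sum.distrib)
  also have "\<dots> = 0" using lam by (simp add: pairing_h_of)
  finally have "hv lam ?z = (\<lambda>s. 0)" by simp
  then have "hv lam (a * ?z) = (\<lambda>s. 0)" by (rule hv_mult_0)
  moreover have "hv lam (\<Sum>(i, j) \<in> pos_roots ?m ?n. y (i, j) * E i j) = (\<lambda>s. 0)"
    by (intro hv_sum_0) (auto simp: pos_roots_def intro!: hv_mult_0 hv_raising)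
  ultimately show ?thesis unfolding x by (simp add: fun_eq_iff hv_add)
qed

lemma sap_eval_highest_weight:
  assumes H: "sapovalov TYPE('m::finite) TYPE('n::finite) rs \<gamma> H"
    and lam: "form (CARD('m)) (CARD('n)) (rho_shift (CARD('m)) (CARD('n)) lam) (root_weight \<gamma>) = 0"
    and i: "1 \<le> i" "i < j" "j \<le> CARD('m) + CARD('n)"
  shows "hv lam (E i j * sap_eval (CARD('m)) (CARD('n)) rs \<gamma> H lam :: ('k::field, 'm, 'n) ugl) = (\<lambda>s. 0)"
proof -
  have "(i, j) \<in> pos_roots (CARD('m)) (CARD('n))" using i by (simp add: pos_roots_def)
  then have "E i j * sap_elem (CARD('m)) (CARD('n)) rs \<gamma> H
      \<in> (sap_left_ideal (CARD('m)) (CARD('n)) \<gamma> :: ('k, 'm, 'n) ugl set)"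
    using H unfolding sapovalov_def Let_def by blast
  from hv_sap_left_ideal[OF lam this] show ?thesis
    by (simp only: hv_cong_mult[OF hv_sap_elem])
qed

lemma sap_eval_eq_csum:
  fixes u :: "nat \<Rightarrow> 'k::field_char_0" and r :: nat
  assumes H: "sapovalov TYPE('m::finite) TYPE('n::finite) rs (r, q) H"
    and rs: "root_order (CARD('m)) (CARD('n)) rs"
    and r: "1 \<le> r" "r \<le> q" "q \<le> CARD('m) + CARD('n)"
    and lam: "form (CARD('m)) (CARD('n)) (rho_shift (CARD('m)) (CARD('n)) lam) (root_weight (r, q)) = 0"
    and u: "\<And>i. r \<le> i \<Longrightarrow> i + 1 < q \<Longrightarrow> (if i = CARD('m) then -1 else 1) * u (i + 1) =
      (if i = r then 0 else u i + 1) + lam i - (if i = CARD('m) then -1 else 1) * lam (i + 1)"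
  shows "(sap_eval (CARD('m)) (CARD('n)) rs (r, q) H lam :: ('k, 'm, 'n) ugl) =
    csum scal E r (\<lambda>_. False) u q"
proof -
  let ?X = "sap_eval (CARD('m)) (CARD('n)) rs (r, q) H lam :: ('k, 'm, 'n) ugl"
  let ?T = "csum scal E r (\<lambda>_. False) u q :: ('k, 'm, 'n) ugl"
  have "?X - ?T = 0"
  proof (rule chain_comb_unique[OF _ r(1,3)])
    show "chain_comb r q 0 (?X - ?T)"
      using chain_comb_diff[OF chain_comb_sap_eval[OF H rs r] chain_comb_csum[OF r(2)]] by simp
    fix i assume i: "r \<le> i" "i + 1 < q"
    have "hv lam (E i (i + 1) * ?X) = (\<lambda>s. 0)"
      by (rule sap_eval_highest_weight[OF H lam]) (use i r in auto)
    moreover have "hv lam (E i (i + 1) * ?T) = (\<lambda>s. 0)"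
      by (rule csum_highest_weight[OF r(1,3) u i])
    ultimately show "hv lam (E i (i + 1) * (?X - ?T)) = (\<lambda>s. 0)"
      by (simp add: right_diff_distrib fun_eq_iff hv_diff)
  qed
  then show ?thesis by simp
qed

section \<open>The determinants as sums over chains\<close>

lemma opp_mult: "opp (x * y) = opp y * opp x"
  by (simp only: unopp_inject[symmetric] unopp_mult opp_inverse[OF UNIV_I])

lemma opp_sum: "opp (sum f A) = (\<Sum>a\<in>A. opp (f a))"
  by (simp only: unopp_inject[symmetric] unopp_sum opp_inverse[OF UNIV_I])

lemma opp_one: "opp 1 = 1"
  by (simp only: unopp_inject[symmetric] unopp_one opp_inverse[OF UNIV_I])

lemma unopp_sign: "unopp ((-1) ^ k) = (-1) ^ k"
  by (induction k) (simp_all add: unopp_one unopp_uminus)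

lemma minus_one_power_commute: "x * (-1) ^ k = (-1) ^ k * (x :: 'a::ring_1)"
  by (cases "even k") simp_all

lemma det_right_opp: "det_right k B = unopp (det_left k (\<lambda>i j. opp (B i j)))"
proof -
  have c: "x * of_int z = of_int z * x" for x :: 'a and z
    by (rule mult_of_int_commute[symmetric])
  show ?thesis
    unfolding det_left_def det_right_def
    by (simp add: unopp_sum unopp_mult unopp_of_int unopp_prod_list rev_map comp_def opp_inverse c)
qed

context central_scalars
begin

lemma csum_opp:
  "csum (\<lambda>x. opp (sc x)) (\<lambda>i j. opp (F i j)) r rt u p = opp (csum sc F r (\<lambda>x. \<not> rt x) u p)"
proof (induction p rule: less_induct)
  case (less p)
  show ?case
  proof (cases "p \<le> r")
    case True
    then show ?thesis by (simp add: csum_start opp_one)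
  next
    case False
    then have rp: "r < p" by simp
    have sc: "opp (sc c * X) = opp (sc c) * opp X" for c X
      by (simp only: sc_central[of c X] opp_mult)
    show ?thesis
      unfolding csum_rec[OF rp] opp_sum sc
      by (intro sum.cong refl) (simp add: less.IH opp_mult)
  qed
qed

text \<open>The shape of \<open>plus_matrix\<close> over an arbitrary ring, for use in the opposite
  algebra; likewise \<open>minus_hess\<close> for \<open>minus_matrix\<close>.\<close>

definition plus_hess :: "nat \<Rightarrow> (nat \<Rightarrow> nat \<Rightarrow> 'a) \<Rightarrow> (nat \<Rightarrow> 'c) \<Rightarrow> nat \<Rightarrow> nat \<Rightarrow> 'a"
  where "plus_hess r F a = (\<lambda>k l.
    if k \<le> l then F (r + l) (r + k - 1) else if k = l + 1 then - sc (a l) else 0)"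

definition minus_hess :: "nat \<Rightarrow> (nat \<Rightarrow> nat \<Rightarrow> 'a) \<Rightarrow> (nat \<Rightarrow> 'c) \<Rightarrow> nat \<Rightarrow> nat \<Rightarrow> 'a"
  where "minus_hess m F b = (\<lambda>k l.
    if k > l then F (m + k) (m + l) else if k = l then sc (b l) else 0)"

text \<open>Column \<open>q\<close> holds the links ending at r + q, so the recursion of the
  determinant is that of \<open>csum\<close> with new links on the right. The minus sign of the
  subdiagonal cancels that of the expansion.\<close>

lemma det_right_plus_hess:
  "det_right q (plus_hess r F a) = csum sc F r (\<lambda>_. True) (\<lambda>x. a (x - r)) (r + q)"
proof (induction q rule: less_induct)
  case (less q)
  show ?case
  proof (cases "q = 0")
    case True
    then show ?thesis by (simp add: det_right_def csum_start)
  next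
    case False
    let ?M = "plus_hess r F a"
    have "det_right q ?M = (\<Sum>k=1..q. sc (\<Prod>l=k..<q. - (- a l)) * det_right (k - 1) ?M * ?M k q)"
      by (rule hessenberg_recursion) (use False in \<open>auto simp: plus_hess_def sc_minus\<close>)
    also have "\<dots> = (\<Sum>k=r..<r + q. sc (\<Prod>x\<in>{k<..<r + q}. a (x - r)) *
        (csum sc F r (\<lambda>_. True) (\<lambda>x. a (x - r)) k * F (r + q) k))"
    proof (rule sum.reindex_bij_witness[of _ "\<lambda>k. k + 1 - r" "\<lambda>k. r + k - 1"])
      fix k assume k: "k \<in> {1..q}"
      have "(\<Prod>x\<in>{r + k - 1<..<r + q}. a (x - r)) = (\<Prod>l=k..<q. a l)"
        by (rule prod.reindex_bij_witness[of _ "\<lambda>l. r + l" "\<lambda>x. x - r"]) (use k in auto)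
      moreover have "det_right (k - 1) ?M = csum sc F r (\<lambda>_. True) (\<lambda>x. a (x - r)) (r + k - 1)"
      proof -
        have "k - 1 < q" "r + (k - 1) = r + k - 1" using k by auto
        then show ?thesis using less.IH[of "k - 1"] by simp
      qed
      ultimately show "sc (\<Prod>x\<in>{r + k - 1<..<r + q}. a (x - r)) *
          (csum sc F r (\<lambda>_. True) (\<lambda>x. a (x - r)) (r + k - 1) * F (r + q) (r + k - 1))
        = sc (\<Prod>l=k..<q. - (- a l)) * det_right (k - 1) ?M * ?M k q"
        using k by (simp add: plus_hess_def mult.assoc)
    qed auto
    also have "\<dots> = csum sc F r (\<lambda>_. True) (\<lambda>x. a (x - r)) (r + q)"
      using False by (simp add: csum_rec)
    finally show ?thesis .
  qed
qed

lemma det_right_del_row_plus_hess: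
  assumes "1 \<le> j" "j \<le> p + 1"
  shows "det_right p (del_row j (plus_hess r F a)) =
    sc (\<Prod>l=j..p. - a l) * csum sc F r (\<lambda>_. True) (\<lambda>x. a (x - r)) (r + j - 1)"
proof -
  have "det_right p (del_row j (plus_hess r F a)) =
      sc (\<Prod>l=j..p. - a l) * det_right (j - 1) (plus_hess r F a)"
    by (rule hessenberg_del_row) (use assms in \<open>auto simp: plus_hess_def sc_minus\<close>)
  then show ?thesis using assms by (simp add: det_right_plus_hess)
qed

text \<open>Here chains grow from the other end: \<open>G i\<close> is the weighted sum over the
  chains from m + i to m + s.\<close>

lemma det_left_minus_hess:
  fixes m :: nat and F b
  assumes s: "1 \<le> s"
  obtains G where
    "\<And>i. 1 \<le> i \<Longrightarrow> i \<le> s \<Longrightarrow>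
      det_left (s - 1) (del_row i (minus_hess m F b)) = sc (\<Prod>l=1..<i. b l) * G i"
    "G s = 1"
    "\<And>i. 1 \<le> i \<Longrightarrow> i < s \<Longrightarrow>
      G i = (\<Sum>k\<in>{i<..s}. sc (\<Prod>x\<in>{i<..<k}. - b x) * G k * F (m + k) (m + i))"
proof -
  \<comment> \<open>Rows are counted down from s and columns from s - 1. Since there is one row more
    than columns, this moves the diagonal with the entries \<open>b\<close> to the
    subdiagonal.\<close>
  define N where "N = (\<lambda>k l. minus_hess m F b (s + 1 - k) (s - l))"
  define G where "G = (\<lambda>i. det_right (s - i) N)"
  show ?thesis
  proof (rule that[of G])
    fix i assume i: "1 \<le> i" "i \<le> s"
    have "det_left (s - 1) (del_row i (minus_hess m F b)) =
        det_right (s - 1) (\<lambda>k l. del_row i (minus_hess m F b) (s - 1 + 1 - k) (s - 1 + 1 - l))"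
      by (rule det_right_reverse[symmetric])
    also have "\<dots> = det_right (s - 1) (del_row (s + 1 - i) N)"
    proof (rule det_right_cong)
      fix k l assume "k \<in> {1..s - 1}" "l \<in> {1..s - 1}"
      moreover from this have "s - k + 1 = s + 1 - k" by auto
      ultimately show "del_row i (minus_hess m F b) (s - 1 + 1 - k) (s - 1 + 1 - l) = del_row (s + 1 - i) N k l"
        using i s by (auto simp: del_row_def N_def)
    qed
    also have "\<dots> = sc (\<Prod>l=s+1-i..s-1. b (s - l)) * det_right (s + 1 - i - 1) N"
      by (rule hessenberg_del_row) (use i in \<open>auto simp: N_def minus_hess_def\<close>)
    also have "(\<Prod>l=s+1-i..s-1. b (s - l)) = (\<Prod>l=1..<i. b l)"
      by (rule prod.reindex_bij_witness[of _ "\<lambda>l. s - l" "\<lambda>l. s - l"]) (use i in auto)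
    finally show "det_left (s - 1) (del_row i (minus_hess m F b)) = sc (\<Prod>l=1..<i. b l) * G i"
      using i by (simp add: G_def)
  next
    show "G s = 1" by (simp add: G_def det_right_def)
  next
    fix i assume i: "1 \<le> i" "i < s"
    have "G i = (\<Sum>k=1..s - i. sc (\<Prod>l=k..<s - i. - b (s - l)) * det_right (k - 1) N * N k (s - i))"
      unfolding G_def by (rule hessenberg_recursion) (use i in \<open>auto simp: N_def minus_hess_def\<close>)
    also have "\<dots> = (\<Sum>k\<in>{i<..s}. sc (\<Prod>x\<in>{i<..<k}. - b x) * G k * F (m + k) (m + i))"
    proof (rule sum.reindex_bij_witness[of _ "\<lambda>k. s + 1 - k" "\<lambda>k. s + 1 - k"])
      fix k assume k: "k \<in> {1..s - i}"
      have "(\<Prod>x\<in>{i<..<s + 1 - k}. - b x) = (\<Prod>l=k..<s - i. - b (s - l))"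
        by (rule prod.reindex_bij_witness[of _ "\<lambda>l. s - l" "\<lambda>l. s - l"]) (use i k in auto)
      moreover have "s - (s + 1 - k) = k - 1" using k by auto
      moreover have "N k (s - i) = F (m + (s + 1 - k)) (m + i)"
        using k i by (auto simp: N_def minus_hess_def)
      ultimately show "sc (\<Prod>x\<in>{i<..<s + 1 - k}. - b x) * G (s + 1 - k) * F (m + (s + 1 - k)) (m + i)
         = sc (\<Prod>l=k..<s - i. - b (s - l)) * det_right (k - 1) N * N k (s - i)"
        unfolding G_def by (simp only:)
    qed (use i in auto)
    finally show "G i = (\<Sum>k\<in>{i<..s}. sc (\<Prod>x\<in>{i<..<k}. - b x) * G k * F (m + k) (m + i))" .
  qed
qed

text \<open>The chains are split at their unique odd link; \<open>G\<close> solves the recursion of \<open>csum\<close> in the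
  even part beyond that link from the other end.\<close>

lemma det_sum_eq_csum:
  fixes F :: "nat \<Rightarrow> nat \<Rightarrow> 'a" and a b :: "nat \<Rightarrow> 'c" and r m s :: nat
  assumes r: "r \<le> m" and s: "1 \<le> s"
  shows "(\<Sum>j=1..m-r+1. \<Sum>i=1..s. (-1) ^ (i + j + r + m) *
       (det_left (s - 1) (del_row i (minus_hess m F b)) *
        det_right (m - r) (del_row j (plus_hess r F a)) * F (m + i) (j + r - 1)))
     = csum sc F r (\<lambda>x. x \<le> m) (\<lambda>x. if x \<le> m then a (x - r) else - b (x - m)) (m + s)"
proof -
  define \<kappa> where "\<kappa> = (\<lambda>x. if x \<le> m then a (x - r) else - b (x - m))"
  define T where "T = csum sc F r (\<lambda>x. x \<le> m) \<kappa>"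
  let ?K = "\<lambda>k p. \<Prod>x\<in>{k<..<p}. \<kappa> x"
  obtain G where G1: "\<And>i. 1 \<le> i \<Longrightarrow> i \<le> s \<Longrightarrow>
      det_left (s - 1) (del_row i (minus_hess m F b)) = sc (\<Prod>l=1..<i. b l) * G i"
    and G2: "G s = 1"
    and G3: "\<And>i. 1 \<le> i \<Longrightarrow> i < s \<Longrightarrow>
      G i = (\<Sum>k\<in>{i<..s}. sc (\<Prod>x\<in>{i<..<k}. - b x) * G k * F (m + k) (m + i))"
    using det_left_minus_hess[OF s, of m F b] by blast
  have T_low: "csum sc F r (\<lambda>_. True) (\<lambda>x. a (x - r)) p = T p" if "p \<le> m" for p
    unfolding T_def by (rule csum_cong) (use that in \<open>auto simp: \<kappa>_def\<close>)
  have trm: "(-1) ^ (i + j + r + m) * (det_left (s - 1) (del_row i (minus_hess m F b)) *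
        det_right (m - r) (del_row j (plus_hess r F a)) * F (m + i) (j + r - 1))
      = sc (?K (r + j - 1) (m + i)) * (G i * (T (r + j - 1) * F (m + i) (r + j - 1)))"
    if i: "i \<in> {1..s}" and j: "j \<in> {1..m-r+1}" for i j
  proof -
    have rj: "r + j - 1 \<le> m" using j r by auto
    let ?A = "\<Prod>l=j..m-r. a l" and ?B = "\<Prod>l=1..<i. - b l"
    have A: "(\<Prod>l=j..m-r. - a l) = (-1) ^ (m - r + 1 - j) * ?A" by (simp add: prod_uminus)
    have B: "(\<Prod>l=1..<i. b l) = (-1) ^ (i - 1) * ?B"
      by (simp add: prod_uminus mult.assoc[symmetric] power_add[symmetric] mult_2[symmetric])
    have K: "?K (r + j - 1) (m + i) = ?A * ?B"
    proof -
      have "{r + j - 1<..<m + i} = {r + j - 1<..m} \<union> {m<..<m + i}" using i j r by auto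
      then have "?K (r + j - 1) (m + i) = (\<Prod>x\<in>{r + j - 1<..m}. \<kappa> x) * (\<Prod>x\<in>{m<..<m + i}. \<kappa> x)"
        by (simp only:) (rule prod.union_disjoint, auto)
      also have "(\<Prod>x\<in>{r + j - 1<..m}. \<kappa> x) = ?A"
        by (rule prod.reindex_bij_witness[of _ "\<lambda>l. r + l" "\<lambda>x. x - r"]) (use j r in \<open>auto simp: \<kappa>_def\<close>)
      also have "(\<Prod>x\<in>{m<..<m + i}. \<kappa> x) = ?B"
        by (rule prod.reindex_bij_witness[of _ "\<lambda>l. m + l" "\<lambda>x. x - m"]) (auto simp: \<kappa>_def)
      finally show ?thesis .
    qed
    \<comment> \<open>The sign of the formula, together with the signs of negating i - 1 factors
      \<open>b\<close> and m - r + 1 - j factors \<open>a\<close>, is an even power of -1.\<close>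
    have e: "(i + j + r + m) + ((i - 1) + (m - r + 1 - j)) = 2 * (m + i)"
    proof -
      obtain f where "m = (r + j - 1) + f" using le_Suc_ex[OF rj] by blast
      moreover have "1 \<le> i" "1 \<le> j" using i j by auto
      ultimately show ?thesis by (cases i; cases j) auto
    qed
    have "(-1) ^ (i + j + r + m) * ((\<Prod>l=1..<i. b l) * (\<Prod>l=j..m-r. - a l)) = ?A * ?B"
    proof -
      have "(-1) ^ (i + j + r + m) * ((\<Prod>l=1..<i. b l) * (\<Prod>l=j..m-r. - a l))
          = (-1) ^ ((i + j + r + m) + ((i - 1) + (m - r + 1 - j))) * (?A * ?B)"
        unfolding A B power_add by (simp only: mult_ac)
      then show ?thesis unfolding e by simp
    qed
    then have sc: "sc ((-1) ^ (i + j + r + m)) * (sc (\<Prod>l=1..<i. b l) * sc (\<Prod>l=j..m-r. - a l))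
        = sc (?K (r + j - 1) (m + i))"
      unfolding K sc_mult[symmetric] by simp
    have d: "det_right (m - r) (del_row j (plus_hess r F a)) = sc (\<Prod>l=j..m-r. - a l) * T (r + j - 1)"
      using det_right_del_row_plus_hess[of j "m - r"] T_low[OF rj] j by simp
    have "(-1) ^ (i + j + r + m) * (det_left (s - 1) (del_row i (minus_hess m F b)) *
        det_right (m - r) (del_row j (plus_hess r F a)) * F (m + i) (j + r - 1))
      = sc ((-1) ^ (i + j + r + m)) * ((sc (\<Prod>l=1..<i. b l) * G i) *
        (sc (\<Prod>l=j..m-r. - a l) * T (r + j - 1)) * F (m + i) (r + j - 1))"
      using G1[of i] i d by (simp add: sc_power sc_minus sc_1 add.commute)
    also have "\<dots> = (sc ((-1) ^ (i + j + r + m)) * (sc (\<Prod>l=1..<i. b l) * sc (\<Prod>l=j..m-r. - a l))) *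
        (G i * (T (r + j - 1) * F (m + i) (r + j - 1)))"
      by (simp only: mult.assoc sc_left_commute[of "G i"])
    finally show ?thesis unfolding sc .
  qed
  have "(\<Sum>j=1..m-r+1. \<Sum>i=1..s. (-1) ^ (i + j + r + m) *
       (det_left (s - 1) (del_row i (minus_hess m F b)) *
        det_right (m - r) (del_row j (plus_hess r F a)) * F (m + i) (j + r - 1)))
     = (\<Sum>j=1..m-r+1. \<Sum>i=1..s. sc (?K (r + j - 1) (m + i)) * (G i * (T (r + j - 1) * F (m + i) (r + j - 1))))"
    by (intro sum.cong refl trm)
  also have "\<dots> = (\<Sum>i=1..s. \<Sum>j=1..m-r+1. sc (?K (r + j - 1) (m + i)) * (G i * (T (r + j - 1) * F (m + i) (r + j - 1))))"
    by (rule sum.swap)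
  \<comment> \<open>The sum over the sites up to m is the recursion of \<open>T (m + i)\<close>
    without the links leaving sites beyond m; these are subtracted.\<close>
  also have "\<dots> = (\<Sum>i=1..s. G i * T (m + i)
      - (\<Sum>k=1..<i. sc (\<Prod>x\<in>{k<..<i}. - b x) * G i * F (m + i) (m + k) * T (m + k)))"
  proof (rule sum.cong[OF refl])
    fix i assume i: "i \<in> {1..s}"
    have "(\<Sum>j=1..m-r+1. sc (?K (r + j - 1) (m + i)) * (G i * (T (r + j - 1) * F (m + i) (r + j - 1))))
      = (\<Sum>p=r..m. sc (?K p (m + i)) * (G i * (T p * F (m + i) p)))"
      by (rule sum.reindex_bij_witness[of _ "\<lambda>p. p + 1 - r" "\<lambda>j. r + j - 1"]) (use r in auto)
    also have "\<dots> = G i * (\<Sum>p=r..m. sc (?K p (m + i)) * (T p * F (m + i) p))"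
      by (simp only: sum_distrib_left sc_left_commute)
    also have "(\<Sum>p=r..m. sc (?K p (m + i)) * (T p * F (m + i) p)) = T (m + i)
        - (\<Sum>k=1..<i. sc (\<Prod>x\<in>{k<..<i}. - b x) * (F (m + i) (m + k) * T (m + k)))"
    proof -
      let ?f = "\<lambda>p. sc (?K p (m + i)) * (if p \<le> m then T p * F (m + i) p else F (m + i) p * T p)"
      have "T (m + i) = (\<Sum>p=r..<m + i. ?f p)"
        unfolding T_def by (rule csum_rec) (use r i in auto)
      also have "{r..<m + i} = {r..m} \<union> {m<..<m + i}" using r i by auto
      also have "(\<Sum>p\<in>{r..m} \<union> {m<..<m + i}. ?f p) = (\<Sum>p=r..m. ?f p) + (\<Sum>p\<in>{m<..<m + i}. ?f p)"
        by (rule sum.union_disjoint) auto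
      also have "(\<Sum>p=r..m. ?f p) = (\<Sum>p=r..m. sc (?K p (m + i)) * (T p * F (m + i) p))"
        by (intro sum.cong) auto
      also have "(\<Sum>p\<in>{m<..<m + i}. ?f p) =
          (\<Sum>k=1..<i. sc (\<Prod>x\<in>{k<..<i}. - b x) * (F (m + i) (m + k) * T (m + k)))"
      proof (rule sum.reindex_bij_witness[of _ "\<lambda>k. m + k" "\<lambda>p. p - m"])
        fix p assume p: "p \<in> {m<..<m + i}"
        have "?K p (m + i) = (\<Prod>x\<in>{p - m<..<i}. - b x)"
          by (rule prod.reindex_bij_witness[of _ "\<lambda>x. m + x" "\<lambda>x. x - m"]) (use p in \<open>auto simp: \<kappa>_def\<close>)
        then show "sc (\<Prod>x\<in>{p - m<..<i}. - b x) * (F (m + i) (m + (p - m)) * T (m + (p - m))) = ?f p"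
          using p by simp
      qed auto
      finally show ?thesis by simp
    qed
    also have "G i * (T (m + i) - (\<Sum>k=1..<i. sc (\<Prod>x\<in>{k<..<i}. - b x) * (F (m + i) (m + k) * T (m + k))))
      = G i * T (m + i) - (\<Sum>k=1..<i. sc (\<Prod>x\<in>{k<..<i}. - b x) * G i * F (m + i) (m + k) * T (m + k))"
      by (simp only: right_diff_distrib sum_distrib_left sc_left_commute mult.assoc)
    finally show "(\<Sum>j=1..m-r+1. sc (?K (r + j - 1) (m + i)) * (G i * (T (r + j - 1) * F (m + i) (r + j - 1))))
      = G i * T (m + i) - (\<Sum>k=1..<i. sc (\<Prod>x\<in>{k<..<i}. - b x) * G i * F (m + i) (m + k) * T (m + k))" .
  qed
  \<comment> \<open>After exchanging the sums, the recursion of \<open>G\<close> turns the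
    subtracted terms into G k * T (m + k), so that only the term i = s, with G s = 1,
    survives.\<close>
  also have "\<dots> = (\<Sum>i=1..s. G i * T (m + i)) - (\<Sum>k=1..<s. G k * T (m + k))"
  proof -
    let ?g = "\<lambda>i k. sc (\<Prod>x\<in>{k<..<i}. - b x) * G i * F (m + i) (m + k) * T (m + k)"
    have "(\<Sum>i=1..s. \<Sum>k=1..<i. ?g i k) = (\<Sum>i=1..<s+1. \<Sum>k=1..<i. ?g i k)"
      by (simp add: atLeastLessThanSuc_atLeastAtMost)
    also have "\<dots> = (\<Sum>k=1..<s+1. \<Sum>i\<in>{k<..<s+1}. ?g i k)" by (rule sum_triangle_swap)
    also have "\<dots> = (\<Sum>k=1..<s. \<Sum>i\<in>{k<..<s+1}. ?g i k)"
    proof -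
      have "{1..<s+1} = insert s {1..<s}" "{s<..<s+1} = {}" using s by auto
      then show ?thesis by (simp only: sum.insert finite_atLeastLessThan) simp
    qed
    also have "\<dots> = (\<Sum>k=1..<s. G k * T (m + k))"
    proof (rule sum.cong[OF refl])
      fix k assume k: "k \<in> {1..<s}"
      have "{k<..<s+1} = {k<..s}" by auto
      then show "(\<Sum>i\<in>{k<..<s+1}. ?g i k) = G k * T (m + k)"
        using G3[of k] k by (simp add: sum_distrib_right)
    qed
    finally show ?thesis by (simp only: sum_subtractf)
  qed
  also have "\<dots> = T (m + s)"
  proof -
    have "{1..s} = insert s {1..<s}" using s by auto
    then show ?thesis using G2 by simp
  qed
  finally show ?thesis by (simp only: T_def \<kappa>_def)
qed

text \<open>The second formula is the first one in the opposite algebra.\<close>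

lemma det_sum_eq_csum_opp:
  fixes F :: "nat \<Rightarrow> nat \<Rightarrow> 'a" and a b :: "nat \<Rightarrow> 'c" and r m s :: nat
  assumes "r \<le> m" "1 \<le> s"
  shows "(\<Sum>j=1..m-r+1. \<Sum>i=1..s. (-1) ^ (i + j + r + m) *
       (F (m + i) (j + r - 1) * (det_left (m - r) (del_row j (plus_hess r F a)) *
        det_right (s - 1) (del_row i (minus_hess m F b)))))
     = csum sc F r (\<lambda>x. \<not> x \<le> m) (\<lambda>x. if x \<le> m then a (x - r) else - b (x - m)) (m + s)"
proof -
  interpret o: central_scalars "\<lambda>x. opp (sc x)" by (rule central_scalars_opp)
  let ?F = "\<lambda>i j. opp (F i j)"
  have p: "del_row j (o.plus_hess r ?F a) = (\<lambda>k l. opp (del_row j (plus_hess r F a) k l))" for j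
    by (auto simp: fun_eq_iff del_row_def o.plus_hess_def plus_hess_def uminus_opp_def opp_inverse zero_opp_def)
  have q: "del_row i (o.minus_hess m ?F b) = (\<lambda>k l. opp (del_row i (minus_hess m F b) k l))" for i
    by (auto simp: fun_eq_iff del_row_def o.minus_hess_def minus_hess_def zero_opp_def)
  have "(\<Sum>j=1..m-r+1. \<Sum>i=1..s. (-1) ^ (i + j + r + m) *
       (det_left (s - 1) (del_row i (o.minus_hess m ?F b)) *
        det_right (m - r) (del_row j (o.plus_hess r ?F a)) * ?F (m + i) (j + r - 1)))
     = opp (csum sc F r (\<lambda>x. \<not> x \<le> m) (\<lambda>x. if x \<le> m then a (x - r) else - b (x - m)) (m + s))"
    unfolding csum_opp[symmetric] by (rule o.det_sum_eq_csum[OF assms])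
  from arg_cong[OF this, of unopp] show ?thesis
    unfolding p q unopp_sum
    by (simp add: unopp_mult unopp_sign det_left_opp[symmetric] det_right_opp[symmetric] opp_inverse
      minus_one_power_commute)
qed

end

lemma det_right_commute:
  assumes "\<And>i j. i \<in> {1..k} \<Longrightarrow> j \<in> {1..k} \<Longrightarrow> x * B i j = B i j * x"
  shows "x * det_right k B = det_right k B * x"
proof -
  have "x * (of_int (sign w) * prod_list (map (\<lambda>i. B (w i) i) [1..<k+1]))
      = of_int (sign w) * prod_list (map (\<lambda>i. B (w i) i) [1..<k+1]) * x"
    if w: "w permutes {1..k}" for w
  proof -
    have "x * prod_list (map (\<lambda>i. B (w i) i) [1..<k+1]) = prod_list (map (\<lambda>i. B (w i) i) [1..<k+1]) * x"
    proof (rule prod_list_commute)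
      fix y assume "y \<in> set (map (\<lambda>i. B (w i) i) [1..<k+1])"
      then obtain i where "i \<in> set [1..<k+1]" "y = B (w i) i" by (auto simp del: upt_Suc)
      then have "i \<in> {1..k}" "y = B (w i) i" by (simp_all del: upt_Suc)
      then show "x * y = y * x" using assms[of "w i" i] permutes_in_image[OF w, of i] by simp
    qed
    then show ?thesis by (simp only: of_int_left_commute mult.assoc)
  qed
  then show ?thesis
    unfolding det_right_def sum_distrib_left sum_distrib_right by (intro sum.cong refl) simp
qed

lemma det_left_commute:
  assumes "\<And>i j. i \<in> {1..k} \<Longrightarrow> j \<in> {1..k} \<Longrightarrow> x * B i j = B i j * x"
  shows "x * det_left k B = det_left k B * x"
proof -
  have "opp x * det_right k (\<lambda>i j. opp (B i j)) = det_right k (\<lambda>i j. opp (B i j)) * opp x"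
    by (rule det_right_commute) (simp only: opp_mult[symmetric] assms)
  from arg_cong[OF this, of unopp] show ?thesis
    by (simp add: unopp_mult det_left_opp opp_inverse)
qed

section \<open>The weight \<open>\<rho>\<close>\<close>

lemma sum_root_weight_set:
  assumes "finite S"
  shows "(\<Sum>\<alpha>\<in>S. root_weight \<alpha> k) =
    (of_nat (card {\<alpha>\<in>S. fst \<alpha> = k}) - of_nat (card {\<alpha>\<in>S. snd \<alpha> = k}) :: 'k::comm_ring_1)"
proof -
  have "(\<Sum>\<alpha>\<in>S. root_weight \<alpha> k) =
      (\<Sum>\<alpha>\<in>S. (if fst \<alpha> = k then 1 else 0) - (if snd \<alpha> = k then 1 else 0 :: 'k))"
    by (intro sum.cong refl) (auto simp: root_weight_def coord_def)
  also have "\<dots> = of_nat (card {\<alpha>\<in>S. fst \<alpha> = k}) - of_nat (card {\<alpha>\<in>S. snd \<alpha> = k})"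
    using assms by (simp add: sum_subtractf sum.If_cases Int_def)
  finally show ?thesis .
qed

lemma finite_pos_roots: "finite (pos_roots m n)"
  by (rule finite_subset[of _ "{1..m+n} \<times> {1..m+n}"]) (auto simp: pos_roots_def)

lemma rho_card:
  "rho m n k = (1/2 * (of_nat (card {\<alpha>\<in>even_pos_roots m n. fst \<alpha> = k}) - of_nat (card {\<alpha>\<in>even_pos_roots m n. snd \<alpha> = k}))
    - 1/2 * (of_nat (card {\<alpha>\<in>odd_pos_roots m n. fst \<alpha> = k}) - of_nat (card {\<alpha>\<in>odd_pos_roots m n. snd \<alpha> = k})) :: 'k::field)"
proof -
  have "finite (even_pos_roots m n)" "finite (odd_pos_roots m n)"
    using finite_pos_roots[of m n] by (auto simp: even_pos_roots_def odd_pos_roots_def)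
  then show ?thesis by (simp only: rho_def sum_root_weight_set)
qed

lemma even_pos_roots_eq: "even_pos_roots m n = {(i, j). 1 \<le> i \<and> i < j \<and> j \<le> m + n \<and> (j \<le> m \<or> m < i)}"
  unfolding even_pos_roots_def pos_roots_def parity_def
  by (rule set_eqI, rename_tac x, case_tac x, case_tac "fst x \<le> m", auto)

lemma odd_pos_roots_eq: "odd_pos_roots m n = {(i, j). 1 \<le> i \<and> i \<le> m \<and> m < j \<and> j \<le> m + n}"
  unfolding odd_pos_roots_def pos_roots_def parity_def
  by (rule set_eqI, rename_tac x, case_tac x, case_tac "fst x \<le> m", auto)

lemma rho_eps:
  assumes "1 \<le> k" "k \<le> m"
  shows "rho m n k = (1/2 * (of_nat (m - k) - of_nat (k - 1)) - 1/2 * of_nat n :: 'k::field)"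
proof -
  have 1: "{\<alpha>\<in>even_pos_roots m n. fst \<alpha> = k} = {k} \<times> {k<..m}"
    and 2: "{\<alpha>\<in>even_pos_roots m n. snd \<alpha> = k} = {1..<k} \<times> {k}"
    and 3: "{\<alpha>\<in>odd_pos_roots m n. fst \<alpha> = k} = {k} \<times> {m<..m+n}"
    and 4: "{\<alpha>\<in>odd_pos_roots m n. snd \<alpha> = k} = {}"
    using assms by (auto simp: even_pos_roots_eq odd_pos_roots_eq)
  show ?thesis
    unfolding rho_card 1 2 3 4 by (simp add: card_cartesian_product)
qed

lemma rho_del:
  assumes "m < k" "k \<le> m + n"
  shows "rho m n k = (1/2 * (of_nat (m + n - k) - of_nat (k - m - 1)) + 1/2 * of_nat m :: 'k::field)"
proof -
  have 1: "{\<alpha>\<in>even_pos_roots m n. fst \<alpha> = k} = {k} \<times> {k<..m+n}"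
    and 2: "{\<alpha>\<in>even_pos_roots m n. snd \<alpha> = k} = {m<..<k} \<times> {k}"
    and 3: "{\<alpha>\<in>odd_pos_roots m n. fst \<alpha> = k} = {}"
    and 4: "{\<alpha>\<in>odd_pos_roots m n. snd \<alpha> = k} = {1..m} \<times> {k}"
    using assms by (auto simp: even_pos_roots_eq odd_pos_roots_eq)
  show ?thesis
    unfolding rho_card 1 2 3 4 by (simp add: card_cartesian_product)
qed

text \<open>This is (\<rho>, \<alpha>^vee) = 1 for an even simple root \<alpha>, in
  coordinates.\<close>

lemma rho_simple_even:
  assumes "1 \<le> k" "k < m + n" "k \<noteq> m"
  shows "rho m n k = rho m n (k + 1) + (1 :: 'k::field_char_0)"
proof (cases "k < m")
  case True
  have "m - k = Suc (m - (k + 1))" "k + 1 - 1 = Suc (k - 1)" using True assms by auto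
  then have "of_nat (m - k) = (of_nat (m - (k + 1)) + 1 :: 'k)" "of_nat (k + 1 - 1) = (of_nat (k - 1) + 1 :: 'k)"
    by (simp_all only: of_nat_Suc add.commute)
  then show ?thesis using True assms by (simp only: rho_eps) (simp add: rho_eps field_simps)
next
  case False
  have "m + n - k = Suc (m + n - (k + 1))" "k + 1 - m - 1 = Suc (k - m - 1)" using False assms by auto
  then have "of_nat (m + n - k) = (of_nat (m + n - (k + 1)) + 1 :: 'k)"
    "of_nat (k + 1 - m - 1) = (of_nat (k - m - 1) + 1 :: 'k)"
    by (simp_all only: of_nat_Suc add.commute)
  then show ?thesis using False assms by (simp add: rho_del field_simps)
qed

text \<open>This is (\<rho>, \<alpha>) = 0 for the odd simple root, the plus sign coming from the
  form.\<close>

lemma rho_simple_odd: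
  assumes "1 \<le> m" "1 \<le> n"
  shows "rho m n m + rho m n (m + 1) = (0 :: 'k::field_char_0)"
proof -
  have 1: "rho m n m = ((1 - of_nat m - of_nat n) / 2 :: 'k)"
    using assms by (simp add: rho_eps of_nat_diff field_simps)
  have 2: "rho m n (m + 1) = ((of_nat n - 1 + of_nat m) / 2 :: 'k)"
    using assms by (simp add: rho_del of_nat_diff field_simps)
  show ?thesis by (simp only: 1 2 add_divide_distrib[symmetric]) simp
qed

lemma form_coord_diff:
  assumes "i \<in> {1..m+n}" "j \<in> {1..m+n}"
  shows "form m n \<mu> (\<lambda>k. coord i k - coord j k) =
    ((if i \<le> m then \<mu> i else - \<mu> i) - (if j \<le> m then \<mu> j else - \<mu> j) :: 'k::comm_ring_1)"
proof -
  have c: "form m n \<mu> (coord i) = (if i \<le> m then \<mu> i else - \<mu> i)" if "i \<in> {1..m+n}" for i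
  proof -
    have "(\<Sum>k=1..m. \<mu> k * coord i k) = (\<Sum>k=1..m. if k = i then \<mu> k else 0)"
      by (intro sum.cong) (auto simp: coord_def)
    moreover have "(\<Sum>k=1..n. \<mu> (m + k) * coord i (m + k)) = (\<Sum>k=1..n. if k = i - m then if i > m then \<mu> i else 0 else 0)"
      by (intro sum.cong) (auto simp: coord_def)
    ultimately show ?thesis using that by (auto simp: form_def)
  qed
  have "form m n \<mu> (\<lambda>k. coord i k - coord j k) = form m n \<mu> (coord i) - form m n \<mu> (coord j)"
    by (simp add: form_def right_diff_distrib sum_subtractf)
  then show ?thesis by (simp only: c assms)
qed

lemma form_scale: "form m n \<mu> (\<lambda>k. c * \<nu> k) = c * form m n \<mu> \<nu>"
  by (simp add: form_def sum_distrib_left right_diff_distrib mult.left_commute)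

lemma coroot_pairing:
  "form m n \<mu> (coroot m n \<alpha>) = 2 / form m n \<alpha> \<alpha> * form m n \<mu> \<alpha>"
proof -
  have "coroot m n \<alpha> = (\<lambda>k. (2 / form m n \<alpha> \<alpha>) * \<alpha> k)"
    by (simp add: coroot_def)
  then show ?thesis by (simp only: form_scale)
qed

text \<open>The square of the root is 2 here and -2 in \<open>b_coef_eq\<close>. In the latter case
  the sign from the coroot cancels that of the form, so both coefficients are plain differences of
  coordinates.\<close>

lemma a_coef_eq:
  assumes "1 \<le> r" "1 \<le> j" "r + j \<le> m"
  shows "a_coef m n lam r j = (rho_shift m n lam r - rho_shift m n lam (r + j) :: 'k::field_char_0)"
  using assms by (simp add: a_coef_def coroot_pairing eps_def form_coord_diff) (simp add: coord_def)

lemma b_coef_eq: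
  assumes "1 \<le> i" "i < s" "s \<le> n"
  shows "b_coef m n lam s i = (rho_shift m n lam (m + i) - rho_shift m n lam (m + s) :: 'k::field_char_0)"
  using assms by (simp add: b_coef_def coroot_pairing del_def form_coord_diff) (simp add: coord_def diff_divide_distrib)

lemma plus_matrix_hess: "plus_matrix r a = scal.plus_hess r E a"
  by (simp add: plus_matrix_def scal.plus_hess_def)

lemma minus_matrix_hess: "minus_matrix m b = scal.minus_hess m E b"
  by (simp add: minus_matrix_def scal.minus_hess_def)

text \<open>The root vectors in the two matrices have their indices in r, ..., m and in m + 1, ...,
  m + s respectively, so the entries commute.\<close>

lemma det_plus_minus_commute:
  assumes m: "m = CARD('m::finite)" and r: "1 \<le> r" "r \<le> m" and s: "1 \<le> s" "s \<le> CARD('n::finite)"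
  shows "det_right (m - r) (del_row j (plus_matrix r a)) * det_left (s - 1) (del_row i (minus_matrix m b))
    = (det_left (s - 1) (del_row i (minus_matrix m b)) * det_right (m - r) (del_row j (plus_matrix r a))
       :: ('k::field, 'm, 'n) ugl)"
proof (rule det_left_commute, rule sym, rule det_right_commute)
  fix k l k' l' assume kl: "k \<in> {1..s - 1}" "l \<in> {1..s - 1}" "k' \<in> {1..m - r}" "l' \<in> {1..m - r}"
  have comm: "E p q * E p' q' = (E p' q' * E p q :: ('k, 'm, 'n) ugl)"
    if "m < q" "q < p" "p \<le> m + s" "r \<le> q'" "q' < p'" "p' \<le> m" for p q p' q'
    by (rule lower_commute) (use that r s m in auto)
  show "del_row i (minus_matrix m b) k l * del_row j (plus_matrix r a) k' l' =
      (del_row j (plus_matrix r a) k' l' * del_row i (minus_matrix m b) k l :: ('k, 'm, 'n) ugl)"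
    using kl by (auto simp: del_row_def minus_matrix_def plus_matrix_def scal_central intro!: comm)
qed

theorem theorem8p1:
  fixes m n r s :: nat
    and lam :: "'k::{alg_closed_field, field_char_0} weight"
    and rs :: "(nat \<times> nat) list"
    and H :: "(nat \<times> nat) multiset \<Rightarrow> 'k cartan_poly"
  assumes m: "m = CARD('m::finite)" and n: "n = CARD('n::finite)"
    and r: "1 \<le> r" "r \<le> m" and s: "1 \<le> s" "s \<le> n"
    and lam: "form m n (rho_shift m n lam) (\<lambda>k. eps r k - del m s k) = 0"
    and rs: "root_order m n rs"
    and H: "sapovalov TYPE('m) TYPE('n) rs (r, m + s) H"
  shows "(sap_eval m n rs (r, m + s) H lam :: ('k, 'm, 'n) ugl) =
      (-1) ^ (m + r) *
      (\<Sum>j=1..m-r+1. \<Sum>i=1..s. (-1) ^ (i + j) *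
         det_right (m - r) (del_row j (A_plus m n lam r)) *
         det_left (s - 1) (del_row i (A_minus m n lam s)) *
         E (m + i) (j + r - 1))
    \<and> (sap_eval m n rs (r, m + s) H lam :: ('k, 'm, 'n) ugl) =
      (\<Sum>j=1..m-r+1. \<Sum>i=1..s.
         E (m + i) (j + r - 1) * (-1) ^ (i + j + r + m) *
         det_left (m - r) (del_row j (B_plus m n lam r)) *
         det_right (s - 1) (del_row i (B_minus m n lam s)))"
proof -
  let ?L = "rho_shift m n lam"
  let ?a = "a_coef m n lam r" and ?b = "b_coef m n lam s"
  define u where "u = (\<lambda>x. if x \<le> m then ?a (x - r) - 1 else - ?b (x - m))"
  define T where "T = (csum scal E r (\<lambda>_. False) u (m + s) :: ('k, 'm, 'n) ugl)"
  interpret chain_algebra "scal :: 'k \<Rightarrow> ('k, 'm, 'n) ugl" E r "m + n"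
    unfolding m n by (rule chain_algebra_ugl[OF r(1)])
  have N: "m + s \<le> m + n" using s by simp
  have root: "(\<lambda>k. eps r k - del m s k) = (root_weight (r, m + s) :: 'k weight)"
    by (simp add: root_weight_def eps_def del_def fun_eq_iff)
  have lam': "?L r + ?L (m + s) = 0"
    using lam form_coord_diff[of r m n "m + s" ?L] r s by (simp add: eps_def del_def)

  have \<theta>: "(sap_eval m n rs (r, m + s) H lam :: ('k, 'm, 'n) ugl) = T"
    unfolding T_def m n
  proof (rule sap_eval_eq_csum)
    fix i assume i: "r \<le> i" "i + 1 < CARD('m) + s"
    have iN: "i < m + n" "i + 1 < m + s" using i N by (auto simp: m)
    have L: "lam k = ?L k - rho m n k" for k by (simp add: rho_shift_def)
    have a: "?a (x - r) = ?L r - ?L x" if "r < x" "x \<le> m" for x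
      using a_coef_eq[of r "x - r" m n lam] that r by simp
    have b: "?b (x - m) = ?L x - ?L (m + s)" if "m < x" "x < m + s" for x
      using b_coef_eq[of "x - m" s n m lam] that s by auto
    \<comment> \<open>For i = r the general expression is \<open>?L r - ?L r\<close>, which agrees
      with the exceptional value 0.\<close>
    have base: "(if i = r then 0 else u i + 1) = (if i \<le> m then ?L r - ?L i else ?L (m + s) - ?L i + 1)"
      using i r iN by (auto simp: u_def a b)
    consider "i < m" | "i = m" | "m < i" by linarith
    then have "(if i = m then -1 else 1) * u (i + 1) =
      (if i = r then 0 else u i + 1) + lam i - (if i = m then -1 else 1) * lam (i + 1)"
    proof cases
      case 1
      have e1: "u (i + 1) = ?L r - ?L (i + 1) - 1" using 1 i a[of "i + 1"] by (simp add: u_def)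
      have e2: "rho m n i = rho m n (i + 1) + (1 :: 'k)"
        by (rule rho_simple_even) (use 1 i r in auto)
      have e3: "(if i = r then 0 else u i + 1) = ?L r - ?L i" using 1 base by simp
      show ?thesis unfolding e3 e1 L[of i] L[of "i + 1"] e2 using 1 by simp
    next
      case 2
      have e1: "u (i + 1) = ?L (m + s) - ?L (i + 1)" using 2 iN b[of "i + 1"] by (simp add: u_def)
      have e2: "rho m n (i + 1) = (- rho m n i :: 'k)"
        using rho_simple_odd[of m n, where 'k='k] r s 2 by (simp add: add_eq_0_iff)
      have e3: "(if i = r then 0 else u i + 1) = ?L r - ?L i" using 2 base by simp
      \<comment> \<open>The recursion passes the odd simple root, where its sign changes, precisely
        because (\<lambda> + \<rho>, \<gamma>) = 0 identifies the reference value
        \<open>?L r\<close> of the weights before it with minus the reference value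
        \<open>?L (m + s)\<close> of those after it.\<close>
      have e4: "?L (m + s) = - ?L r" using lam' by (simp add: add_eq_0_iff)
      show ?thesis unfolding e3 e1 L[of i] L[of "i + 1"] e2 e4 using 2 by simp
    next
      case 3
      have e1: "u (i + 1) = ?L (m + s) - ?L (i + 1)" using 3 iN b[of "i + 1"] by (simp add: u_def)
      have e2: "rho m n i = rho m n (i + 1) + (1 :: 'k)"
        by (rule rho_simple_even) (use 3 i r iN in auto)
      have e3: "(if i = r then 0 else u i + 1) = ?L (m + s) - ?L i + 1" using 3 base by simp
      show ?thesis unfolding e3 e1 L[of i] L[of "i + 1"] e2 using 3 by simp
    qed
    then show "(if i = CARD('m) then -1 else 1) * u (i + 1) =
      (if i = r then 0 else u i + 1) + lam i - (if i = CARD('m) then -1 else 1) * lam (i + 1)"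
      by (simp only: m)
  qed (use H rs r s lam N in \<open>simp_all add: root flip: m n\<close>)

  have "(\<Sum>j=1..m-r+1. \<Sum>i=1..s. (-1) ^ (i + j + r + m) *
       (det_left (s - 1) (del_row i (minus_matrix m ?b)) *
        det_right (m - r) (del_row j (plus_matrix r ?a)) * E (m + i) (j + r - 1)))
     = (csum scal E r (\<lambda>x. x \<le> m) (\<lambda>x. if x \<le> m then ?a (x - r) else - ?b (x - m)) (m + s) :: ('k, 'm, 'n) ugl)"
    unfolding plus_matrix_hess minus_matrix_hess by (rule scal.det_sum_eq_csum[OF r(2) s(1)])
  also have "\<dots> = T"
    unfolding T_def u_def csum_flip[OF N, of "\<lambda>x. x \<le> m"] by (rule csum_cong) auto
  finally have 1: "T = (\<Sum>j=1..m-r+1. \<Sum>i=1..s. (-1) ^ (i + j + r + m) *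
       (det_left (s - 1) (del_row i (minus_matrix m ?b)) *
        det_right (m - r) (del_row j (plus_matrix r ?a)) * E (m + i) (j + r - 1)))" ..
  have 1: "T = (-1) ^ (m + r) * (\<Sum>j=1..m-r+1. \<Sum>i=1..s. (-1) ^ (i + j) *
         det_right (m - r) (del_row j (A_plus m n lam r)) *
         det_left (s - 1) (del_row i (A_minus m n lam s)) * E (m + i) (j + r - 1))"
    unfolding 1 A_plus_def A_minus_def sum_distrib_left
  proof (intro sum.cong refl)
    fix i j
    have "(-1) ^ (i + j + r + m) = ((-1) ^ (m + r) * (-1) ^ (i + j) :: ('k, 'm, 'n) ugl)"
      by (simp only: power_add[symmetric] add.commute add.left_commute)
    moreover have "det_right (m - r) (del_row j (plus_matrix r ?a)) * det_left (s - 1) (del_row i (minus_matrix m ?b))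
      = (det_left (s - 1) (del_row i (minus_matrix m ?b)) * det_right (m - r) (del_row j (plus_matrix r ?a))
         :: ('k, 'm, 'n) ugl)"
      using det_plus_minus_commute[OF m r s(1)] s n by simp
    ultimately show "(-1) ^ (i + j + r + m) * (det_left (s - 1) (del_row i (minus_matrix m ?b)) *
        det_right (m - r) (del_row j (plus_matrix r ?a)) * E (m + i) (j + r - 1)) =
      ((-1) ^ (m + r) * ((-1) ^ (i + j) * det_right (m - r) (del_row j (plus_matrix r ?a)) *
        det_left (s - 1) (del_row i (minus_matrix m ?b)) * E (m + i) (j + r - 1)) :: ('k, 'm, 'n) ugl)"
      by (simp only: mult.assoc[symmetric]) (simp only: mult.assoc)
  qed

  have "(\<Sum>j=1..m-r+1. \<Sum>i=1..s. (-1) ^ (i + j + r + m) *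
       (E (m + i) (j + r - 1) * (det_left (m - r) (del_row j (plus_matrix r (\<lambda>l. ?a l - 1))) *
        det_right (s - 1) (del_row i (minus_matrix m (\<lambda>l. ?b l - 1))))))
     = (csum scal E r (\<lambda>x. \<not> x \<le> m)
         (\<lambda>x. if x \<le> m then ?a (x - r) - 1 else - (?b (x - m) - 1)) (m + s) :: ('k, 'm, 'n) ugl)"
    unfolding plus_matrix_hess minus_matrix_hess by (rule scal.det_sum_eq_csum_opp[OF r(2) s(1)])
  also have "\<dots> = T"
    unfolding T_def u_def csum_flip[OF N, of "\<lambda>x. \<not> x \<le> m"] by (rule csum_cong) auto
  finally have 2: "T = (\<Sum>j=1..m-r+1. \<Sum>i=1..s.
         E (m + i) (j + r - 1) * (-1) ^ (i + j + r + m) *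
         det_left (m - r) (del_row j (B_plus m n lam r)) *
         det_right (s - 1) (del_row i (B_minus m n lam s)))"
    by (simp add: B_plus_def B_minus_def minus_one_power_commute mult.assoc)
  show ?thesis unfolding \<theta> using 1 2 by blast
qed

end
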